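(* Let $D_Y\subset\mathcal{P}_Y$ be the chamber defined in the context. Under any isometry $S_Y\cong L_{10}$ that maps $\mathcal{P}_Y$ to $\mathcal{P}_{10}$, the chamber $D_Y$ is a union of exactly $2^{14}\cdot3\cdot5\cdot7\cdot17\cdot31=906608640$ Vinberg chambers.
   Context: Let $F(x_1,\dots,x_4)$ be a general complex cubic form, $\overline{X}\subset\mathbb{P}^3$ the quartic Hessian surface $\det(\partial^2F/\partial x_i\partial x_j)=0$, with ten ordinary nodes $p_\alpha$ and ten lines $\ell_\beta$, indexed by the set $A$ of $3$-subsets and the set $B$ of $2$-subsets of $\{1,\dots,5\}$ so that $p_\alpha\in\ell_\beta$ iff $\beta\subset\alpha$. Let $X\to\overline{X}$ be the minimal resolution (a K3 surface), $E_\alpha$ the exceptional curve over $p_\alpha$, $L_\beta$ the strict transform of $\ell_\beta$; the classes $[E_\alpha],[L_\beta]$ generate the Néron–Severi lattice $S_X$, with $\langle E_\alpha,E_{\alpha'}\rangle=-2\delta_{\alpha\alpha'}$, $\langle L_\beta,L_{\beta'}\rangle=-2\delta_{\beta\beta'}$, $\langle E_\alpha,L_\beta\rangle=1$ if $\beta\subset\alpha$ and $0$ otherwise. $X$ has an Enriques involution $\varepsilon$ with $\varepsilon(E_\alpha)=L_{\bar\alpha}$ ($\bar\alpha$ the complement); $\pi:X\to Y=X/\langle\varepsilon\rangle$ is the quotient. $S_Y$ is the lattice of numerical classes of divisors on $Y$ with form $\langle\,,\rangle_Y$, and $\langle \pi^*y,\pi^*y'\rangle_X=2\langle y,y'\rangle_Y$.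 $\mathcal{P}_Y$ is the component of $\{y\in S_Y\otimes\mathbb{R}:\langle y,y\rangle_Y>0\}$ containing an ample class. For $\alpha\in A$, let $\bar u_\alpha\in S_Y$ be the class of the smooth rational curve $\pi(E_\alpha)=\pi(L_{\bar\alpha})$; let $v_\alpha\in S_X^\vee$ be the unique vector with $\langle v_\alpha,[E_{\alpha'}]\rangle_X=\delta_{\alpha\alpha'}$ for all $\alpha'\in A$ and $\langle v_\alpha,[L_\beta]\rangle_X=\delta_{\bar\alpha\beta}$ for all $\beta\in B$; and let $\bar v_\alpha\in S_Y\otimes\mathbb{Q}$ be the vector with $\langle\bar v_\alpha,y\rangle_Y=\langle v_\alpha,\pi^*y\rangle_X$ for all $y\in S_Y$. Put $D_Y=\{y\in\mathcal{P}_Y:\langle y,\bar u_\alpha\rangle_Y\ge0,\ \langle y,\bar v_\alpha\rangle_Y\ge0\ \forall\alpha\in A\}$. $L_{10}$ is the even unimodular hyperbolic lattice of rank 10 with a fixed positive cone $\mathcal{P}_{10}$; a Vinberg chamber is a standard fundamental domain of the Weyl group $W(L_{10})$ (generated by reflections in roots, i.e. vectors of square $-2$) acting on $\mathcal{P}_{10}$, i.e. the closure in $\mathcal{P}_{10}$ of a connected component of $\mathcal{P}_{10}\setminus\bigcup_r (r)^\perp$, $r$ running over all roots. *)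

theory Defs
  imports "HOL-Analysis.Analysis"
begin

definition five :: "nat set" where "five = {1..5}"

text \<open>A: 3-subsets of {1..5} (nodes / curves E_alpha); B: 2-subsets (lines / curves L_beta).\<close>
definition setA :: "nat set set" where "setA = {S. S \<subseteq> five \<and> card S = 3}"
definition setB :: "nat set set" where "setB = {S. S \<subseteq> five \<and> card S = 2}"

text \<open>Generators of S_X: E_alpha indexed by alpha in A, L_beta indexed by beta in B
  (the two index sets are disjoint, so a generator is just a subset in A or B).\<close>
definition gens :: "nat set set" where "gens = setA \<union> setB"

definition compl5 :: "nat set \<Rightarrow> nat set" where "compl5 S = five - S"

definition gX :: "nat set \<Rightarrow> nat set \<Rightarrow> real" where
  "gX S T = (if S = T then -2
             else if (S \<in> setA \<and> T \<in> setB \<and> T \<subseteq> S) \<or> (S \<in> setB \<and> T \<in> setA \<and> S \<subseteq> T) then 1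
             else 0)"

text \<open>Elements of S_X tensor R are represented by real coefficient vectors on the generators
  (modulo the kernel of the Gram form). The form:\<close>
definition formX :: "(nat set \<Rightarrow> real) \<Rightarrow> (nat set \<Rightarrow> real) \<Rightarrow> real" where
  "formX c d = (\<Sum>S\<in>gens. \<Sum>T\<in>gens. c S * gX S T * d T)"

text \<open>A real coefficient vector represents an element of S_X iff it is congruent modulo the
  kernel of the form to an integral combination of the generators.\<close>
definition inSX :: "(nat set \<Rightarrow> real) \<Rightarrow> bool" where
  "inSX c \<longleftrightarrow> (\<exists>d. (\<forall>S\<in>gens. d S \<in> \<int>) \<and>
                  (\<forall>T\<in>gens. (\<Sum>S\<in>gens. (c S - d S) * gX S T) = 0))"

text \<open>v_alpha in the dual of S_X: its pairing with the generators, extended linearly.\<close>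
definition vXgen :: "nat set \<Rightarrow> nat set \<Rightarrow> real" where
  "vXgen \<alpha> S = (if S = \<alpha> then 1 else if S = compl5 \<alpha> then 1 else 0)"

definition vX_pair :: "nat set \<Rightarrow> (nat set \<Rightarrow> real) \<Rightarrow> real" where
  "vX_pair \<alpha> c = (\<Sum>S\<in>gens. c S * vXgen \<alpha> S)"

text \<open>S_Y tensor R = R^A, a vector a standing for sum a_alpha * ubar_alpha.\<close>
definition VY :: "(nat set \<Rightarrow> real) set" where
  "VY = {a. \<forall>S. S \<notin> setA \<longrightarrow> a S = 0}"

text \<open>pi^* ubar_alpha = [E_alpha] + [L_(complement alpha)].\<close>
definition pistar :: "(nat set \<Rightarrow> real) \<Rightarrow> (nat set \<Rightarrow> real)" where
  "pistar a = (\<lambda>S. if S \<in> setA then a S else if S \<in> setB then a (compl5 S) else 0)"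

text \<open><pi^* y, pi^* y'>_X = 2 <y, y'>_Y.\<close>
definition formY :: "(nat set \<Rightarrow> real) \<Rightarrow> (nat set \<Rightarrow> real) \<Rightarrow> real" where
  "formY a b = formX (pistar a) (pistar b) / 2"

text \<open>S_Y = {y : pi^* y in S_X} (pi^* S_Y is the epsilon-invariant part of S_X).\<close>
definition SY :: "(nat set \<Rightarrow> real) set" where
  "SY = {a \<in> VY. inSX (pistar a)}"

definition ubar :: "nat set \<Rightarrow> (nat set \<Rightarrow> real)" where
  "ubar \<alpha> = (\<lambda>S. if S = \<alpha> then 1 else 0)"

definition vbar :: "nat set \<Rightarrow> (nat set \<Rightarrow> real)" where
  "vbar \<alpha> = (THE v. v \<in> VY \<and> (\<forall>y\<in>VY. formY v y = vX_pair \<alpha> (pistar y)))"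

text \<open>Positive cone component containing the ample classes; it is the component containing the
  effective class sum of the ubar_alpha, which has positive square.\<close>
definition PY :: "(nat set \<Rightarrow> real) set" where
  "PY = {y \<in> VY. formY y y > 0 \<and> formY y (\<lambda>S. \<Sum>\<alpha>\<in>setA. ubar \<alpha> S) > 0}"

definition DY :: "(nat set \<Rightarrow> real) set" where
  "DY = {y \<in> PY. \<forall>\<alpha>\<in>setA. formY y (ubar \<alpha>) \<ge> 0 \<and> formY y (vbar \<alpha>) \<ge> 0}"

text \<open>Coordinates 0,1: hyperbolic plane U; coordinates 2..9: E_8(-1) (Bourbaki nodes 1..8).\<close>
definition e8edge :: "nat \<Rightarrow> nat \<Rightarrow> bool" where
  "e8edge i j \<longleftrightarrow> (i, j) \<in> {(2,4),(4,5),(5,6),(6,7),(7,8),(8,9),(3,5)}"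

definition g10 :: "nat \<Rightarrow> nat \<Rightarrow> real" where
  "g10 i j = (if {i, j} = {0, 1} \<and> i \<noteq> j then 1
              else if 2 \<le> i \<and> i = j then -2
              else if e8edge i j \<or> e8edge j i then 1
              else 0)"

definition form10 :: "real^10 \<Rightarrow> real^10 \<Rightarrow> real" where
  "form10 x y = (\<Sum>i<10. \<Sum>j<10. x $ (of_nat i) * g10 i j * y $ (of_nat j))"

definition L10 :: "(real^10) set" where
  "L10 = {x. \<forall>i. x $ i \<in> \<int>}"

definition h10 :: "real^10" where
  "h10 = (\<chi> i. if i = 0 \<or> i = 1 then 1 else 0)"

definition P10 :: "(real^10) set" where
  "P10 = {x. form10 x x > 0 \<and> form10 x h10 > 0}"

definition roots10 :: "(real^10) set" where
  "roots10 = {r \<in> L10. form10 r r = -2}"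

definition P10_reg :: "(real^10) set" where
  "P10_reg = P10 - (\<Union>r\<in>roots10. {x. form10 x r = 0})"

definition vinberg_chamber :: "(real^10) set \<Rightarrow> bool" where
  "vinberg_chamber C \<longleftrightarrow>
     (\<exists>x\<in>P10_reg. C = closure (connected_component_set P10_reg x) \<inter> P10)"

end

theory Submission
  imports Defs "HOL-Combinatorics.Transposition"
begin

text \<open>
  The vectors \<open>ubar \<alpha>\<close> and \<open>vbar \<alpha>\<close> are twenty roots \<open>U \<alpha>\<close>, \<open>V \<alpha>\<close> of the unimodular lattice with
  \<open>U \<alpha> \<sqdot> V \<beta> = 2 \<delta>\<close>. Let \<open>\<Gamma>\<close> be the group of isometries that fix all \<open>V \<alpha>\<close> modulo 2. It contains the
  reflections in the \<open>U \<alpha>\<close>, and the reflection in \<open>V \<alpha>\<close> followed by a symmetry of the chamber \<open>D\<close> induced by a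
  transposition in \<open>S\<^sub>5\<close>; so every Vinberg chamber can be moved into \<open>D\<close> by \<open>\<Gamma>\<close>. Conversely \<open>\<Gamma>\<close> preserves the set of roots
  congruent modulo 2 to combinations of the \<open>U\<close> or of the \<open>V\<close>, and none of these cuts the interior of \<open>D\<close>; hence \<open>D\<close> is a
  strict fundamental domain of \<open>\<Gamma>\<close>. As the isometry group of the lattice acts simply transitively on Vinberg chambers,
  the chambers in \<open>D\<close> correspond to the cosets of \<open>\<Gamma>\<close>, that is, to the isometric embeddings of the span of
  the \<open>V \<alpha>\<close> modulo 2, a quadratic space of dimension 4 and minus type, into the quadratic space
  \<open>L\<^sub>1\<^sub>0 / 2 L\<^sub>1\<^sub>0\<close>. There are \<open>527 \<sqdot> 256 \<sqdot> 120 \<sqdot> 56\<close> of them.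
\<close>

section \<open>The hyperbolic form and its isometries\<close>

text \<open>Label each triple \<alpha> by the pair {a,b} of points outside it. Modulo 2,
  \<open>V \<alpha>\<close> then behaves like e_a + e_b in the space of even-weight vectors of
  F_2^5, with half the weight as quadratic form. This is where the dimension 4, the minus type, the
  linear relations among the \<open>V\<close> and the S_5 symmetry come from. The reflection in
  \<open>V \<alpha>\<close> acts on this space as the transposition (a b), so it lies in \<Gamma>
  only after the symmetry of D that undoes it. This twist is the obstacle: D is not cut out by
  reflections belonging to \<Gamma>, and disjointness of its translates is not a statement of
  Coxeter theory. It comes instead from a \<Gamma>-invariant family of roots with constant sign on
  the interior of D; that none of them cuts D is a height estimate from \<open>w\<close>, the sum of
  the \<open>U\<close>. The count uses that lattice isometries act transitively on frames modulo 2,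
  a form of Witt's theorem. Reflections supply the transvections inside E_8, and Eichler maps move
  the hyperbolic plane. The number is the index of O_6^-(2) in O_10^+(2).\<close>

lemma all_10: "(\<forall>i::10. P i) \<longleftrightarrow> P 0 \<and> P 1 \<and> P 2 \<and> P 3 \<and> P 4 \<and> P 5 \<and> P 6 \<and> P 7 \<and> P 8 \<and> P 9"
proof
  assume h: "P 0 \<and> P 1 \<and> P 2 \<and> P 3 \<and> P 4 \<and> P 5 \<and> P 6 \<and> P 7 \<and> P 8 \<and> P 9"
  show "\<forall>i. P i"
  proof
    fix i :: 10
    obtain z where z: "i = of_int z" "0 \<le> z" "z < 10" by (cases i) auto
    then have "z = 0 \<or> z = 1 \<or> z = 2 \<or> z = 3 \<or> z = 4 \<or> z = 5 \<or> z = 6 \<or> z = 7 \<or> z = 8 \<or> z = 9"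
      by arith
    with z(1) h show "P i" by auto
  qed
qed blast

lemma vec_eq_10: "x = y \<longleftrightarrow> x$0 = y$0 \<and> x$1 = y$1 \<and> x$2 = y$2 \<and> x$3 = y$3 \<and> x$4 = y$4 \<and> x$5 = y$5
    \<and> x$6 = y$6 \<and> x$7 = y$7 \<and> x$8 = y$8 \<and> x$9 = y$9" for x y :: "real^10"
  unfolding vec_eq_iff all_10 ..

lemma form10_expand: "form10 x y = x$0 * y$1 + x$1 * y$0
   - 2 * (x$2*y$2 + x$3*y$3 + x$4*y$4 + x$5*y$5 + x$6*y$6 + x$7*y$7 + x$8*y$8 + x$9*y$9)
   + (x$2*y$4 + x$4*y$2) + (x$4*y$5 + x$5*y$4) + (x$5*y$6 + x$6*y$5) + (x$6*y$7 + x$7*y$6)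
   + (x$7*y$8 + x$8*y$7) + (x$8*y$9 + x$9*y$8) + (x$3*y$5 + x$5*y$3)"
  unfolding form10_def g10_def e8edge_def
  by (simp add: eval_nat_numeral lessThan_Suc doubleton_eq_iff)

lemma form10_commute: "form10 x y = form10 y x"
  by (simp add: form10_expand mult.commute)

lemma form10_add_left [simp]: "form10 (x + y) z = form10 x z + form10 y z"
  by (simp add: form10_expand algebra_simps)

lemma form10_scale_left [simp]: "form10 (c *\<^sub>R x) z = c * form10 x z"
  by (simp add: form10_expand algebra_simps)

lemma form10_add_right [simp]: "form10 z (x + y) = form10 z x + form10 z y"
  by (metis form10_add_left form10_commute)

lemma form10_scale_right [simp]: "form10 z (c *\<^sub>R x) = c * form10 z x"
  by (metis form10_scale_left form10_commute)

lemma form10_minus_left [simp]: "form10 (- x) z = - form10 x z"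
  using form10_scale_left[of "-1" x z] by simp

lemma form10_minus_right [simp]: "form10 z (- x) = - form10 z x"
  using form10_scale_right[of z "-1" x] by simp

lemma form10_diff_left [simp]: "form10 (x - y) z = form10 x z - form10 y z"
  using form10_add_left[of x "-y" z] by simp

lemma form10_diff_right [simp]: "form10 z (x - y) = form10 z x - form10 z y"
  using form10_add_right[of z x "-y"] by simp

lemma form10_zero [simp]: "form10 0 z = 0" "form10 z 0 = 0"
  by (simp_all add: form10_expand)

lemma form10_sum_left [simp]: "form10 (sum f A) z = (\<Sum>a\<in>A. form10 (f a) z)"
  by (induction A rule: infinite_finite_induct) auto

lemma form10_sum_right [simp]: "form10 z (sum f A) = (\<Sum>a\<in>A. form10 z (f a))"
  by (induction A rule: infinite_finite_induct) auto

lemma continuous_on_form10 [continuous_intros]: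
  "continuous_on S f \<Longrightarrow> continuous_on S g \<Longrightarrow> continuous_on S (\<lambda>x. form10 (f x) (g x))"
  unfolding form10_expand by (intro continuous_intros)

lemma L10_iff: "x \<in> L10 \<longleftrightarrow> x$0 \<in> \<int> \<and> x$1 \<in> \<int> \<and> x$2 \<in> \<int> \<and> x$3 \<in> \<int> \<and> x$4 \<in> \<int> \<and> x$5 \<in> \<int>
    \<and> x$6 \<in> \<int> \<and> x$7 \<in> \<int> \<and> x$8 \<in> \<int> \<and> x$9 \<in> \<int>"
  unfolding L10_def all_10 by simp

lemma L10_closed:
  "0 \<in> L10"
  "x \<in> L10 \<Longrightarrow> y \<in> L10 \<Longrightarrow> x + y \<in> L10"
  "x \<in> L10 \<Longrightarrow> y \<in> L10 \<Longrightarrow> x - y \<in> L10"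
  "x \<in> L10 \<Longrightarrow> - x \<in> L10"
  "c \<in> \<int> \<Longrightarrow> x \<in> L10 \<Longrightarrow> c *\<^sub>R x \<in> L10"
  by (auto simp: L10_def)

lemma L10_sum: "(\<And>a. a \<in> A \<Longrightarrow> f a \<in> L10) \<Longrightarrow> sum f A \<in> L10"
  by (induction A rule: infinite_finite_induct) (auto simp: L10_closed)

lemma form10_Ints: "x \<in> L10 \<Longrightarrow> y \<in> L10 \<Longrightarrow> form10 x y \<in> \<int>"
  unfolding form10_expand by (intro Ints_add Ints_diff Ints_mult) (auto simp: L10_iff)

lemma form10_even:
  assumes "x \<in> L10" shows "form10 x x / 2 \<in> \<int>"
proof -
  have "form10 x x = 2 * (x$0 * x$1
   - (x$2*x$2 + x$3*x$3 + x$4*x$4 + x$5*x$5 + x$6*x$6 + x$7*x$7 + x$8*x$8 + x$9*x$9)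
   + x$2*x$4 + x$4*x$5 + x$5*x$6 + x$6*x$7 + x$7*x$8 + x$8*x$9 + x$3*x$5)"
    by (simp add: form10_expand algebra_simps)
  then have "form10 x x / 2 = x$0 * x$1
   - (x$2*x$2 + x$3*x$3 + x$4*x$4 + x$5*x$5 + x$6*x$6 + x$7*x$7 + x$8*x$8 + x$9*x$9)
   + x$2*x$4 + x$4*x$5 + x$5*x$6 + x$6*x$7 + x$7*x$8 + x$8*x$9 + x$3*x$5" by simp
  moreover have "x$i \<in> \<int>" for i using assms by (simp add: L10_def)
  ultimately show ?thesis by (simp only:) (intro Ints_add Ints_diff Ints_mult)
qed

lemma form10_neg_even:
  assumes "x \<in> L10" "form10 x x < 0" shows "form10 x x \<le> - 2"
proof -
  obtain k where "form10 x x / 2 = of_int k" using form10_even[OF assms(1)] by (auto elim: Ints_cases)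
  then have "form10 x x = 2 * of_int k" by simp
  with assms(2) show ?thesis by (smt (verit) of_int_less_0_iff of_int_le_iff of_int_minus of_int_1)
qed

lemma h10_nth [simp]: "h10$0 = 1" "h10$1 = 1" "h10$2 = 0" "h10$3 = 0" "h10$4 = 0" "h10$5 = 0"
   "h10$6 = 0" "h10$7 = 0" "h10$8 = 0" "h10$9 = 0"
  by (simp_all add: h10_def)

lemma form10_h10: "form10 x h10 = x$0 + x$1" "form10 h10 x = x$0 + x$1"
  by (simp_all add: form10_expand)

text \<open>Gaussian elimination of E_8 along its diagram: the ends \<open>2\<close> and
  \<open>3\<close> are eliminated first, then the chain up to \<open>9\<close>. The pivots 2, 2,
  3/2, 5/6, 4/5, 3/4, 2/3, 1/2 have product 1, the determinant of E_8.\<close>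

lemma form10_diagonal: "form10 x x = 2 * (x$0 * x$1) -
   (2 * (x$2 - x$4/2)\<^sup>2 + 2 * (x$3 - x$5/2)\<^sup>2 + 3/2 * (x$4 - 2/3 * x$5)\<^sup>2 + 5/6 * (x$5 - 6/5 * x$6)\<^sup>2
    + 4/5 * (x$6 - 5/4 * x$7)\<^sup>2 + 3/4 * (x$7 - 4/3 * x$8)\<^sup>2 + 2/3 * (x$8 - 3/2 * x$9)\<^sup>2 + 1/2 * (x$9)\<^sup>2)"
  unfolding form10_expand power2_eq_square by (simp add: field_simps)

lemma form10_le: "form10 x x \<le> 2 * (x$0 * x$1)"
proof -
  have "0 \<le> 2 * (x$2 - x$4/2)\<^sup>2 + 2 * (x$3 - x$5/2)\<^sup>2 + 3/2 * (x$4 - 2/3 * x$5)\<^sup>2 + 5/6 * (x$5 - 6/5 * x$6)\<^sup>2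
    + 4/5 * (x$6 - 5/4 * x$7)\<^sup>2 + 3/4 * (x$7 - 4/3 * x$8)\<^sup>2 + 2/3 * (x$8 - 3/2 * x$9)\<^sup>2 + 1/2 * (x$9)\<^sup>2"
    by (intro add_nonneg_nonneg mult_nonneg_nonneg zero_le_power2) simp_all
  then show ?thesis unfolding form10_diagonal by linarith
qed

lemma form10_ge_imp_zero:
  assumes "2 * (x$0 * x$1) \<le> form10 x x"
  shows "x$2 = 0 \<and> x$3 = 0 \<and> x$4 = 0 \<and> x$5 = 0 \<and> x$6 = 0 \<and> x$7 = 0 \<and> x$8 = 0 \<and> x$9 = 0"
proof -
  have "2 * (x$2 - x$4/2)\<^sup>2 + 2 * (x$3 - x$5/2)\<^sup>2 + 3/2 * (x$4 - 2/3 * x$5)\<^sup>2 + 5/6 * (x$5 - 6/5 * x$6)\<^sup>2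
    + 4/5 * (x$6 - 5/4 * x$7)\<^sup>2 + 3/4 * (x$7 - 4/3 * x$8)\<^sup>2 + 2/3 * (x$8 - 3/2 * x$9)\<^sup>2 + 1/2 * (x$9)\<^sup>2 = 0"
    using assms form10_le[of x] unfolding form10_diagonal by linarith
  then have "x$2 = x$4/2 \<and> x$3 = x$5/2 \<and> x$4 = 2/3 * x$5 \<and> x$5 = 6/5 * x$6
    \<and> x$6 = 5/4 * x$7 \<and> x$7 = 4/3 * x$8 \<and> x$8 = 3/2 * x$9 \<and> x$9 = 0"
    by (simp add: add_nonneg_eq_0_iff)
  then show ?thesis by auto
qed

lemma form10_neg_h10_perp:
  assumes "form10 x h10 = 0" "x \<noteq> 0" shows "form10 x x < 0"
proof (rule ccontr)
  assume a: "\<not> form10 x x < 0"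
  have x1: "x$1 = - x$0" using assms(1) by (simp add: form10_h10)
  have "x$0 * x$1 \<le> 0" by (simp add: x1)
  then have "2 * (x$0 * x$1) \<le> form10 x x" using a by linarith
  from form10_ge_imp_zero[OF this] have z: "x$2 = 0 \<and> x$3 = 0 \<and> x$4 = 0 \<and> x$5 = 0 \<and> x$6 = 0 \<and> x$7 = 0 \<and> x$8 = 0 \<and> x$9 = 0" .
  have "x$0 = 0" using a form10_le[of x] x1 by (smt (verit) mult_minus_right not_real_square_gt_zero)
  with x1 z assms(2) show False by (simp add: vec_eq_10)
qed

text \<open>The signature (1,9), seen from an arbitrary positive vector. Subtracting a multiple of
  \<open>p\<close> moves \<open>x\<close> into the complement of \<open>h10\<close>, where
  definiteness is known; as \<open>x\<close> is orthogonal to \<open>p\<close>, this can only raise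
  the square.\<close>

lemma form10_neg_perp:
  assumes p: "form10 p p > 0" and xp: "form10 x p = 0" and "x \<noteq> 0"
  shows "form10 x x < 0"
proof -
  have a: "form10 p h10 \<noteq> 0" using form10_neg_h10_perp[of p] p by (cases "p = 0") auto
  define t where "t = form10 x h10 / form10 p h10"
  define y where "y = x - t *\<^sub>R p"
  have yh: "form10 y h10 = 0" using a by (simp add: y_def t_def)
  have yy: "form10 y y = form10 x x + t\<^sup>2 * form10 p p"
    using xp form10_commute[of x p] by (simp add: y_def algebra_simps power2_eq_square)
  show ?thesis
  proof (cases "y = 0")
    case True
    then have "t \<noteq> 0" using \<open>x \<noteq> 0\<close> by (auto simp: y_def)
    then have "t\<^sup>2 * form10 p p > 0" using p by simp
    then show ?thesis using yy True by simp
  next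
    case False
    then show ?thesis using form10_neg_h10_perp[OF yh False] yy p
      by (smt (verit) mult_nonneg_nonneg zero_le_power2)
  qed
qed

lemma form10_nonpos_perp:
  "form10 p p > 0 \<Longrightarrow> form10 x p = 0 \<Longrightarrow> form10 x x \<le> 0"
  using form10_neg_perp by (cases "x = 0") (auto simp: less_imp_le)

lemma form10_nondegenerate:
  assumes "\<And>y. form10 x y = 0" shows "x = 0"
  using form10_neg_h10_perp[of x] assms[of h10] assms[of x] by fastforce

lemma form10_cauchy_perp:
  assumes p: "form10 p p > 0" and xp: "form10 x p = 0" and yp: "form10 y p = 0"
  shows "(form10 x y)\<^sup>2 \<le> form10 x x * form10 y y"
proof (cases "y = 0")
  case False
  then have yy: "form10 y y < 0" using form10_neg_perp p yp by blast
  define z where "z = form10 y y *\<^sub>R x - form10 x y *\<^sub>R y"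
  have "form10 z p = 0" by (simp add: z_def xp yp)
  then have "form10 z z \<le> 0" using p form10_nonpos_perp by blast
  moreover have "form10 z z = form10 y y * (form10 x x * form10 y y - (form10 x y)\<^sup>2)"
    using form10_commute[of y x] by (simp add: z_def algebra_simps power2_eq_square)
  ultimately show ?thesis using yy by (simp add: mult_le_0_iff)
qed simp

text \<open>Cauchy-Schwarz for the projections of \<open>x\<close> and \<open>y\<close> to the
  negative definite complement of \<open>p\<close>, cleared of denominators by the factor
  \<open>form10 p p\<close>.\<close>

lemma form10_cauchy:
  assumes p: "form10 p p > 0"
  shows "(form10 x y * form10 p p - form10 x p * form10 y p)\<^sup>2
     \<le> ((form10 x p)\<^sup>2 - form10 x x * form10 p p) * ((form10 y p)\<^sup>2 - form10 y y * form10 p p)"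
proof -
  define a where "a = form10 p p"
  define x' where "x' = a *\<^sub>R x - form10 x p *\<^sub>R p"
  define y' where "y' = a *\<^sub>R y - form10 y p *\<^sub>R p"
  have "(form10 x' y')\<^sup>2 \<le> form10 x' x' * form10 y' y'"
    by (rule form10_cauchy_perp[OF p]) (simp_all add: x'_def y'_def a_def)
  moreover have "form10 x' y' = a * (form10 x y * a - form10 x p * form10 y p)"
    "form10 x' x' = - a * ((form10 x p)\<^sup>2 - form10 x x * a)" "form10 y' y' = - a * ((form10 y p)\<^sup>2 - form10 y y * a)"
    using form10_commute[of p x] form10_commute[of p y]
    by (simp_all add: x'_def y'_def a_def algebra_simps power2_eq_square)
  ultimately have "a\<^sup>2 * (form10 x y * a - form10 x p * form10 y p)\<^sup>2
     \<le> a\<^sup>2 * (((form10 x p)\<^sup>2 - form10 x x * a) * ((form10 y p)\<^sup>2 - form10 y y * a))"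
    by (simp add: power_mult_distrib power2_eq_square mult_ac)
  then show ?thesis using p by (simp add: a_def)
qed

section \<open>The positive cone\<close>

lemma P10_iff: "x \<in> P10 \<longleftrightarrow> form10 x x > 0 \<and> form10 x h10 > 0" by (simp add: P10_def)

lemma h10_P10: "h10 \<in> P10" by (simp add: P10_iff form10_h10)

text \<open>Rescaled to equal height over \<open>h10\<close>, the two vectors differ by a vector of
  nonpositive square; expanding that square bounds the mixed term from below.\<close>

lemma P10_pos:
  assumes "x \<in> P10" "y \<in> P10" shows "form10 x y > 0"
proof -
  define a b where "a = form10 x h10" and "b = form10 y h10"
  have ab: "a > 0" "b > 0" and xx: "form10 x x > 0" and yy: "form10 y y > 0"
    using assms by (auto simp: P10_iff a_def b_def)
  define z where "z = b *\<^sub>R x - a *\<^sub>R y"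
  have "form10 z h10 = 0" by (simp add: z_def a_def b_def)
  then have "form10 z z \<le> 0" using form10_nonpos_perp[of h10 z] h10_P10 by (auto simp: P10_iff)
  then have "b\<^sup>2 * form10 x x + a\<^sup>2 * form10 y y \<le> 2 * (a * b) * form10 x y"
    using form10_commute[of y x] by (simp add: z_def algebra_simps power2_eq_square)
  moreover have "b\<^sup>2 * form10 x x + a\<^sup>2 * form10 y y > 0" using ab xx yy by (simp add: add_pos_pos)
  ultimately have "0 < (a * b) * form10 x y" by linarith
  moreover have "0 < a * b" using ab by simp
  ultimately show ?thesis using zero_less_mult_pos by blast
qed

lemma P10_I:
  assumes "x \<in> P10" "form10 x y > 0" "form10 y y > 0" shows "y \<in> P10"
proof -
  have "form10 y h10 \<noteq> 0" using form10_neg_h10_perp[of y] assms(3) by fastforce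
  moreover have "\<not> form10 y h10 < 0"
  proof
    assume "form10 y h10 < 0"
    then have "- y \<in> P10" using assms(3) by (simp add: P10_iff)
    from P10_pos[OF assms(1) this] assms(2) show False by simp
  qed
  ultimately show ?thesis using assms(3) by (simp add: P10_iff)
qed

lemma P10_add: "x \<in> P10 \<Longrightarrow> y \<in> P10 \<Longrightarrow> x + y \<in> P10"
  using P10_pos[of x y] form10_commute[of x y] by (auto simp: P10_iff)

lemma P10_scale: "x \<in> P10 \<Longrightarrow> c > 0 \<Longrightarrow> c *\<^sub>R x \<in> P10"
  by (auto simp: P10_iff)

lemma P10_convex_comb:
  assumes "x \<in> P10" "y \<in> P10" "0 \<le> s" "0 \<le> t" "s + t = 1"
  shows "s *\<^sub>R x + t *\<^sub>R y \<in> P10"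
proof (cases "s = 0 \<or> t = 0")
  case True then show ?thesis using assms by auto
next
  case False then show ?thesis using assms by (intro P10_add P10_scale) auto
qed

lemma finite_L10_bounded: "finite {z \<in> L10. \<forall>i. \<bar>z$i\<bar> \<le> K}"
proof -
  let ?S = "{z \<in> L10. \<forall>i. \<bar>z$i\<bar> \<le> K}"
  have "\<lfloor>z$i\<rfloor> \<in> {- \<lceil>K\<rceil> - 1..\<lceil>K\<rceil>}" if "z \<in> ?S" for z i
  proof -
    have "\<bar>z$i\<bar> \<le> K" using that by auto
    then show ?thesis by simp linarith
  qed
  then have "(\<lambda>z. \<lambda>i. \<lfloor>z$i\<rfloor>) ` ?S \<subseteq> (UNIV \<rightarrow>\<^sub>E {- \<lceil>K\<rceil> - 1..\<lceil>K\<rceil>})"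
    by (intro image_subsetI PiE_I) auto
  then have "finite ((\<lambda>z. \<lambda>i. \<lfloor>z$i\<rfloor>) ` ?S)" by (rule finite_subset) (simp add: finite_PiE)
  moreover have "inj_on (\<lambda>z. \<lambda>i. \<lfloor>z$i\<rfloor>) ?S"
  proof (rule inj_onI)
    fix x y assume "x \<in> ?S" "y \<in> ?S" and e: "(\<lambda>i. \<lfloor>x$i\<rfloor>) = (\<lambda>i. \<lfloor>y$i\<rfloor>)"
    then have "x$i = of_int \<lfloor>x$i\<rfloor>" "y$i = of_int \<lfloor>y$i\<rfloor>" for i by (auto simp: L10_def)
    then show "x = y" using fun_cong[OF e] by (metis vec_eq_iff)
  qed
  ultimately show ?thesis by (rule finite_imageD)
qed

text \<open>The form \<open>?Q\<close> is positive definite, so it suffices to bound the height of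
  \<open>z\<close> over \<open>h10\<close>. Since \<open>x\<close> is interior to the cone,
  \<open>x - \<epsilon> *\<^sub>R h10\<close> still lies in it and pairs positively with
  \<open>z\<close>, which bounds this height by \<open>c / \<epsilon>\<close>.\<close>

lemma L10_finite_below:
  assumes x: "x \<in> P10" shows "finite {z \<in> L10 \<inter> P10. form10 x z \<le> c}"
proof -
  let ?Q = "\<lambda>z. (form10 z h10)\<^sup>2 - form10 z z"
  have Qpos: "?Q z > 0" if "z \<noteq> 0" for z
  proof -
    have "?Q z = (z$0)\<^sup>2 + (z$1)\<^sup>2 + (2 * (z$0 * z$1) - form10 z z)"
      by (simp add: form10_h10 power2_eq_square algebra_simps)
    moreover have "2 * (z$0 * z$1) - form10 z z \<ge> 0" using form10_le[of z] by simp
    moreover have "\<not> ((z$0)\<^sup>2 + (z$1)\<^sup>2 + (2 * (z$0 * z$1) - form10 z z) \<le> 0)"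
    proof
      assume a: "(z$0)\<^sup>2 + (z$1)\<^sup>2 + (2 * (z$0 * z$1) - form10 z z) \<le> 0"
      then have "(z$0)\<^sup>2 = 0" "(z$1)\<^sup>2 = 0" "2 * (z$0 * z$1) \<le> form10 z z"
        using form10_le[of z] zero_le_power2[of "z$0"] zero_le_power2[of "z$1"] by linarith+
      with form10_ge_imp_zero[of z] that show False by (simp add: vec_eq_10)
    qed
    ultimately show ?thesis by linarith
  qed
  have "\<exists>\<kappa>>0. \<forall>z. ?Q z \<ge> \<kappa> * (norm z)\<^sup>2"
  proof -
    have "continuous_on (sphere 0 1) ?Q" by (intro continuous_intros)
    moreover have "sphere (0::real^10) 1 \<noteq> {}" by simp
    ultimately obtain s where s: "s \<in> sphere 0 1" "\<forall>z\<in>sphere 0 1. ?Q s \<le> ?Q z"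
      using continuous_attains_inf[of "sphere (0::real^10) 1" ?Q] by auto
    then have "s \<noteq> 0" by auto
    then have pos: "?Q s > 0" using Qpos[of s] by auto
    have "?Q z \<ge> ?Q s * (norm z)\<^sup>2" for z
    proof (cases "z = 0")
      case False
      then have "sgn z \<in> sphere 0 1" by (simp add: norm_sgn)
      then have "?Q s \<le> ?Q (sgn z)" using s by blast
      also have "\<dots> = ?Q z / (norm z)\<^sup>2"
        by (simp add: sgn_div_norm power_mult_distrib power2_eq_square diff_divide_distrib divide_inverse algebra_simps)
      finally show ?thesis using False by (simp add: pos_le_divide_eq)
    qed simp
    with pos show ?thesis by blast
  qed
  then obtain \<kappa> where k: "\<kappa> > 0" "\<And>z. ?Q z \<ge> \<kappa> * (norm z)\<^sup>2" by blast
  define a b where "a = form10 x x" and "b = form10 x h10"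
  have ab: "a > 0" "b > 0" using x by (auto simp: P10_iff a_def b_def)
  \<comment> \<open>The first bound keeps the square of \<open>x - \<epsilon> *\<^sub>R h10\<close>
    above \<open>a / 2\<close>, the second keeps its height at least \<open>b / 2\<close>.\<close>
  define \<epsilon> where "\<epsilon> = min (a / (4 * b)) (b / 4)"
  have "\<epsilon> \<le> a / (4 * b)" "\<epsilon> \<le> b / 4" by (simp_all add: \<epsilon>_def)
  then have e: "\<epsilon> * (4 * b) \<le> a" "\<epsilon> * 4 \<le> b" using ab by (simp_all add: pos_le_divide_eq)
  have e0: "\<epsilon> > 0" using ab by (simp add: \<epsilon>_def)
  have hh: "form10 h10 h10 = 2" by (simp add: form10_h10)
  have xe: "x - \<epsilon> *\<^sub>R h10 \<in> P10"
  proof -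
    have "form10 (x - \<epsilon> *\<^sub>R h10) (x - \<epsilon> *\<^sub>R h10) = a - 2 * (\<epsilon> * b) + 2 * \<epsilon>\<^sup>2"
      by (simp add: a_def b_def hh algebra_simps power2_eq_square form10_commute[of h10 x])
    moreover have "\<epsilon>\<^sup>2 \<ge> 0" by simp
    moreover have "form10 (x - \<epsilon> *\<^sub>R h10) h10 = b - 2 * \<epsilon>" by (simp add: b_def hh)
    ultimately show ?thesis using e e0 ab unfolding P10_iff by linarith
  qed
  define M where "M = c / \<epsilon>"
  have "{z \<in> L10 \<inter> P10. form10 x z \<le> c} \<subseteq> {z \<in> L10. \<forall>i. \<bar>z$i\<bar> \<le> M / sqrt \<kappa>}"
  proof clarsimp
    fix z i assume z: "z \<in> L10" "z \<in> P10" "form10 x z \<le> c"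
    have "0 < form10 x z - \<epsilon> * form10 h10 z" using P10_pos[OF xe z(2)] by simp
    then have "form10 z h10 * \<epsilon> \<le> c" using z(3) form10_commute[of h10 z] by (simp add: mult.commute)
    then have "form10 z h10 \<le> M" using e0 by (simp add: M_def pos_le_divide_eq)
    moreover have "0 < form10 z h10" "form10 z z > 0" using z(2) by (auto simp: P10_iff)
    ultimately have "(form10 z h10)\<^sup>2 \<le> M\<^sup>2" "M > 0" by (simp_all add: power_mono)
    then have "\<kappa> * (norm z)\<^sup>2 \<le> M\<^sup>2" using k(2)[of z] \<open>form10 z z > 0\<close> by linarith
    then have "(sqrt \<kappa> * norm z)\<^sup>2 \<le> M\<^sup>2" using k(1) by (simp add: power_mult_distrib)
    then have "sqrt \<kappa> * norm z \<le> M" using \<open>M > 0\<close> by (simp add: power2_le_iff_abs_le)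
    then have "norm z \<le> M / sqrt \<kappa>" using k(1) by (simp add: pos_le_divide_eq mult.commute)
    then show "\<bar>z$i\<bar> \<le> M / sqrt \<kappa>" using component_le_norm_cart[of z i] by linarith
  qed
  then show ?thesis using finite_L10_bounded finite_subset by blast
qed

section \<open>Lattice isometries preserving the positive cone\<close>

definition isoms10 :: "(real^10 \<Rightarrow> real^10) set" where
  "isoms10 = {g. linear g \<and> (\<forall>x y. form10 (g x) (g y) = form10 x y) \<and> g ` L10 = L10 \<and> g ` P10 = P10}"

lemma isoms10_linear: "g \<in> isoms10 \<Longrightarrow> linear g"
  and isoms10_form: "g \<in> isoms10 \<Longrightarrow> form10 (g x) (g y) = form10 x y"
  and isoms10_L10: "g \<in> isoms10 \<Longrightarrow> x \<in> L10 \<Longrightarrow> g x \<in> L10"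
  and isoms10_P10: "g \<in> isoms10 \<Longrightarrow> x \<in> P10 \<Longrightarrow> g x \<in> P10"
  by (auto simp: isoms10_def)

lemma isoms10_bij: assumes "g \<in> isoms10" shows "bij g"
proof -
  have l: "linear g" using assms isoms10_linear by blast
  have "inj g"
  proof (rule injI)
    fix x y assume "g x = g y"
    then have "form10 (x - y) z = 0" for z
      by (metis assms form10_diff_left isoms10_form right_minus_eq)
    then show "x = y" using form10_nondegenerate[of "x - y"] by auto
  qed
  then show ?thesis using l linear_injective_imp_surjective bij_def by blast
qed

lemma isoms10_inv: assumes g: "g \<in> isoms10" shows "inv g \<in> isoms10"
proof -
  have b: "bij g" using isoms10_bij g by blast
  then have e: "g (inv g x) = x" for x by (simp add: bij_is_surj surj_f_inv_f)
  have "linear (inv g)" using b isoms10_linear[OF g] by (simp add: bij_is_inj inj_linear_imp_inv_linear)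
  moreover have "form10 (inv g x) (inv g y) = form10 x y" for x y
    using isoms10_form[OF g, of "inv g x" "inv g y"] e by simp
  moreover have "inv g ` (g ` L10) = L10" "inv g ` (g ` P10) = P10"
    using b by (simp_all add: bij_is_inj image_inv_f_f)
  moreover have "g ` L10 = L10" "g ` P10 = P10" using g by (auto simp: isoms10_def)
  ultimately show ?thesis by (simp add: isoms10_def)
qed

lemma isoms10_comp: "g \<in> isoms10 \<Longrightarrow> h \<in> isoms10 \<Longrightarrow> g \<circ> h \<in> isoms10"
  using image_comp[of g h L10] image_comp[of g h P10] unfolding isoms10_def by (simp add: linear_compose)

lemma isoms10_id: "id \<in> isoms10" by (auto simp: isoms10_def linear_id)

lemma isoms10_inv_apply:
  assumes "g \<in> isoms10" shows "inv g (g x) = x" "g (inv g x) = x"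
  using isoms10_bij[OF assms] by (simp_all add: bij_is_inj bij_is_surj surj_f_inv_f)

lemma isoms10_adjoint: "g \<in> isoms10 \<Longrightarrow> form10 (g x) y = form10 x (inv g y)"
  by (metis isoms10_form isoms10_inv_apply(2))

text \<open>An isometry maps the cone to itself or to its negative, so one test vector
  \<open>p\<close> decides.\<close>

lemma isoms10_I_inverse:
  assumes l: "linear g" and f: "\<And>x y. form10 (g x) (g y) = form10 x y" and L: "\<And>x. x \<in> L10 \<Longrightarrow> g x \<in> L10"
    and p: "p \<in> P10" "g p \<in> P10" and L': "\<And>x. x \<in> L10 \<Longrightarrow> \<exists>y\<in>L10. g y = x"
  shows "g \<in> isoms10"
proof -
  have "inj g"
  proof (rule injI)
    fix x y assume "g x = g y"
    then have "form10 (x - y) z = 0" for z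
      by (metis f form10_diff_left right_minus_eq)
    then show "x = y" using form10_nondegenerate[of "x - y"] by auto
  qed
  then have s: "surj g" using l linear_injective_imp_surjective by blast
  have P: "g x \<in> P10 \<longleftrightarrow> x \<in> P10" for x
  proof
    assume "g x \<in> P10"
    then have "form10 p x > 0" "form10 x x > 0" using P10_pos[OF p(2), of "g x"] f by (auto simp: P10_iff)
    then show "x \<in> P10" using P10_I[OF p(1)] by blast
  next
    assume "x \<in> P10"
    then have "form10 (g p) (g x) > 0" "form10 (g x) (g x) > 0" using P10_pos[OF p(1), of x] f by (auto simp: P10_iff)
    then show "g x \<in> P10" using P10_I[OF p(2)] by blast
  qed
  have "g ` P10 = P10"
  proof (rule antisym)
    show "P10 \<subseteq> g ` P10" using s P by (metis imageI subsetI surjE)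
  qed (use P in auto)
  moreover have "g ` L10 = L10" using L L' by blast
  ultimately show ?thesis using l f by (simp add: isoms10_def)
qed

definition refl10 :: "real^10 \<Rightarrow> real^10 \<Rightarrow> real^10" where
  "refl10 r x = x + form10 x r *\<^sub>R r"

lemma refl10_isoms10: assumes r: "r \<in> roots10" shows "refl10 r \<in> isoms10"
proof -
  have rr: "form10 r r = - 2" and rL: "r \<in> L10" using r by (auto simp: roots10_def)
  have inv: "refl10 r (refl10 r x) = x" for x
  proof -
    have e: "form10 (refl10 r x) r = - form10 x r" by (simp add: refl10_def rr)
    show ?thesis unfolding refl10_def[of r "refl10 r x"] e by (simp add: refl10_def)
  qed
  have lin: "linear (refl10 r)" by (rule linearI) (simp_all add: refl10_def algebra_simps)
  have form: "form10 (refl10 r x) (refl10 r y) = form10 x y" for x y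
    using form10_commute[of r y] by (simp add: refl10_def rr algebra_simps)
  have L: "refl10 r x \<in> L10" if "x \<in> L10" for x
    using that rL form10_Ints by (simp add: refl10_def L10_closed)
  have "form10 h10 (refl10 r h10) = 2 + (form10 h10 r)\<^sup>2"
    by (simp add: refl10_def form10_h10 power2_eq_square)
  also have "\<dots> > 0" by (simp add: add_pos_nonneg)
  finally have "refl10 r h10 \<in> P10" using P10_I[OF h10_P10, of "refl10 r h10"] form[of h10 h10] h10_P10
    by (simp add: P10_iff)
  then show ?thesis using isoms10_I_inverse[OF lin form L h10_P10] inv L by metis
qed

lemma isoms10_roots: "g \<in> isoms10 \<Longrightarrow> r \<in> roots10 \<Longrightarrow> g r \<in> roots10"
  by (auto simp: roots10_def isoms10_form isoms10_L10)

text \<open>The minimum is attained because the values are pairings of \<open>x\<close> with lattice vectors in the positive cone.\<close>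
lemma isoms10_min_exists:
  assumes G: "G \<subseteq> isoms10" "G \<noteq> {}" and x: "x \<in> P10" and p: "p \<in> P10" "p \<in> L10"
  obtains g where "g \<in> G" "\<And>h. h \<in> G \<Longrightarrow> form10 (g x) p \<le> form10 (h x) p"
proof -
  obtain h0 where h0: "h0 \<in> G" using G by blast
  let ?c = "form10 (h0 x) p"
  let ?Z = "{z \<in> L10 \<inter> P10. form10 x z \<le> ?c}"
  have eq: "form10 (h x) p = form10 x (inv h p)" if "h \<in> G" for h
    using that G isoms10_adjoint by blast
  define S where "S = {inv h p | h. h \<in> G \<and> form10 (h x) p \<le> ?c}"
  have "S \<subseteq> ?Z"
  proof
    fix y assume "y \<in> S"
    then obtain h where h: "y = inv h p" "h \<in> G" "form10 (h x) p \<le> ?c" unfolding S_def by blast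
    then have "inv h \<in> isoms10" using G isoms10_inv by blast
    then show "y \<in> ?Z" using h eq p isoms10_L10 isoms10_P10 by auto
  qed
  then have fin: "finite S" using L10_finite_below[OF x] finite_subset by blast
  have ne: "S \<noteq> {}" using h0 unfolding S_def by auto
  define z where "z = arg_min_on (form10 x) S"
  have z: "z \<in> S" "\<And>y. y \<in> S \<Longrightarrow> form10 x z \<le> form10 x y"
    unfolding z_def using arg_min_if_finite(1)[OF fin ne] arg_min_least[OF fin ne] by auto
  then obtain g where g: "g \<in> G" "z = inv g p" "form10 (g x) p \<le> ?c" unfolding S_def by blast
  have "form10 (g x) p \<le> form10 (h x) p" if "h \<in> G" for h
  proof (cases "form10 (h x) p \<le> ?c")
    case True
    then have "inv h p \<in> S" using that unfolding S_def by blast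
    from z(2)[OF this] show ?thesis using g(2) eq[OF g(1)] eq[OF that] by simp
  qed (use g in linarith)
  with g(1) that show thesis by blast
qed

section \<open>Vinberg chambers\<close>

definition vec10 :: "real \<Rightarrow> real \<Rightarrow> real \<Rightarrow> real \<Rightarrow> real \<Rightarrow> real \<Rightarrow> real \<Rightarrow> real \<Rightarrow> real \<Rightarrow> real \<Rightarrow> real^10" where
  "vec10 a0 a1 a2 a3 a4 a5 a6 a7 a8 a9 = (\<chi> i. if i = 0 then a0 else if i = 1 then a1 else if i = 2 then a2
     else if i = 3 then a3 else if i = 4 then a4 else if i = 5 then a5 else if i = 6 then a6
     else if i = 7 then a7 else if i = 8 then a8 else a9)"

lemma vec10_nth [simp]:
  "vec10 a0 a1 a2 a3 a4 a5 a6 a7 a8 a9 $ 0 = a0" "vec10 a0 a1 a2 a3 a4 a5 a6 a7 a8 a9 $ 1 = a1"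
  "vec10 a0 a1 a2 a3 a4 a5 a6 a7 a8 a9 $ 2 = a2" "vec10 a0 a1 a2 a3 a4 a5 a6 a7 a8 a9 $ 3 = a3"
  "vec10 a0 a1 a2 a3 a4 a5 a6 a7 a8 a9 $ 4 = a4" "vec10 a0 a1 a2 a3 a4 a5 a6 a7 a8 a9 $ 5 = a5"
  "vec10 a0 a1 a2 a3 a4 a5 a6 a7 a8 a9 $ 6 = a6" "vec10 a0 a1 a2 a3 a4 a5 a6 a7 a8 a9 $ 7 = a7"
  "vec10 a0 a1 a2 a3 a4 a5 a6 a7 a8 a9 $ 8 = a8" "vec10 a0 a1 a2 a3 a4 a5 a6 a7 a8 a9 $ 9 = a9"
  by (simp_all add: vec10_def)

text \<open>The simple roots form the diagram \<open>T\<^sub>2\<^sub>,\<^sub>3\<^sub>,\<^sub>7\<close>: the eight simple roots of \<open>E\<^sub>8\<close>, the affine root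
  \<open>f\<^sub>0 - \<theta>\<close> with \<open>\<theta>\<close> the highest root, and \<open>f\<^sub>1 - f\<^sub>0\<close>.\<close>
definition simple10 :: "nat \<Rightarrow> real^10" where
  "simple10 i = (if i = 0 then vec10 0 0 1 0 0 0 0 0 0 0 else if i = 1 then vec10 0 0 0 1 0 0 0 0 0 0
    else if i = 2 then vec10 0 0 0 0 1 0 0 0 0 0 else if i = 3 then vec10 0 0 0 0 0 1 0 0 0 0
    else if i = 4 then vec10 0 0 0 0 0 0 1 0 0 0 else if i = 5 then vec10 0 0 0 0 0 0 0 1 0 0
    else if i = 6 then vec10 0 0 0 0 0 0 0 0 1 0 else if i = 7 then vec10 0 0 0 0 0 0 0 0 0 1
    else if i = 8 then vec10 1 0 (-2) (-3) (-4) (-6) (-5) (-4) (-3) (-2)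
    else vec10 (-1) 1 0 0 0 0 0 0 0 0)"

text \<open>The basis dual to the simple roots.\<close>
definition weight10 :: "nat \<Rightarrow> real^10" where
  "weight10 i = (if i = 0 then vec10 2 2 (-4) (-5) (-7) (-10) (-8) (-6) (-4) (-2)
    else if i = 1 then vec10 3 3 (-5) (-8) (-10) (-15) (-12) (-9) (-6) (-3)
    else if i = 2 then vec10 4 4 (-7) (-10) (-14) (-20) (-16) (-12) (-8) (-4)
    else if i = 3 then vec10 6 6 (-10) (-15) (-20) (-30) (-24) (-18) (-12) (-6)
    else if i = 4 then vec10 5 5 (-8) (-12) (-16) (-24) (-20) (-15) (-10) (-5)
    else if i = 5 then vec10 4 4 (-6) (-9) (-12) (-18) (-15) (-12) (-8) (-4)
    else if i = 6 then vec10 3 3 (-4) (-6) (-8) (-12) (-10) (-8) (-6) (-3)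
    else if i = 7 then vec10 2 2 (-2) (-3) (-4) (-6) (-5) (-4) (-3) (-2)
    else if i = 8 then vec10 1 1 0 0 0 0 0 0 0 0 else vec10 1 0 0 0 0 0 0 0 0 0)"

text \<open>The Weyl vector, the sum of the ten dual weights. Pairing with it is the height of a
  root, and it serves as an integral base point inside the standard chamber.\<close>

definition weyl10 :: "real^10" where
  "weyl10 = vec10 31 30 (-46) (-68) (-91) (-135) (-110) (-84) (-57) (-29)"

lemma all_less_10: "(\<forall>i<10::nat. P i) \<longleftrightarrow> P 0 \<and> P 1 \<and> P 2 \<and> P 3 \<and> P 4 \<and> P 5 \<and> P 6 \<and> P 7 \<and> P 8 \<and> P 9"
  by (simp add: eval_nat_numeral All_less_Suc conj_ac)

lemma sum_less_10: "(\<Sum>i<10::nat. f i) = f 0 + f 1 + f 2 + f 3 + f 4 + f 5 + f 6 + f 7 + f 8 + f 9"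
  for f :: "nat \<Rightarrow> 'a::comm_monoid_add"
  by (simp add: eval_nat_numeral lessThan_Suc ac_simps)

lemma simple10_roots: "i < 10 \<Longrightarrow> simple10 i \<in> roots10"
proof -
  have "\<forall>i<10. simple10 i \<in> roots10"
    unfolding all_less_10 by (simp add: roots10_def L10_iff simple10_def form10_expand)
  then show "i < 10 \<Longrightarrow> simple10 i \<in> roots10" by blast
qed

lemma simple10_offdiag: "i < 10 \<Longrightarrow> j < 10 \<Longrightarrow> i \<noteq> j \<Longrightarrow> form10 (simple10 i) (simple10 j) \<ge> 0"
proof -
  have "\<forall>i<10. \<forall>j<10. i \<noteq> j \<longrightarrow> form10 (simple10 i) (simple10 j) \<ge> 0"
    unfolding all_less_10 by (simp add: simple10_def form10_expand)
  then show "i < 10 \<Longrightarrow> j < 10 \<Longrightarrow> i \<noteq> j \<Longrightarrow> form10 (simple10 i) (simple10 j) \<ge> 0" by blast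
qed

lemma weight10_dual: "i < 10 \<Longrightarrow> j < 10 \<Longrightarrow> form10 (weight10 i) (simple10 j) = (if i = j then 1 else 0)"
proof -
  have "\<forall>i<10. \<forall>j<10. form10 (weight10 i) (simple10 j) = (if i = j then 1 else 0)"
    unfolding all_less_10 by (simp add: simple10_def weight10_def form10_expand)
  then show "i < 10 \<Longrightarrow> j < 10 \<Longrightarrow> form10 (weight10 i) (simple10 j) = (if i = j then 1 else 0)" by blast
qed

lemma weight10_L10: "i < 10 \<Longrightarrow> weight10 i \<in> L10"
proof -
  have "\<forall>i<10. weight10 i \<in> L10" unfolding all_less_10 by (simp add: L10_iff weight10_def)
  then show "i < 10 \<Longrightarrow> weight10 i \<in> L10" by blast
qed

text \<open>Deleting a node other than \<open>9\<close> leaves a negative definite diagram. Deleting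
  node \<open>9\<close> leaves affine E_8, and \<open>weight10 9\<close> is its isotropic null
  vector, hence the bound.\<close>

lemma weight10_pos: "i < 9 \<Longrightarrow> form10 (weight10 i) (weight10 i) > 0"
proof -
  have "\<forall>i<10. i < 9 \<longrightarrow> form10 (weight10 i) (weight10 i) > 0"
    unfolding all_less_10 by (simp add: weight10_def form10_expand)
  then show "i < 9 \<Longrightarrow> form10 (weight10 i) (weight10 i) > 0" by auto
qed

lemma weight10_norm_inj:
  "i < 10 \<Longrightarrow> j < 10 \<Longrightarrow> form10 (weight10 i) (weight10 i) = form10 (weight10 j) (weight10 j) \<Longrightarrow> i = j"
proof -
  have "\<forall>i<10. \<forall>j<10. form10 (weight10 i) (weight10 i) = form10 (weight10 j) (weight10 j) \<longrightarrow> i = j"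
    unfolding all_less_10 by (simp add: weight10_def form10_expand)
  then show "i < 10 \<Longrightarrow> j < 10 \<Longrightarrow> form10 (weight10 i) (weight10 i) = form10 (weight10 j) (weight10 j) \<Longrightarrow> i = j" by blast
qed

lemma simple10_expand: "(\<Sum>i<10. form10 x (weight10 i) *\<^sub>R simple10 i) = x"
  unfolding sum_less_10 vec_eq_10 by (simp add: weight10_def simple10_def form10_expand algebra_simps)

lemma weight10_expand: "(\<Sum>i<10. form10 x (simple10 i) *\<^sub>R weight10 i) = x"
  unfolding sum_less_10 vec_eq_10 by (simp add: weight10_def simple10_def form10_expand algebra_simps)

lemma weyl10_L10: "weyl10 \<in> L10" by (simp add: weyl10_def L10_iff)

lemma weyl10_simple: "i < 10 \<Longrightarrow> form10 weyl10 (simple10 i) = 1"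
proof -
  have "\<forall>i<10. form10 weyl10 (simple10 i) = 1"
    unfolding all_less_10 by (simp add: weyl10_def simple10_def form10_expand)
  then show "i < 10 \<Longrightarrow> form10 weyl10 (simple10 i) = 1" by blast
qed

lemma weyl10_P10: "weyl10 \<in> P10"
  by (simp add: weyl10_def P10_iff form10_h10 form10_expand)

lemma form10_expand_simple: "form10 x y = (\<Sum>i<10. form10 y (weight10 i) * form10 x (simple10 i))"
proof -
  have "form10 x y = form10 x (\<Sum>i<10. form10 y (weight10 i) *\<^sub>R simple10 i)" by (simp only: simple10_expand)
  then show ?thesis by simp
qed

lemma eq_by_simple10:
  assumes "\<And>i. i < 10 \<Longrightarrow> form10 x (simple10 i) = form10 y (simple10 i)" shows "x = y"
  using assms weight10_expand[of x] weight10_expand[of y] by (metis (mono_tags, lifting) lessThan_iff sum.cong)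

lemma perp_weight10_neg:
  assumes "x \<in> L10" "x \<noteq> 0" "i < 9" "form10 x (weight10 i) = 0" shows "form10 x x \<le> -2"
  using form10_neg_even[OF assms(1)] form10_neg_perp[OF weight10_pos[OF assms(3)] assms(4,2)] by blast

text \<open>The bound \<open>i < 9\<close> makes \<open>weight10 i\<close> a vector of positive
  square orthogonal to the positive part \<open>p\<close>, which forces \<open>p\<close> to have
  square at most -2.\<close>

lemma root10_sign_aux:
  assumes r: "r \<in> roots10" and i: "i < 9" "form10 r (weight10 i) < 0" and k: "k < 10" "form10 r (weight10 k) > 0"
  shows False
proof -
  have rL: "r \<in> L10" and rr: "form10 r r = -2" using r by (auto simp: roots10_def)
  define c where "c i = form10 r (weight10 i)" for i
  have cZ: "c i \<in> \<int>" if "i < 10" for i using that rL weight10_L10 form10_Ints by (simp add: c_def)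
  define p where "p = (\<Sum>i<10. max (c i) 0 *\<^sub>R simple10 i)"
  define n where "n = (\<Sum>i<10. max (- c i) 0 *\<^sub>R simple10 i)"
  have mZ: "max (c i) 0 \<in> \<int>" "max (- c i) 0 \<in> \<int>" if "i < 10" for i
    using cZ[OF that] by (auto simp: max_def)
  have sL: "simple10 i \<in> L10" if "i < 10" for i using simple10_roots[OF that] by (simp add: roots10_def)
  have pL: "p \<in> L10" and nL: "n \<in> L10"
    unfolding p_def n_def by (auto intro!: L10_sum L10_closed mZ sL)
  have "p - n = (\<Sum>i<10. c i *\<^sub>R simple10 i)"
    unfolding p_def n_def sum_subtractf[symmetric] scaleR_diff_left[symmetric]
    by (intro sum.cong) (auto simp: max_def)
  then have rpn: "r = p - n" using simple10_expand[of r] by (simp add: c_def)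
  have pw: "form10 p (weight10 j) = max (c j) 0" and nw: "form10 n (weight10 j) = max (- c j) 0" if "j < 10" for j
  proof -
    have "form10 (\<Sum>i<10. d i *\<^sub>R simple10 i) (weight10 j) = d j" for d
    proof -
      have "form10 (\<Sum>i<10. d i *\<^sub>R simple10 i) (weight10 j) = (\<Sum>i<10. if i = j then d i else 0)"
        unfolding form10_sum_left form10_scale_left
        by (intro sum.cong) (auto simp: form10_commute[of _ "weight10 j"] weight10_dual that)
      also have "\<dots> = d j" using that by simp
      finally show ?thesis .
    qed
    then show "form10 p (weight10 j) = max (c j) 0" "form10 n (weight10 j) = max (- c j) 0"
      by (simp_all add: p_def n_def)
  qed
  have pn: "form10 p n \<ge> 0"
  proof -
    have "form10 p n = (\<Sum>i<10. \<Sum>j<10. max (c i) 0 * (max (- c j) 0 * form10 (simple10 i) (simple10 j)))"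
      unfolding p_def n_def form10_sum_left form10_sum_right form10_scale_left form10_scale_right sum_distrib_left
      by (subst sum.swap) (simp add: mult.left_commute)
    also have "\<dots> \<ge> 0"
    proof (intro sum_nonneg)
      fix i j :: nat assume "i \<in> {..<10}" "j \<in> {..<10}"
      then show "0 \<le> max (c i) 0 * (max (- c j) 0 * form10 (simple10 i) (simple10 j))"
        using simple10_offdiag[of i j] by (cases "i = j") (auto simp: max_def)
    qed
    finally show ?thesis .
  qed
  have rr': "form10 p p + form10 n n - 2 * form10 p n = -2"
    using rr form10_commute[of n p] by (simp add: rpn)
  have n0: "n \<noteq> 0" using nw[of i] i by (auto simp: c_def)
  have p0: "p \<noteq> 0" using pw[of k] k by (auto simp: c_def)
  have "form10 p (weight10 i) = 0" using pw[of i] i by (simp add: c_def)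
  then have pp: "form10 p p \<le> -2" using perp_weight10_neg[OF pL p0 i(1)] by blast
  show False
  \<comment> \<open>If \<open>p\<close> involves a node below \<open>9\<close>, then
    \<open>n\<close> has square at most -2 as well, and \<open>r\<close> would have square at most
    -4. Otherwise \<open>p\<close> is a multiple of the last simple root, and \<open>n\<close> is
    orthogonal only to the isotropic weight; then \<open>n\<close> is a multiple of the null vector,
    which pairs nontrivially with \<open>p\<close>.\<close>
  proof (cases "\<exists>k<9. c k > 0")
    case True
    then obtain m where m: "m < 9" "c m > 0" by blast
    then have "form10 n (weight10 m) = 0" using nw[of m] by simp
    then have "form10 n n \<le> -2" using perp_weight10_neg[OF nL n0 m(1)] by blast
    then show False using pp rr' pn by linarith
  next
    case False
    have "\<not> k < 9" using False k by (auto simp: c_def)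
    then have "k = 9" using k(1) by linarith
    then have c9: "c 9 > 0" using k by (simp add: c_def)
    then have "form10 n (weight10 9) = 0" using nw[of 9] by simp
    then have n1: "n$1 = 0" by (simp add: weight10_def form10_expand)
    then have nn: "form10 n n \<le> 0" using form10_le[of n] by simp
    with pp rr' pn have "form10 n n = 0" "form10 p n = 0" by linarith+
    then have z: "n$2 = 0 \<and> n$3 = 0 \<and> n$4 = 0 \<and> n$5 = 0 \<and> n$6 = 0 \<and> n$7 = 0 \<and> n$8 = 0 \<and> n$9 = 0"
      using form10_ge_imp_zero[of n] n1 by simp
    have "form10 p n = p$1 * n$0" using n1 z by (simp add: form10_expand)
    moreover have "p$1 = c 9" using pw[of 9] c9 by (simp add: weight10_def form10_expand)
    ultimately have "n$0 = 0" using \<open>form10 p n = 0\<close> c9 by simp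
    then show False using n1 z n0 by (simp add: vec_eq_10)
  qed
qed

text \<open>A root with coefficients of both signs would split as \<open>p - n\<close> with \<open>p \<sqdot> n \<ge> 0\<close>, and the squares of \<open>p\<close>
  and \<open>n\<close> are too negative, since a proper subdiagram of \<open>T\<^sub>2\<^sub>,\<^sub>3\<^sub>,\<^sub>7\<close> is negative (semi)definite.\<close>
lemma root10_sign:
  assumes r: "r \<in> roots10"
  shows "(\<forall>i<10. form10 r (weight10 i) \<ge> 0) \<or> (\<forall>i<10. form10 r (weight10 i) \<le> 0)"
proof (rule ccontr)
  assume "\<not> ?thesis"
  then obtain i k where ik: "i < 10" "form10 r (weight10 i) < 0" "k < 10" "form10 r (weight10 k) > 0"
    by (auto simp: not_le)
  have mr: "- r \<in> roots10" using r by (auto simp: roots10_def L10_closed)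
  have "i \<noteq> k" using ik by auto
  then consider "i < 9" | "k < 9" using ik(1,3) by linarith
  then show False
  proof cases
    case 1 then show False using root10_sign_aux[OF r] ik by blast
  next
    case 2 then show False using root10_sign_aux[OF mr, of k i] ik by simp
  qed
qed

text \<open>Chambers are indexed by isometries instead of Weyl group elements. The diagram has no
  symmetry, so the two index sets agree, and isometries are what reduction modulo 2 acts
  through.\<close>

definition open_chamber :: "(real^10 \<Rightarrow> real^10) \<Rightarrow> (real^10) set" where
  "open_chamber g = {x \<in> P10. \<forall>i<10. form10 x (g (simple10 i)) > 0}"

definition closed_chamber :: "(real^10 \<Rightarrow> real^10) \<Rightarrow> (real^10) set" where
  "closed_chamber g = {x \<in> P10. \<forall>i<10. form10 x (g (simple10 i)) \<ge> 0}"

lemma weyl10_chamber: "weyl10 \<in> open_chamber id"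
  by (simp add: open_chamber_def weyl10_P10 weyl10_simple)

lemma open_chamber_iff:
  "g \<in> isoms10 \<Longrightarrow> x \<in> open_chamber g \<longleftrightarrow> inv g x \<in> open_chamber id"
  unfolding open_chamber_def using isoms10_P10[of g "inv g x"] isoms10_P10[OF isoms10_inv, of g x]
   isoms10_adjoint[OF isoms10_inv, of g x]
  by (auto simp: isoms10_inv_apply inv_inv_eq isoms10_bij)

lemma open_chamber_image:
  "g \<in> isoms10 \<Longrightarrow> x \<in> open_chamber id \<Longrightarrow> g x \<in> open_chamber g"
  by (simp add: open_chamber_iff isoms10_inv_apply)

lemma open_chamber_nonempty: "g \<in> isoms10 \<Longrightarrow> g weyl10 \<in> open_chamber g"
  using open_chamber_image weyl10_chamber by blast

lemma root10_pos_on_chamber_id: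
  assumes r: "r \<in> roots10" and x: "x \<in> open_chamber id"
  shows "form10 x r \<noteq> 0" "form10 x r > 0 \<longleftrightarrow> (\<forall>i<10. form10 r (weight10 i) \<ge> 0)"
proof -
  have nz: "\<exists>i<10. form10 r (weight10 i) \<noteq> 0"
  proof (rule ccontr)
    assume "\<not> ?thesis"
    then have "r = 0" using simple10_expand[of r] by (metis (no_types, lifting) lessThan_iff scale_eq_0_iff sum.neutral)
    then show False using r by (simp add: roots10_def)
  qed
  have pos: "form10 x q > 0" if q: "\<forall>i<10. form10 q (weight10 i) \<ge> 0" "\<exists>i<10. form10 q (weight10 i) \<noteq> 0" for q
  proof -
    from q obtain i where i: "i < 10" "form10 q (weight10 i) > 0" by (metis less_eq_real_def)
    show ?thesis unfolding form10_expand_simple[of x q]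
      by (rule sum_pos2[of _ i]) (use i q x in \<open>auto simp: open_chamber_def intro: mult_nonneg_nonneg less_imp_le\<close>)
  qed
  have neg: "form10 x r < 0" if "\<forall>i<10. form10 r (weight10 i) \<le> 0" using pos[of "- r"] that nz by simp
  have ps: "form10 x r > 0" if "\<forall>i<10. form10 r (weight10 i) \<ge> 0" using pos[of r] that nz by simp
  show "form10 x r \<noteq> 0" using root10_sign[OF r] neg ps by fastforce
  show "form10 x r > 0 \<longleftrightarrow> (\<forall>i<10. form10 r (weight10 i) \<ge> 0)"
    using root10_sign[OF r] neg ps by (metis less_asym)
qed

lemma open_chamber_root_sign:
  assumes g: "g \<in> isoms10" and r: "r \<in> roots10" and x: "x \<in> open_chamber g" and y: "y \<in> open_chamber g"
  shows "form10 x r \<noteq> 0" "form10 x r > 0 \<longleftrightarrow> form10 y r > 0"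
proof -
  have ir: "inv g r \<in> roots10" using isoms10_roots[OF isoms10_inv[OF g] r] .
  have e: "form10 z r = form10 (inv g z) (inv g r)" for z using isoms10_form[OF isoms10_inv[OF g]] by simp
  show "form10 x r \<noteq> 0" "form10 x r > 0 \<longleftrightarrow> form10 y r > 0"
    using root10_pos_on_chamber_id[OF ir] x y open_chamber_iff[OF g] e by metis+
qed

lemma open_chamber_regular: "g \<in> isoms10 \<Longrightarrow> open_chamber g \<subseteq> P10_reg"
  using open_chamber_root_sign(1) by (force simp: P10_reg_def open_chamber_def)

lemma open_chamber_convex: "convex (open_chamber g)"
proof (rule convexI)
  fix x y and u v :: real assume h: "x \<in> open_chamber g" "y \<in> open_chamber g" "0 \<le> u" "0 \<le> v" "u + v = 1"
  have "0 < u * form10 x (g (simple10 i)) + v * form10 y (g (simple10 i))" if "i < 10" for i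
  proof -
    have "form10 x (g (simple10 i)) > 0" "form10 y (g (simple10 i)) > 0" using h that by (auto simp: open_chamber_def)
    then show ?thesis using h(3-5) by (cases "u = 0") (auto intro!: add_pos_nonneg)
  qed
  then show "u *\<^sub>R x + v *\<^sub>R y \<in> open_chamber g" using h by (auto simp: open_chamber_def P10_convex_comb)
qed

text \<open>The open chamber is convex and meets no mirror, so it lies in one component. Conversely,
  leaving it inside a connected set forces some simple root to vanish, by the intermediate value
  property.\<close>

lemma connected_component_open_chamber:
  assumes g: "g \<in> isoms10" and x: "x \<in> open_chamber g"
  shows "connected_component_set P10_reg x = open_chamber g"
proof
  show "open_chamber g \<subseteq> connected_component_set P10_reg x"
    using connected_component_maximal[OF x convex_connected[OF open_chamber_convex] open_chamber_regular[OF g]] .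
  show "connected_component_set P10_reg x \<subseteq> open_chamber g"
  proof
    fix y assume y: "y \<in> connected_component_set P10_reg x"
    let ?T = "connected_component_set P10_reg x"
    have sub: "?T \<subseteq> P10_reg" by (rule connected_component_subset)
    have xT: "x \<in> ?T" using x open_chamber_regular[OF g] by auto
    have "form10 y (g (simple10 i)) > 0" if i: "i < 10" for i
    proof (rule ccontr)
      let ?f = "\<lambda>z. form10 z (g (simple10 i))"
      assume a: "\<not> ?f y > 0"
      have "connected (?f ` ?T)"
        by (intro connected_continuous_image continuous_intros connected_connected_component)
      moreover have "?f x > 0" using x i by (simp add: open_chamber_def)
      ultimately have "{?f y..?f x} \<subseteq> ?f ` ?T" using xT y by (intro connected_contains_Icc imageI)
      moreover have "0 \<in> {?f y..?f x}" using a \<open>?f x > 0\<close> by auto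
      ultimately have "0 \<in> ?f ` ?T" by blast
      then obtain z where "z \<in> ?T" "?f z = 0" by auto
      moreover have "g (simple10 i) \<in> roots10" using isoms10_roots[OF g simple10_roots[OF i]] .
      ultimately show False using sub by (auto simp: P10_reg_def)
    qed
    moreover have "y \<in> P10" using y sub by (auto simp: P10_reg_def)
    ultimately show "y \<in> open_chamber g" by (simp add: open_chamber_def)
  qed
qed

lemma limit_in_closure:
  fixes x p :: "real^10"
  assumes "\<And>\<delta>. \<delta> > 0 \<Longrightarrow> \<exists>t. 0 < t \<and> t < \<delta> \<and> x + t *\<^sub>R p \<in> S"
  shows "x \<in> closure S"
  unfolding closure_approachable
proof (intro allI impI)
  fix e :: real assume e: "e > 0"
  have "e / (norm p + 1) > 0" using e by (simp add: add_nonneg_pos)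
  then obtain t where t: "0 < t" "t < e / (norm p + 1)" "x + t *\<^sub>R p \<in> S" using assms by blast
  have "t * norm p \<le> t * (norm p + 1)" using t(1) by simp
  also have "\<dots> < e" using t(2) by (simp add: pos_less_divide_eq add_nonneg_pos)
  finally have "dist (x + t *\<^sub>R p) x < e" using t(1) by (simp add: dist_norm)
  then show "\<exists>y\<in>S. dist y x < e" using t(3) by blast
qed

lemma closure_open_chamber:
  assumes g: "g \<in> isoms10" shows "closure (open_chamber g) \<inter> P10 = closed_chamber g"
proof
  have "closed {x. \<forall>i\<in>{..<10}. form10 x (g (simple10 i)) \<ge> 0}"
    unfolding Collect_ball_eq by (intro closed_INT ballI closed_Collect_le continuous_intros)
  moreover have "open_chamber g \<subseteq> {x. \<forall>i\<in>{..<10}. form10 x (g (simple10 i)) \<ge> 0}"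
    by (auto simp: open_chamber_def less_imp_le)
  ultimately have "closure (open_chamber g) \<subseteq> {x. \<forall>i\<in>{..<10}. form10 x (g (simple10 i)) \<ge> 0}"
    by (rule closure_minimal[rotated])
  then show "closure (open_chamber g) \<inter> P10 \<subseteq> closed_chamber g" by (auto simp: closed_chamber_def)
  show "closed_chamber g \<subseteq> closure (open_chamber g) \<inter> P10"
  proof
    fix x assume x: "x \<in> closed_chamber g"
    define p where "p = g weyl10"
    have p: "p \<in> open_chamber g" using open_chamber_nonempty[OF g] by (simp add: p_def)
    have "x + t *\<^sub>R p \<in> open_chamber g" if "t > 0" for t
      using x p that by (auto simp: open_chamber_def closed_chamber_def P10_add P10_scale add_nonneg_pos)
    then have "x \<in> closure (open_chamber g)" by (intro limit_in_closure[of x p]) (metis dense)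
    then show "x \<in> closure (open_chamber g) \<inter> P10" using x by (auto simp: closed_chamber_def)
  qed
qed

lemma vinberg_chamber_closed_chamber: "g \<in> isoms10 \<Longrightarrow> vinberg_chamber (closed_chamber g)"
  unfolding vinberg_chamber_def using open_chamber_nonempty[of g] open_chamber_regular[of g]
   connected_component_open_chamber[of g] closure_open_chamber[of g] by (metis subsetD)

text \<open>Choose the image of \<open>x\<close> of least height over \<open>weyl10\<close>: a
  simple root pairing negatively with it would give a reflection lowering the height further, and a
  zero pairing contradicts regularity.\<close>

lemma regular_in_open_chamber:
  assumes x: "x \<in> P10_reg" obtains g where "g \<in> isoms10" "x \<in> open_chamber g"
proof -
  have xP: "x \<in> P10" using x by (simp add: P10_reg_def)
  obtain g where g: "g \<in> isoms10" and min: "\<And>h. h \<in> isoms10 \<Longrightarrow> form10 (g x) weyl10 \<le> form10 (h x) weyl10"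
    using isoms10_min_exists[of isoms10, OF _ _ xP weyl10_P10 weyl10_L10] isoms10_id by blast
  have "form10 (g x) (simple10 i) > 0" if i: "i < 10" for i
  proof -
    have s: "simple10 i \<in> roots10" using simple10_roots[OF i] .
    have "refl10 (simple10 i) \<circ> g \<in> isoms10" using refl10_isoms10[OF s] g isoms10_comp by blast
    from min[OF this] have "form10 (g x) (simple10 i) \<ge> 0"
      using weyl10_simple[OF i] form10_commute[of "simple10 i" weyl10] by (simp add: refl10_def)
    moreover have "form10 (g x) (simple10 i) = form10 x (inv g (simple10 i))" using isoms10_adjoint[OF g] .
    moreover have "inv g (simple10 i) \<in> roots10" using isoms10_roots[OF isoms10_inv[OF g] s] .
    ultimately show ?thesis using x by (auto simp: P10_reg_def less_eq_real_def)
  qed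
  then have "g x \<in> open_chamber id" using isoms10_P10[OF g xP] by (simp add: open_chamber_def)
  then have "x \<in> open_chamber (inv g)"
    using open_chamber_iff[OF isoms10_inv[OF g]] isoms10_bij[OF g] by (simp add: inv_inv_eq)
  then show thesis using that isoms10_inv[OF g] by blast
qed

text \<open>An isometry preserving the chamber permutes the simple roots, hence the dual weights; these have
  pairwise distinct squares.\<close>
lemma chamber_stabilizer_trivial:
  assumes g: "g \<in> isoms10" and y: "y \<in> open_chamber id" "g y \<in> open_chamber id"
  shows "g = id"
proof -
  have ig: "inv g \<in> isoms10" using isoms10_inv[OF g] .
  have l: "linear g" "linear (inv g)" using g ig isoms10_linear by auto
  have pos: "form10 (g (simple10 i)) (weight10 j) \<ge> 0" if "i < 10" "j < 10" for i j
  proof -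
    have r: "g (simple10 i) \<in> roots10" using isoms10_roots[OF g simple10_roots] that by blast
    have "form10 (g y) (g (simple10 i)) > 0" using isoms10_form[OF g] y that by (simp add: open_chamber_def)
    then show ?thesis using root10_pos_on_chamber_id(2)[OF r y(2)] that by blast
  qed
  \<comment> \<open>The preimages of the simple roots are positive on \<open>y\<close>, hence
    positive roots, hence of integral height at least 1.\<close>
  have ht: "form10 (inv g (simple10 i)) weyl10 \<ge> 1" if i: "i < 10" for i
  proof -
    have r: "inv g (simple10 i) \<in> roots10" using isoms10_roots[OF ig simple10_roots] that by blast
    have "form10 y (inv g (simple10 i)) > 0" using isoms10_adjoint[OF g, of y] y i by (simp add: open_chamber_def)
    then have "\<forall>j<10. form10 (inv g (simple10 i)) (weight10 j) \<ge> 0" using root10_pos_on_chamber_id(2)[OF r y(1)] by blast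
    then have "form10 weyl10 (inv g (simple10 i)) > 0" using root10_pos_on_chamber_id(2)[OF r weyl10_chamber] by blast
    moreover have "form10 weyl10 (inv g (simple10 i)) \<in> \<int>"
      using form10_Ints[OF weyl10_L10] r by (simp add: roots10_def)
    ultimately show ?thesis by (auto simp: form10_commute[of _ weyl10] elim!: Ints_cases)
  qed
  have perm: "\<exists>j<10. g (simple10 i) = simple10 j" if i: "i < 10" for i
  proof -
    define n where "n j = form10 (g (simple10 i)) (weight10 j)" for j
    have nZ: "n j \<in> \<int>" if "j < 10" for j
      using that i form10_Ints weight10_L10 isoms10_roots[OF g simple10_roots[OF i]] by (simp add: n_def roots10_def)
    have n0: "n j \<ge> 0" if "j < 10" for j using pos i that by (simp add: n_def)
    have gs: "g (simple10 i) = (\<Sum>j<10. n j *\<^sub>R simple10 j)" using simple10_expand[of "g (simple10 i)"] by (simp add: n_def)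
    have "simple10 i = inv g (g (simple10 i))" using isoms10_inv_apply[OF g] by simp
    also have "\<dots> = (\<Sum>j<10. n j *\<^sub>R inv g (simple10 j))"
      by (simp add: gs linear_sum[OF l(2)] linear_scale[OF l(2)])
    finally have e: "simple10 i = (\<Sum>j<10. n j *\<^sub>R inv g (simple10 j))" .
    \<comment> \<open>A simple root has height 1, while the \<open>n j\<close> are nonnegative
      integers weighted by heights at least 1. So exactly one \<open>n j\<close> is nonzero, and it
      equals 1.\<close>
    have "1 = form10 (simple10 i) weyl10" using weyl10_simple[OF i] form10_commute by metis
    also have "\<dots> = (\<Sum>j<10. n j * form10 (inv g (simple10 j)) weyl10)"
      by (subst e) simp
    also have "\<dots> \<ge> (\<Sum>j<10. n j)" using n0 ht by (intro sum_mono) (force simp: mult_le_cancel_left1)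
    finally have s: "(\<Sum>j<10. n j) \<le> 1" .
    have "\<exists>j<10. n j \<noteq> 0"
    proof (rule ccontr)
      assume "\<not> ?thesis"
      then have "g (simple10 i) = 0" unfolding gs by (intro sum.neutral) auto
      then show False using isoms10_roots[OF g simple10_roots[OF i]] by (simp add: roots10_def)
    qed
    then obtain j where j: "j < 10" "n j \<noteq> 0" by blast
    then have j1: "n j \<ge> 1" using nZ[of j] n0[of j] by (auto elim!: Ints_cases)
    have "(\<Sum>k<10. n k) = n j + (\<Sum>k\<in>{..<10} - {j}. n k)" using j by (subst sum.remove[of _ j]) auto
    moreover have nn: "(\<Sum>k\<in>{..<10} - {j}. n k) \<ge> 0" using n0 by (intro sum_nonneg) auto
    ultimately have "n j = 1" "(\<Sum>k\<in>{..<10} - {j}. n k) = 0" using s j1 by linarith+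
    moreover from this have "\<forall>k\<in>{..<10} - {j}. n k = 0" using n0 by (subst (asm) sum_nonneg_eq_0_iff) auto
    ultimately have "g (simple10 i) = (\<Sum>k<10. if k = j then simple10 k else 0)" unfolding gs
      by (intro sum.cong) auto
    then show ?thesis using j by auto
  qed
  then obtain \<pi> where pi: "\<And>i. i < 10 \<Longrightarrow> \<pi> i < 10 \<and> g (simple10 i) = simple10 (\<pi> i)" by metis
  have inj: "i = k" if "i < 10" "k < 10" "\<pi> i = \<pi> k" for i k
  proof -
    have "g (simple10 i) = g (simple10 k)" using pi that by simp
    then have "simple10 i = simple10 k" using isoms10_inv_apply(1)[OF g] by metis
    then show ?thesis using weight10_dual[of i i] weight10_dual[of i k] that by (auto split: if_splits)
  qed
  have "\<pi> i = i" if i: "i < 10" for i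
  proof -
    have "inv g (weight10 (\<pi> i)) = weight10 i"
    proof (rule eq_by_simple10)
      fix k :: nat assume k: "k < 10"
      have "form10 (inv g (weight10 (\<pi> i))) (simple10 k) = form10 (g (inv g (weight10 (\<pi> i)))) (g (simple10 k))"
        using isoms10_form[OF g] by simp
      also have "\<dots> = form10 (weight10 (\<pi> i)) (simple10 (\<pi> k))" using pi k isoms10_inv_apply(2)[OF g] by simp
      also have "\<dots> = form10 (weight10 i) (simple10 k)" using weight10_dual pi i k inj by auto
      finally show "form10 (inv g (weight10 (\<pi> i))) (simple10 k) = form10 (weight10 i) (simple10 k)" .
    qed
    then show ?thesis using weight10_norm_inj pi i isoms10_form[OF ig] by metis
  qed
  then have fx: "g (simple10 i) = simple10 i" if "i < 10" for i using pi that by auto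
  have "g x = x" for x
  proof -
    have "g x = g (\<Sum>i<10. form10 x (weight10 i) *\<^sub>R simple10 i)" by (simp add: simple10_expand)
    also have "\<dots> = (\<Sum>i<10. form10 x (weight10 i) *\<^sub>R simple10 i)"
      using fx by (simp add: linear_sum[OF l(1)] linear_scale[OF l(1)])
    finally show ?thesis by (simp add: simple10_expand)
  qed
  then show ?thesis by (simp add: fun_eq_iff)
qed

lemma open_chamber_inj:
  assumes "g \<in> isoms10" "h \<in> isoms10" "x \<in> open_chamber g" "x \<in> open_chamber h" shows "g = h"
proof -
  have "(inv h \<circ> g) (inv g x) = inv h x" using isoms10_inv_apply(2)[OF assms(1)] by simp
  then have "inv h \<circ> g = id"
    using chamber_stabilizer_trivial[OF isoms10_comp[OF isoms10_inv[OF assms(2)] assms(1)], of "inv g x"]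
      assms open_chamber_iff by metis
  then show ?thesis using isoms10_inv_apply(2)[OF assms(2)] by (metis comp_apply id_apply ext)
qed

lemma closed_chamber_inj:
  assumes g: "g \<in> isoms10" and h: "h \<in> isoms10" and e: "closed_chamber g = closed_chamber h" shows "g = h"
proof -
  let ?x = "g weyl10"
  have x: "?x \<in> open_chamber g" using open_chamber_nonempty[OF g] .
  then have "?x \<in> closed_chamber h" unfolding e[symmetric] by (auto simp: open_chamber_def closed_chamber_def less_imp_le)
  moreover have "form10 ?x (h (simple10 i)) \<noteq> 0" if "i < 10" for i
    using open_chamber_root_sign(1)[OF g _ x x] isoms10_roots[OF h simple10_roots[OF that]] by blast
  ultimately have "?x \<in> open_chamber h" by (force simp: open_chamber_def closed_chamber_def less_eq_real_def)
  with x show ?thesis using open_chamber_inj g h by blast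
qed

section \<open>The Petersen graph on triples\<close>

definition triples :: "nat set list" where
  "triples = [{1,2,3},{1,2,4},{1,2,5},{1,3,4},{1,3,5},{1,4,5},{2,3,4},{2,3,5},{2,4,5},{3,4,5}]"
lemma triples_distinct: "distinct triples" by code_simp
lemma five_eq: "five = {1,2,3,4,5}" by (auto simp: five_def)
lemma setA_triples: "setA = set triples"
proof
  show "set triples \<subseteq> setA" by (auto simp: triples_def setA_def five_def)
  have "finite setA" "card setA = 10" using n_subsets[of five 3] by (simp_all add: setA_def five_def choose_reduce_nat numeral_eq_Suc)
  moreover have "card (set triples) = 10" using distinct_card[OF triples_distinct] by (simp add: triples_def)
  ultimately show "setA \<subseteq> set triples" using \<open>set triples \<subseteq> setA\<close> by (metis card_subset_eq subset_refl)
qed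

lemma triples_separate: "\<forall>\<alpha>\<in>set triples. \<forall>\<beta>\<in>set triples. \<alpha> \<noteq> \<beta> \<longrightarrow> (\<exists>\<gamma>\<in>set triples. (card (\<alpha> \<inter> \<gamma>) = 2) \<noteq> (card (\<beta> \<inter> \<gamma>) = 2))"
  by code_simp
text \<open>The witness swaps the two points outside \<alpha>. The last clause says that \<alpha>,
  \<beta> and the image of \<beta> are the three neighbours of one vertex, which makes the sum of
  their \<open>V\<close> even.\<close>

lemma triples_transpose: "\<forall>\<alpha>\<in>set triples. \<exists>i\<in>{1,2,3,4,5}. \<exists>j\<in>{1,2,3,4,5}. Transposition.transpose i j ` \<alpha> = \<alpha> \<and>
   (\<forall>\<beta>\<in>set triples. (card (\<alpha> \<inter> \<beta>) = 1 \<longrightarrow> Transposition.transpose i j ` \<beta> = \<beta>) \<and>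
     (card (\<alpha> \<inter> \<beta>) = 2 \<longrightarrow> Transposition.transpose i j ` \<beta> \<noteq> \<beta> \<and> Transposition.transpose i j ` \<beta> \<noteq> \<alpha> \<and> (\<exists>\<gamma>\<in>set triples. set (filter (\<lambda>\<delta>. card (\<delta> \<inter> \<gamma>) = 1) triples) = {\<alpha>, \<beta>, Transposition.transpose i j ` \<beta>})))"
  by code_simp

lemma sum_setA: "sum f setA = f {1,2,3} + f {1,2,4} + f {1,2,5} + f {1,3,4} + f {1,3,5} + f {1,4,5} + f {2,3,4} + f {2,3,5} + f {2,4,5} + f {3,4,5}"
  for f :: "nat set \<Rightarrow> 'a::comm_monoid_add"
  unfolding setA_triples sum.distinct_set_conv_list[OF triples_distinct] by (simp add: triples_def add.assoc)

text \<open>Two triples meet in one point iff the complementary pairs are disjoint, so this is the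
  adjacency matrix of the Petersen graph.\<close>

definition adj :: "nat set \<Rightarrow> nat set \<Rightarrow> real" where "adj \<alpha> \<beta> = (if card (\<alpha> \<inter> \<beta>) = 1 then 1 else 0)"

lemma adj_sum: "(\<Sum>\<alpha>\<in>setA. \<Sum>\<beta>\<in>setA. c \<alpha> * adj \<alpha> \<beta> * c \<beta>) = 
  2 * (c {1,2,3} * (c {1,4,5} + c {2,4,5} + c {3,4,5}) + c {1,2,4} * (c {1,3,5} + c {2,3,5} + c {3,4,5})
     + c {1,2,5} * (c {1,3,4} + c {2,3,4} + c {3,4,5}) + c {1,3,4} * (c {2,3,5} + c {2,4,5})
     + c {1,3,5} * (c {2,3,4} + c {2,4,5}) + c {1,4,5} * (c {2,3,4} + c {2,3,5}))"
  unfolding sum_setA adj_def by (simp add: algebra_simps)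

lemma adj_row: "\<beta> \<in> setA \<Longrightarrow> (\<Sum>\<alpha>\<in>setA. adj \<alpha> \<beta>) = 3"
proof -
  have "\<forall>\<beta>\<in>set triples. length (filter (\<lambda>\<alpha>. card (\<alpha> \<inter> \<beta>) = 1) triples) = 3" by code_simp
  moreover have "(\<Sum>\<alpha>\<in>setA. adj \<alpha> \<beta>) = real (length (filter (\<lambda>\<alpha>. card (\<alpha> \<inter> \<beta>) = 1) triples))"
    unfolding setA_triples sum.distinct_set_conv_list[OF triples_distinct] adj_def
    by (simp add: sum_list_map_filter'[symmetric] sum_list_triv)
  ultimately show "\<beta> \<in> setA \<Longrightarrow> (\<Sum>\<alpha>\<in>setA. adj \<alpha> \<beta>) = 3" by (simp add: setA_triples)
qed

text \<open>The eigenvalues of the Petersen matrix A are 3, 1, -2. With J the all-ones matrix, I +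
  J/5 - A vanishes on the eigenspaces of 3 (constants) and 1, and is 3 on that of -2.\<close>

lemma petersen_le: "(\<Sum>\<alpha>\<in>setA. \<Sum>\<beta>\<in>setA. c \<alpha> * adj \<alpha> \<beta> * c \<beta>) \<le> (\<Sum>\<alpha>\<in>setA. (c \<alpha>)\<^sup>2) + (\<Sum>\<alpha>\<in>setA. c \<alpha>)\<^sup>2 / 5"
proof -
  have "2 * (a * (g + j + k) + b * (f + i + k) + d * (e + h + k) + e * (i + j) + f * (h + j) + g * (h + i))
     \<le> a^2 + b^2 + d^2 + e^2 + f^2 + g^2 + h^2 + i^2 + j^2 + k^2 + (a+b+d+e+f+g+h+i+j+k)\<^sup>2 / 5"
    (is "?L \<le> ?R + ?s\<^sup>2 / 5") for a b d e f g h i j k :: real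
  proof -
    \<comment> \<open>One square for each point of {1,...,5}: the four summands are the triples
      avoiding that point, an independent set of the graph. These five forms span the dual of the
      eigenspace of -2.\<close>
    have "25 * ?R + 5 * ?s\<^sup>2 - 25 * ?L
     = (5*(h+i+j+k) - 2 * ?s)\<^sup>2 + (5*(e+f+g+k) - 2 * ?s)\<^sup>2
     + (5*(b+d+g+j) - 2 * ?s)\<^sup>2 + (5*(a+d+f+i) - 2 * ?s)\<^sup>2 + (5*(a+b+e+h) - 2 * ?s)\<^sup>2" by algebra
    also have "\<dots> \<ge> 0" by (intro add_nonneg_nonneg zero_le_power2)
    finally have n: "0 \<le> 25 * ?R + 5 * ?s\<^sup>2 - 25 * ?L" .
    have "0 \<le> 25 * R + 5 * S - 25 * L \<Longrightarrow> L \<le> R + S / 5" for R S L :: real by simp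
    from this[OF n] show ?thesis .
  qed
  then show ?thesis unfolding adj_sum unfolding sum_setA .
qed

text \<open>The companion bound at the other end of the spectrum: 2I + A - J/2 vanishes on the
  eigenspaces of 3 and -2 and is 3 on that of 1. The ten squares below are the coordinates of this
  projection, up to scale.\<close>

lemma petersen_ge: "(\<Sum>\<alpha>\<in>setA. c \<alpha>)\<^sup>2 / 2 \<le> 2 * (\<Sum>\<alpha>\<in>setA. (c \<alpha>)\<^sup>2) + (\<Sum>\<alpha>\<in>setA. \<Sum>\<beta>\<in>setA. c \<alpha> * adj \<alpha> \<beta> * c \<beta>)"
proof -
  have "(a+b+d+e+f+g+h+i+j+k)\<^sup>2 / 2 \<le> 2 * (a^2 + b^2 + d^2 + e^2 + f^2 + g^2 + h^2 + i^2 + j^2 + k^2)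
     + 2 * (a * (g + j + k) + b * (f + i + k) + d * (e + h + k) + e * (i + j) + f * (h + j) + g * (h + i))"
    (is "?s\<^sup>2 / 2 \<le> ?R + ?L") for a b d e f g h i j k :: real
  proof -
    have "12 * (?R + ?L) - 6 * ?s\<^sup>2
     = (2*(2*a+g+j+k) - ?s)\<^sup>2 + (2*(2*b+f+i+k) - ?s)\<^sup>2 + (2*(2*d+e+h+k) - ?s)\<^sup>2 + (2*(2*e+d+i+j) - ?s)\<^sup>2
     + (2*(2*f+b+h+j) - ?s)\<^sup>2 + (2*(2*g+a+h+i) - ?s)\<^sup>2 + (2*(2*h+d+f+g) - ?s)\<^sup>2 + (2*(2*i+b+e+g) - ?s)\<^sup>2
     + (2*(2*j+a+e+f) - ?s)\<^sup>2 + (2*(2*k+a+b+d) - ?s)\<^sup>2" by algebra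
    also have "\<dots> \<ge> 0" by (intro add_nonneg_nonneg zero_le_power2)
    finally have n: "0 \<le> 12 * (?R + ?L) - 6 * ?s\<^sup>2" .
    have "0 \<le> 12 * R - 6 * S \<Longrightarrow> S / 2 \<le> R" for R S :: real by simp
    from this[OF n] show ?thesis .
  qed
  then show ?thesis unfolding adj_sum unfolding sum_setA .
qed

lemma finite_setA [simp]: "finite setA" by (simp add: setA_triples)

lemma card_setA: "card setA = 10"
  unfolding setA_triples distinct_card[OF triples_distinct] by (simp add: triples_def)

lemma setA_inter_card: "\<alpha> \<in> setA \<Longrightarrow> \<beta> \<in> setA \<Longrightarrow> card (\<alpha> \<inter> \<beta>) = (if \<alpha> = \<beta> then 3 else if card (\<alpha> \<inter> \<beta>) = 1 then 1 else 2)"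
proof -
  have "\<forall>\<alpha>\<in>set triples. \<forall>\<beta>\<in>set triples. card (\<alpha> \<inter> \<beta>) = (if \<alpha> = \<beta> then 3 else if card (\<alpha> \<inter> \<beta>) = 1 then 1 else 2)"
    by code_simp
  then show "\<alpha> \<in> setA \<Longrightarrow> \<beta> \<in> setA \<Longrightarrow> card (\<alpha> \<inter> \<beta>) = (if \<alpha> = \<beta> then 3 else if card (\<alpha> \<inter> \<beta>) = 1 then 1 else 2)"
    unfolding setA_triples by blast
qed

lemma adj_self: "\<alpha> \<in> setA \<Longrightarrow> adj \<alpha> \<alpha> = 0"
  by (simp add: adj_def setA_def)

lemma adj_commute: "adj \<alpha> \<beta> = adj \<beta> \<alpha>"
  by (simp add: adj_def Int_commute)

lemma adj_bounds: "0 \<le> adj \<alpha> \<beta>" "adj \<alpha> \<beta> \<le> 1" by (simp_all add: adj_def)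

text \<open>The shortest nonzero vectors of the root lattice A_9. Special roots orthogonal to
  \<open>w\<close> will be reduced to these.\<close>

lemma sum_zero_short:
  fixes c :: "nat set \<Rightarrow> real"
  assumes Z: "\<And>\<alpha>. \<alpha> \<in> setA \<Longrightarrow> c \<alpha> \<in> \<int>" and s0: "sum c setA = 0" and s2: "(\<Sum>\<alpha>\<in>setA. (c \<alpha>)\<^sup>2) \<le> 2"
    and nz: "\<exists>\<alpha>\<in>setA. c \<alpha> \<noteq> 0"
  shows "\<exists>\<alpha>\<in>setA. \<exists>\<beta>\<in>setA. \<alpha> \<noteq> \<beta> \<and> (\<forall>\<gamma>\<in>setA. c \<gamma> = (if \<gamma> = \<alpha> then 1 else if \<gamma> = \<beta> then -1 else 0))"
proof -
  have "\<exists>\<alpha>\<in>setA. c \<alpha> > 0"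
  proof (rule ccontr)
    assume "\<not> ?thesis"
    then have "\<forall>\<alpha>\<in>setA. c \<alpha> \<le> 0" by (auto simp: not_less)
    then have "\<forall>\<alpha>\<in>setA. - c \<alpha> = 0" using s0 sum_nonneg_eq_0_iff[of setA "\<lambda>\<alpha>. - c \<alpha>"] by (simp add: sum_negf)
    with nz show False by auto
  qed
  then obtain \<alpha> where a: "\<alpha> \<in> setA" "c \<alpha> > 0" by blast
  have "\<exists>\<alpha>\<in>setA. c \<alpha> < 0"
  proof (rule ccontr)
    assume "\<not> ?thesis"
    then have "\<forall>\<alpha>\<in>setA. c \<alpha> \<ge> 0" by (auto simp: not_less)
    then have "\<forall>\<alpha>\<in>setA. c \<alpha> = 0" using s0 sum_nonneg_eq_0_iff[of setA c] by simp
    with nz show False by blast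
  qed
  then obtain \<beta> where b: "\<beta> \<in> setA" "c \<beta> < 0" by blast
  have ab: "\<alpha> \<noteq> \<beta>" using a b by auto
  have a1: "c \<alpha> \<ge> 1" and b1: "c \<beta> \<le> -1" using Z a b by (force elim!: Ints_cases)+
  have "(c \<alpha>)\<^sup>2 \<ge> c \<alpha>" "(c \<beta>)\<^sup>2 \<ge> - c \<beta>"
    using a1 b1 mult_left_mono[of 1 "c \<alpha>" "c \<alpha>"] mult_left_mono[of 1 "- c \<beta>" "- c \<beta>"] by (simp_all add: power2_eq_square)
  have "(\<Sum>\<gamma>\<in>setA. (c \<gamma>)\<^sup>2) = (c \<alpha>)\<^sup>2 + ((c \<beta>)\<^sup>2 + (\<Sum>\<gamma>\<in>setA - {\<alpha>} - {\<beta>}. (c \<gamma>)\<^sup>2))"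
    using a b ab by (simp add: sum.remove[of setA \<alpha>] sum.remove[of "setA - {\<alpha>}" \<beta>])
  moreover have "(\<Sum>\<gamma>\<in>setA - {\<alpha>} - {\<beta>}. (c \<gamma>)\<^sup>2) \<ge> 0" by (intro sum_nonneg) simp
  ultimately have r0: "(\<Sum>\<gamma>\<in>setA - {\<alpha>} - {\<beta>}. (c \<gamma>)\<^sup>2) = 0" and "c \<alpha> = 1" "c \<beta> = -1"
    using s2 a1 b1 \<open>(c \<alpha>)\<^sup>2 \<ge> c \<alpha>\<close> \<open>(c \<beta>)\<^sup>2 \<ge> - c \<beta>\<close> by linarith+
  moreover have "\<forall>\<gamma>\<in>setA - {\<alpha>} - {\<beta>}. c \<gamma> = 0" using r0 by (subst (asm) sum_nonneg_eq_0_iff) auto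
  ultimately show ?thesis using a b ab by (intro bexI[of _ \<alpha>] bexI[of _ \<beta>]) auto
qed

lemma adj_sum_short:
  assumes ab: "\<alpha> \<in> setA" "\<beta> \<in> setA" "\<alpha> \<noteq> \<beta>" and c: "\<forall>\<gamma>\<in>setA. c \<gamma> = (if \<gamma> = \<alpha> then 1 else if \<gamma> = \<beta> then -1 else 0)"
  shows "(\<Sum>\<gamma>\<in>setA. \<Sum>\<delta>\<in>setA. c \<gamma> * adj \<gamma> \<delta> * c \<delta>) = - 2 * adj \<alpha> \<beta>" "(\<Sum>\<gamma>\<in>setA. (c \<gamma>)\<^sup>2) = 2"
proof -
  have s: "(\<Sum>\<gamma>\<in>setA. c \<gamma> * f \<gamma>) = f \<alpha> - f \<beta>" for f :: "nat set \<Rightarrow> real"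
  proof -
    have "(\<Sum>\<gamma>\<in>setA. c \<gamma> * f \<gamma>) = (\<Sum>\<gamma>\<in>setA. (if \<gamma> = \<alpha> then f \<gamma> else 0) - (if \<gamma> = \<beta> then f \<gamma> else 0))"
      using c ab by (intro sum.cong) auto
    also have "\<dots> = f \<alpha> - f \<beta>" using ab by (simp add: sum_subtractf)
    finally show ?thesis .
  qed
  have "(\<Sum>\<gamma>\<in>setA. \<Sum>\<delta>\<in>setA. c \<gamma> * adj \<gamma> \<delta> * c \<delta>) = (\<Sum>\<gamma>\<in>setA. c \<gamma> * (\<Sum>\<delta>\<in>setA. c \<delta> * adj \<gamma> \<delta>))"
    by (simp add: sum_distrib_left mult_ac)
  also have "\<dots> = - 2 * adj \<alpha> \<beta>" using ab adj_self adj_commute[of \<beta> \<alpha>] by (simp add: s)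
  finally show "(\<Sum>\<gamma>\<in>setA. \<Sum>\<delta>\<in>setA. c \<gamma> * adj \<gamma> \<delta> * c \<delta>) = - 2 * adj \<alpha> \<beta>" .
  show "(\<Sum>\<gamma>\<in>setA. (c \<gamma>)\<^sup>2) = 2" using s[of c] c ab by (simp add: power2_eq_square)
qed

section \<open>Special roots do not cut the chamber\<close>

definition cong2 :: "real^10 \<Rightarrow> real^10 \<Rightarrow> bool" where
  "cong2 x y \<longleftrightarrow> (\<exists>z\<in>L10. x - y = 2 *\<^sub>R z)"

lemma cong2_refl: "cong2 x x"
  unfolding cong2_def by (rule bexI[of _ 0]) (auto simp: L10_closed)

lemma cong2_sym: "cong2 x y \<Longrightarrow> cong2 y x"
  unfolding cong2_def by (metis L10_closed(4) minus_diff_eq scaleR_minus_right)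

lemma cong2_trans: "cong2 x y \<Longrightarrow> cong2 y z \<Longrightarrow> cong2 x z"
  unfolding cong2_def by (metis (no_types, lifting) L10_closed(2) add_diff_add diff_add_cancel add_diff_cancel_left' add.commute diff_diff_eq2 scaleR_right_distrib)

lemma cong2_add: "cong2 x y \<Longrightarrow> cong2 x' y' \<Longrightarrow> cong2 (x + x') (y + y')"
  unfolding cong2_def by (metis (no_types, lifting) L10_closed(2) add_diff_add scaleR_right_distrib)

lemma cong2_diff: "cong2 x y \<Longrightarrow> cong2 x' y' \<Longrightarrow> cong2 (x - x') (y - y')"
proof -
  assume "cong2 x y" "cong2 x' y'"
  then obtain z z' where "z \<in> L10" "z' \<in> L10" "x - y = 2 *\<^sub>R z" "x' - y' = 2 *\<^sub>R z'" by (auto simp: cong2_def)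
  then have "x - x' - (y - y') = 2 *\<^sub>R (z - z')" by (simp add: algebra_simps)
  then show ?thesis unfolding cong2_def using \<open>z \<in> L10\<close> \<open>z' \<in> L10\<close> L10_closed(3) by blast
qed

lemma cong2_image: "g \<in> isoms10 \<Longrightarrow> cong2 x y \<Longrightarrow> cong2 (g x) (g y)"
  unfolding cong2_def by (metis isoms10_L10 isoms10_linear linear_diff linear_scale)

lemma cong2_form: "cong2 x y \<Longrightarrow> z \<in> L10 \<Longrightarrow> \<exists>k\<in>\<int>. form10 x z = form10 y z + 2 * k"
  unfolding cong2_def by (metis add.commute diff_add_cancel form10_Ints form10_add_left form10_scale_left)

lemma half_not_Ints: "(1/2::real) \<notin> \<int>"
proof
  assume "(1/2::real) \<in> \<int>"
  then obtain i where "(1/2::real) = of_int i" by (rule Ints_cases)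
  then have "(of_int 1 :: real) = of_int (2 * i)" by simp
  then have "1 = 2 * i" by (simp only: of_int_eq_iff)
  then show False by presburger
qed

text \<open>The classes of the ten curves (\<open>U\<close>) and the ten inner walls (\<open>V\<close>) after transport to \<open>L\<^sub>1\<^sub>0\<close>. All twenty
  are roots; the \<open>U\<close> span the Petersen graph, the \<open>V\<close> the triangular graph, its complement.\<close>
locale petersen_frame =
  fixes U V :: "nat set \<Rightarrow> real^10"
  assumes U_L10: "\<alpha> \<in> setA \<Longrightarrow> U \<alpha> \<in> L10"
    and V_L10: "\<alpha> \<in> setA \<Longrightarrow> V \<alpha> \<in> L10"
    and UU: "\<alpha> \<in> setA \<Longrightarrow> \<beta> \<in> setA \<Longrightarrow> form10 (U \<alpha>) (U \<beta>) = adj \<alpha> \<beta> - (if \<alpha> = \<beta> then 2 else 0)"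
    and VV: "\<alpha> \<in> setA \<Longrightarrow> \<beta> \<in> setA \<Longrightarrow> form10 (V \<alpha>) (V \<beta>) = 1 - adj \<alpha> \<beta> - (if \<alpha> = \<beta> then 3 else 0)"
    and UV: "\<alpha> \<in> setA \<Longrightarrow> \<beta> \<in> setA \<Longrightarrow> form10 (U \<alpha>) (V \<beta>) = (if \<alpha> = \<beta> then 2 else 0)"
    and expand_U: "2 *\<^sub>R x = (\<Sum>\<alpha>\<in>setA. form10 x (V \<alpha>) *\<^sub>R U \<alpha>)"
    and sum_U_P10: "sum U setA \<in> P10"
    and symmetry: "i \<in> five \<Longrightarrow> j \<in> five \<Longrightarrow> \<exists>\<sigma>\<in>isoms10. \<forall>\<alpha>\<in>setA.
       \<sigma> (U \<alpha>) = U (Transposition.transpose i j ` \<alpha>) \<and> \<sigma> (V \<alpha>) = V (Transposition.transpose i j ` \<alpha>)"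
begin

text \<open>The S_5-invariant point inside D from which heights are measured: it pairs to 1 with
  each \<open>U\<close> and to 2 with each \<open>V\<close>, and has square 10.\<close>

definition w :: "real^10" where "w = sum U setA"

lemma w_P10: "w \<in> P10" using sum_U_P10 by (simp add: w_def)

lemma w_L10: "w \<in> L10" unfolding w_def by (intro L10_sum U_L10)

lemma VU: "\<alpha> \<in> setA \<Longrightarrow> \<beta> \<in> setA \<Longrightarrow> form10 (V \<alpha>) (U \<beta>) = (if \<alpha> = \<beta> then 2 else 0)"
  using UV[of \<beta> \<alpha>] form10_commute[of "V \<alpha>" "U \<beta>"] by simp

lemma U_roots: "\<alpha> \<in> setA \<Longrightarrow> U \<alpha> \<in> roots10" and V_roots: "\<alpha> \<in> setA \<Longrightarrow> V \<alpha> \<in> roots10"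
  using UU[of \<alpha> \<alpha>] VV[of \<alpha> \<alpha>] U_L10 V_L10 by (auto simp: roots10_def adj_self)

lemma wU: "\<beta> \<in> setA \<Longrightarrow> form10 w (U \<beta>) = 1"
  by (simp add: w_def UU sum_subtractf adj_row)

lemma wV: "\<beta> \<in> setA \<Longrightarrow> form10 w (V \<beta>) = 2"
  by (simp add: w_def UV)

lemma ww: "form10 w w = 10"
proof -
  have "form10 w w = (\<Sum>\<alpha>\<in>setA. form10 w (U \<alpha>))" by (subst (2) w_def) simp
  also have "\<dots> = 10" by (simp add: wU card_setA)
  finally show ?thesis .
qed

lemma form_w: "form10 x w = (\<Sum>\<alpha>\<in>setA. form10 x (U \<alpha>))" by (simp add: w_def)

lemma form_UV: "2 * form10 x y = (\<Sum>\<alpha>\<in>setA. form10 x (V \<alpha>) * form10 (U \<alpha>) y)"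
proof -
  have "form10 (2 *\<^sub>R x) y = (\<Sum>\<alpha>\<in>setA. form10 x (V \<alpha>) * form10 (U \<alpha>) y)"
    by (subst expand_U) simp
  then show ?thesis by simp
qed

lemma eq_by_U:
  assumes "\<And>\<alpha>. \<alpha> \<in> setA \<Longrightarrow> form10 x (U \<alpha>) = form10 y (U \<alpha>)" shows "x = y"
proof -
  have "form10 (x - y) z = 0" for z
    using form_UV[of z "x - y"] assms by (simp add: form10_commute[of "U _"] form10_commute[of z])
  then show ?thesis using form10_nondegenerate[of "x - y"] by simp
qed

lemma expand_V: "2 *\<^sub>R x = (\<Sum>\<alpha>\<in>setA. form10 x (U \<alpha>) *\<^sub>R V \<alpha>)"
proof (rule eq_by_U)
  fix \<beta> assume b: "\<beta> \<in> setA"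
  have "form10 (\<Sum>\<alpha>\<in>setA. form10 x (U \<alpha>) *\<^sub>R V \<alpha>) (U \<beta>) = (\<Sum>\<alpha>\<in>setA. if \<alpha> = \<beta> then 2 * form10 x (U \<alpha>) else 0)"
    unfolding form10_sum_left form10_scale_left using b by (intro sum.cong) (auto simp: VU)
  then show "form10 (2 *\<^sub>R x) (U \<beta>) = form10 (\<Sum>\<alpha>\<in>setA. form10 x (U \<alpha>) *\<^sub>R V \<alpha>) (U \<beta>)" using b by simp
qed

lemma eq_by_V:
  assumes "\<And>\<alpha>. \<alpha> \<in> setA \<Longrightarrow> form10 x (V \<alpha>) = form10 y (V \<alpha>)" shows "x = y"
proof -
  have "2 *\<^sub>R x = 2 *\<^sub>R y" unfolding expand_U[of x] expand_U[of y] using assms by (intro sum.cong) auto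
  then show ?thesis by simp
qed

text \<open>The halves of the \<open>V\<close> form the dual basis of the \<open>U\<close>, whose
  Gram matrix is A - 2I; squares thus become Petersen quadratic forms to which the spectral bounds
  apply. The companion for the \<open>V\<close> has Gram matrix J - A - 3I.\<close>

lemma norm_U: "4 * form10 x x = (\<Sum>\<alpha>\<in>setA. \<Sum>\<beta>\<in>setA. form10 x (V \<alpha>) * adj \<alpha> \<beta> * form10 x (V \<beta>)) - 2 * (\<Sum>\<alpha>\<in>setA. (form10 x (V \<alpha>))\<^sup>2)"
proof -
  let ?c = "\<lambda>\<alpha>. form10 x (V \<alpha>)"
  have "4 * form10 x x = form10 (2 *\<^sub>R x) (2 *\<^sub>R x)" by simp
  also have "\<dots> = (\<Sum>\<alpha>\<in>setA. \<Sum>\<beta>\<in>setA. ?c \<alpha> * (?c \<beta> * form10 (U \<alpha>) (U \<beta>)))"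
    unfolding expand_U[of x] form10_sum_left form10_sum_right form10_scale_left form10_scale_right
    by (subst sum.swap) (simp add: sum_distrib_left mult.left_commute)
  also have "\<dots> = (\<Sum>\<alpha>\<in>setA. \<Sum>\<beta>\<in>setA. ?c \<alpha> * adj \<alpha> \<beta> * ?c \<beta> - (if \<beta> = \<alpha> then 2 * (?c \<alpha>)\<^sup>2 else 0))"
    by (intro sum.cong refl) (auto simp: UU power2_eq_square algebra_simps)
  also have "\<dots> = (\<Sum>\<alpha>\<in>setA. \<Sum>\<beta>\<in>setA. ?c \<alpha> * adj \<alpha> \<beta> * ?c \<beta>) - 2 * (\<Sum>\<alpha>\<in>setA. (?c \<alpha>)\<^sup>2)"
    by (simp add: sum_subtractf sum_distrib_left)
  finally show ?thesis .
qed

lemma norm_V: "4 * form10 x x = (form10 x w)\<^sup>2 - (\<Sum>\<alpha>\<in>setA. \<Sum>\<beta>\<in>setA. form10 x (U \<alpha>) * adj \<alpha> \<beta> * form10 x (U \<beta>)) - 3 * (\<Sum>\<alpha>\<in>setA. (form10 x (U \<alpha>))\<^sup>2)"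
proof -
  let ?c = "\<lambda>\<alpha>. form10 x (U \<alpha>)"
  have "4 * form10 x x = form10 (2 *\<^sub>R x) (2 *\<^sub>R x)" by simp
  also have "\<dots> = (\<Sum>\<alpha>\<in>setA. \<Sum>\<beta>\<in>setA. ?c \<alpha> * (?c \<beta> * form10 (V \<alpha>) (V \<beta>)))"
    unfolding expand_V[of x] form10_sum_left form10_sum_right form10_scale_left form10_scale_right
    by (subst sum.swap) (simp add: sum_distrib_left mult.left_commute)
  also have "\<dots> = (\<Sum>\<alpha>\<in>setA. \<Sum>\<beta>\<in>setA. ?c \<alpha> * ?c \<beta> - ?c \<alpha> * adj \<alpha> \<beta> * ?c \<beta> - (if \<beta> = \<alpha> then 3 * (?c \<alpha>)\<^sup>2 else 0))"
    by (intro sum.cong refl) (auto simp: VV power2_eq_square algebra_simps)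
  also have "\<dots> = (\<Sum>\<alpha>\<in>setA. \<Sum>\<beta>\<in>setA. ?c \<alpha> * ?c \<beta>) - (\<Sum>\<alpha>\<in>setA. \<Sum>\<beta>\<in>setA. ?c \<alpha> * adj \<alpha> \<beta> * ?c \<beta>) - 3 * (\<Sum>\<alpha>\<in>setA. (?c \<alpha>)\<^sup>2)"
    by (simp add: sum_subtractf sum_distrib_left)
  also have "(\<Sum>\<alpha>\<in>setA. \<Sum>\<beta>\<in>setA. ?c \<alpha> * ?c \<beta>) = (form10 x w)\<^sup>2"
    by (simp add: form_w power2_eq_square sum_product)
  finally show ?thesis .
qed

text \<open>Roots congruent modulo 2 to combinations of the \<open>V\<close>, respectively of the \<open>U\<close>.\<close>
definition special :: "real^10 \<Rightarrow> bool" where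
  "special r \<longleftrightarrow> r \<in> roots10 \<and> ((\<forall>\<alpha>\<in>setA. form10 r (U \<alpha>) / 2 \<in> \<int>) \<or> (\<forall>\<alpha>\<in>setA. form10 r (V \<alpha>) / 2 \<in> \<int>))"

lemma special_U: "\<alpha> \<in> setA \<Longrightarrow> special (U \<alpha>)"
  using U_roots[of \<alpha>] UV[of \<alpha>] by (auto simp: special_def)

lemma special_V: "\<alpha> \<in> setA \<Longrightarrow> special (V \<alpha>)"
  using V_roots[of \<alpha>] VU[of \<alpha>] by (auto simp: special_def)

lemma special_minus: "special r \<Longrightarrow> special (- r)"
  by (auto simp: special_def roots10_def L10_closed)

lemma special_form_Ints: "special r \<Longrightarrow> \<alpha> \<in> setA \<Longrightarrow> form10 r (U \<alpha>) \<in> \<int>"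
   "special r \<Longrightarrow> \<alpha> \<in> setA \<Longrightarrow> form10 r (V \<alpha>) \<in> \<int>"
  using U_L10 V_L10 form10_Ints by (auto simp: special_def roots10_def)

text \<open>Reflecting in a root of the same family as the tested one changes each parity condition
  by an even multiple. Across families the change is even because \<open>U\<close> and
  \<open>V\<close> pair to 0 or 2.\<close>

lemma special_refl:
  assumes r: "special r" and a: "\<alpha> \<in> setA"
  shows "special (refl10 (U \<alpha>) r)" "special (refl10 (V \<alpha>) r)"
proof -
  have half: "(x + k * m) / 2 \<in> \<int>" if "x / 2 \<in> \<int>" "k / 2 \<in> \<int>" "m \<in> \<int>" for x k m :: real
    using Ints_add[OF that(1) Ints_mult[OF that(2,3)]] by (simp add: add_divide_distrib)
  have half2: "(x + k * (if b then 2 else 0)) / 2 \<in> \<int>" if "x / 2 \<in> \<int>" "k \<in> \<int>" for x k :: real and b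
    using that by (auto simp: add_divide_distrib)
  have rr: "refl10 (U \<alpha>) r \<in> roots10" "refl10 (V \<alpha>) r \<in> roots10"
    using isoms10_roots[OF refl10_isoms10] U_roots V_roots a r by (auto simp: special_def)
  have UZ: "form10 (U \<alpha>) (U \<beta>) \<in> \<int>" "form10 (V \<alpha>) (V \<beta>) \<in> \<int>" if "\<beta> \<in> setA" for \<beta>
    using that a U_L10 V_L10 form10_Ints by auto
  have UI: "form10 r (U \<alpha>) \<in> \<int>" "form10 r (V \<alpha>) \<in> \<int>" using special_form_Ints[OF r a] .
  have eq: "form10 (refl10 s r) t = form10 r t + form10 r s * form10 s t" for s t by (simp add: refl10_def)
  consider "\<forall>\<alpha>\<in>setA. form10 r (U \<alpha>) / 2 \<in> \<int>" | "\<forall>\<alpha>\<in>setA. form10 r (V \<alpha>) / 2 \<in> \<int>" using r by (auto simp: special_def)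
  then have "special (refl10 (U \<alpha>) r) \<and> special (refl10 (V \<alpha>) r)"
  proof cases
    case 1
    have "form10 (refl10 (U \<alpha>) r) (U \<beta>) / 2 \<in> \<int>" if b: "\<beta> \<in> setA" for \<beta>
      unfolding eq using 1 a b UZ by (intro half) simp_all
    moreover have "form10 (refl10 (V \<alpha>) r) (U \<beta>) / 2 \<in> \<int>" if b: "\<beta> \<in> setA" for \<beta>
      unfolding eq VU[OF a b] using 1 b UI(2) by (intro half2) simp_all
    ultimately show "special (refl10 (U \<alpha>) r) \<and> special (refl10 (V \<alpha>) r)" using rr by (auto simp: special_def)
  next
    case 2
    have "form10 (refl10 (V \<alpha>) r) (V \<beta>) / 2 \<in> \<int>" if b: "\<beta> \<in> setA" for \<beta>
      unfolding eq using 2 a b UZ by (intro half) simp_all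
    moreover have "form10 (refl10 (U \<alpha>) r) (V \<beta>) / 2 \<in> \<int>" if b: "\<beta> \<in> setA" for \<beta>
      unfolding eq UV[OF a b] using 2 b UI(1) by (intro half2) simp_all
    ultimately show "special (refl10 (U \<alpha>) r) \<and> special (refl10 (V \<alpha>) r)" using rr by (auto simp: special_def)
  qed
  then show "special (refl10 (U \<alpha>) r)" "special (refl10 (V \<alpha>) r)" by blast+
qed

text \<open>Height 0 is the start of the descent. The spectral bound on sum-zero vectors leaves only
  differences of two unit vectors as half-coordinates.\<close>

lemma special_not_perp_w:
  assumes r: "special r" shows "form10 r w \<noteq> 0"
proof
  assume rw: "form10 r w = 0"
  have rr: "form10 r r = -2" and r0: "r \<noteq> 0" using r by (auto simp: special_def roots10_def)
  consider "\<forall>\<alpha>\<in>setA. form10 r (U \<alpha>) / 2 \<in> \<int>" | "\<forall>\<alpha>\<in>setA. form10 r (V \<alpha>) / 2 \<in> \<int>" using r by (auto simp: special_def)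
  then show False
  proof cases
    case 1
    define c where "c \<alpha> = form10 r (U \<alpha>) / 2" for \<alpha>
    have eq: "3 * (\<Sum>\<alpha>\<in>setA. (c \<alpha>)\<^sup>2) + (\<Sum>\<alpha>\<in>setA. \<Sum>\<beta>\<in>setA. c \<alpha> * adj \<alpha> \<beta> * c \<beta>) = 2"
      using norm_V[of r] rr rw by (simp add: c_def power_divide flip: sum_divide_distrib)
    have s0: "sum c setA = 0" using rw by (simp add: form_w c_def flip: sum_divide_distrib)
    have "(\<Sum>\<alpha>\<in>setA. (c \<alpha>)\<^sup>2) \<le> 2" using petersen_ge[of c] eq s0 by simp
    moreover have "\<exists>\<alpha>\<in>setA. c \<alpha> \<noteq> 0" using r0 eq_by_U[of r 0] by (auto simp: c_def)
    ultimately obtain \<alpha> \<beta> where "\<alpha> \<in> setA" "\<beta> \<in> setA" "\<alpha> \<noteq> \<beta>" "\<forall>\<gamma>\<in>setA. c \<gamma> = (if \<gamma> = \<alpha> then 1 else if \<gamma> = \<beta> then -1 else 0)"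
      using sum_zero_short[of c] s0 1 by (auto simp: c_def)
    \<comment> \<open>The equation would read 6 - 2 \<open>adj\<close> = 2, but \<open>adj\<close>
      is at most 1. In the other case it would read 4 + 2 \<open>adj\<close> = 2.\<close>
    from adj_sum_short[OF this] eq adj_bounds[of \<alpha> \<beta>] show False by simp
  next
    case 2
    define c where "c \<alpha> = form10 r (V \<alpha>) / 2" for \<alpha>
    have eq: "2 * (\<Sum>\<alpha>\<in>setA. (c \<alpha>)\<^sup>2) - (\<Sum>\<alpha>\<in>setA. \<Sum>\<beta>\<in>setA. c \<alpha> * adj \<alpha> \<beta> * c \<beta>) = 2"
      using norm_U[of r] rr rw by (simp add: c_def power_divide flip: sum_divide_distrib)
    have s0: "sum c setA = 0" using form_UV[of r w] rw by (simp add: c_def form10_commute[of _ w] wU flip: sum_divide_distrib)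
    have "(\<Sum>\<alpha>\<in>setA. (c \<alpha>)\<^sup>2) \<le> 2" using petersen_le[of c] eq s0 by simp
    moreover have "\<exists>\<alpha>\<in>setA. c \<alpha> \<noteq> 0" using r0 eq_by_V[of r 0] by (auto simp: c_def)
    ultimately obtain \<alpha> \<beta> where "\<alpha> \<in> setA" "\<beta> \<in> setA" "\<alpha> \<noteq> \<beta>" "\<forall>\<gamma>\<in>setA. c \<gamma> = (if \<gamma> = \<alpha> then 1 else if \<gamma> = \<beta> then -1 else 0)"
      using sum_zero_short[of c] s0 2 by (auto simp: c_def)
    from adj_sum_short[OF this] eq adj_bounds[of \<alpha> \<beta>] show False by simp
  qed
qed

text \<open>For an isotropic vector of height \<plusminus>1, \<open>petersen_ge\<close> bounds the
  sum of squares of the integers \<open>c \<alpha>\<close> by 1/2, so all of them vanish. Such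
  vectors occur as a root minus a wall in the exceptional cases of the descent.\<close>

lemma isotropic_w:
  assumes z: "z \<in> L10" "form10 z z = 0" shows "(form10 z w)\<^sup>2 \<noteq> 1"
proof
  assume zw: "(form10 z w)\<^sup>2 = 1"
  define c where "c \<alpha> = form10 z (U \<alpha>)" for \<alpha>
  have "3 * (\<Sum>\<alpha>\<in>setA. (c \<alpha>)\<^sup>2) + (\<Sum>\<alpha>\<in>setA. \<Sum>\<beta>\<in>setA. c \<alpha> * adj \<alpha> \<beta> * c \<beta>) = 1"
    using norm_V[of z] z zw by (simp add: c_def)
  moreover have "(sum c setA)\<^sup>2 = 1" using zw by (simp add: form_w c_def)
  ultimately have le: "(\<Sum>\<alpha>\<in>setA. (c \<alpha>)\<^sup>2) \<le> 1/2" using petersen_ge[of c] by simp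
  have "c \<alpha> = 0" if a: "\<alpha> \<in> setA" for \<alpha>
  proof -
    have "(c \<alpha>)\<^sup>2 \<le> (\<Sum>\<alpha>\<in>setA. (c \<alpha>)\<^sup>2)" using a by (intro member_le_sum) auto
    with le have "(c \<alpha>)\<^sup>2 < 1" by simp
    then have "\<bar>c \<alpha>\<bar> < 1" by (simp add: abs_square_less_1)
    moreover have "c \<alpha> \<in> \<int>" using a U_L10 z form10_Ints by (simp add: c_def)
    ultimately show ?thesis by (auto elim!: Ints_cases)
  qed
  then have "sum c setA = 0" by simp
  with \<open>(sum c setA)\<^sup>2 = 1\<close> show False by simp
qed

definition D_int :: "(real^10) set" where
  "D_int = {x \<in> P10. \<forall>\<alpha>\<in>setA. form10 x (U \<alpha>) > 0 \<and> form10 x (V \<alpha>) > 0}"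

lemma w_D_int: "w \<in> D_int" by (simp add: D_int_def w_P10 wU wV)

lemma D_int_zero:
  assumes x: "x \<in> D_int" and y: "y \<in> D_int" and n: "form10 x r < 0" "form10 y r > 0"
  shows "\<exists>z\<in>D_int. form10 z r = 0"
proof (intro bexI)
  define z where "z = form10 y r *\<^sub>R x + (- form10 x r) *\<^sub>R y"
  show "form10 z r = 0" by (simp add: z_def)
  have "z \<in> P10" unfolding z_def using x y n by (intro P10_add P10_scale) (auto simp: D_int_def)
  moreover have "form10 z t > 0" if "form10 x t > 0" "form10 y t > 0" for t
    unfolding z_def form10_add_left form10_scale_left using that n by (intro add_pos_pos mult_pos_pos) auto
  ultimately show "z \<in> D_int" using x y by (auto simp: D_int_def)
qed

text \<open>Descent in the spirit of Vinberg's algorithm: a special root cutting \<open>D\<close> at minimal height above \<open>w\<close>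
  would pair nonnegatively with all \<open>U\<close> and \<open>V\<close>, so that its square \<open>\<Sum> (r \<sqdot> U)(r \<sqdot> V) / 2\<close> would not be
  negative; the Cauchy--Schwarz inequality orthogonally to \<open>w\<close> leaves only finitely many heights at which
  the reflected root may fail to cut \<open>D\<close>.\<close>
lemma special_no_cut_aux:
  assumes "special r" "form10 r w = real m" "x \<in> D_int"
  shows "form10 x r \<noteq> 0"
  using assms
proof (induction m arbitrary: r x rule: less_induct)
  case (less m)
  note r = less.prems(1) and m = less.prems(2) and x = less.prems(3)
  have rr: "form10 r r = -2" and rL: "r \<in> L10" using r by (auto simp: special_def roots10_def)
  have m0: "m \<noteq> 0" using special_not_perp_w[OF r] m by auto
  show ?case
  proof
    assume xr: "form10 x r = 0"
    have "\<exists>\<alpha>\<in>setA. form10 r (U \<alpha>) < 0 \<or> form10 r (V \<alpha>) < 0"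
    proof (rule ccontr)
      assume "\<not> ?thesis"
      then have "0 \<le> (\<Sum>\<alpha>\<in>setA. form10 r (V \<alpha>) * form10 (U \<alpha>) r)"
        by (intro sum_nonneg mult_nonneg_nonneg) (auto simp: form10_commute[of "U _" r] not_less)
      then show False using form_UV[of r r] rr by simp
    qed
    then obtain \<alpha> where a: "\<alpha> \<in> setA" and neg: "form10 r (U \<alpha>) < 0 \<or> form10 r (V \<alpha>) < 0" by blast
    \<comment> \<open>Reflecting in \<open>s\<close> lowers the height by \<open>k * h\<close>. The
      new special root is negative at \<open>x\<close> and, by the induction hypothesis at
      \<open>w\<close>, positive there, so it still cuts the interior: this contradicts
      minimality.\<close>
    have descend: False if s: "s \<in> {U \<alpha>, V \<alpha>}" and k: "form10 r s = - real k" "k > 0" and h: "form10 w s = real h" "k * h \<le> m" "h > 0" for s k h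
    proof -
      have sp: "special (refl10 s r)" using special_refl[OF r a] s by auto
      have "form10 (refl10 s r) w = real (m - k * h)"
        using m k h form10_commute[of s w] by (simp add: refl10_def of_nat_diff)
      moreover have "m - k * h < m" using k h m0 by simp
      ultimately have ih: "\<forall>x\<in>D_int. form10 x (refl10 s r) \<noteq> 0" using less.IH sp by blast
      have "form10 x s > 0" using x a s by (auto simp: D_int_def)
      then have "form10 x (refl10 s r) < 0" using xr k by (simp add: refl10_def)
      moreover have "form10 w (refl10 s r) \<ge> 0"
        using \<open>form10 (refl10 s r) w = real (m - k * h)\<close> form10_commute by simp
      moreover have "form10 w (refl10 s r) \<noteq> 0" using ih w_D_int by blast
      ultimately show False using D_int_zero[OF x w_D_int, of "refl10 s r"] ih by force
    qed
    \<comment> \<open>Both roots have square -2 and \<open>w\<close> has square 10, so each factor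
      is a squared height plus 20.\<close>
    have CS: "(10 * real k + real m * form10 w s)\<^sup>2 \<le> ((real m)\<^sup>2 + 20) * ((form10 w s)\<^sup>2 + 20)"
      if "s \<in> {U \<alpha>, V \<alpha>}" "form10 r s = - real k" for s k
    proof -
      have "form10 s s = -2" using that U_roots[OF a] V_roots[OF a] by (auto simp: roots10_def)
      then have "(- real k * 10 - real m * form10 w s)\<^sup>2 \<le> ((real m)\<^sup>2 + 20) * ((form10 w s)\<^sup>2 + 20)"
        using form10_cauchy[of w r s] ww m rr that by (simp add: form10_commute[of s w])
      moreover have "(- real k * 10 - real m * form10 w s)\<^sup>2 = (10 * real k + real m * form10 w s)\<^sup>2"
        by (simp add: power2_eq_square algebra_simps)
      ultimately show ?thesis by simp
    qed
    have natneg: "\<exists>k>0. t = - real k" if t: "t \<in> \<int>" "t < 0" for t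
    proof -
      obtain i where "t = of_int i" using t(1) by (rule Ints_cases)
      then show ?thesis using t by (intro exI[of _ "nat (- i)"]) auto
    qed
    \<comment> \<open>With these values \<open>r - s\<close> is isotropic and orthogonal to
      \<open>w\<close>, hence zero; but \<open>s\<close> is positive on the interior.\<close>
    have same: False if "s \<in> {U \<alpha>, V \<alpha>}" "form10 r s = -2" "form10 w s = real m" for s
    proof -
      have ss: "form10 s s = -2" using that U_roots[OF a] V_roots[OF a] by (auto simp: roots10_def)
      have "form10 (r - s) w = 0" using that m by (simp add: form10_commute[of s w])
      moreover have "form10 (r - s) (r - s) = 0" using that rr ss by (simp add: form10_commute[of s r])
      ultimately have "r = s" using form10_neg_perp[of w "r - s"] ww by force
      then show False using x a that xr by (auto simp: D_int_def)
    qed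
    show False
    proof (cases "form10 r (U \<alpha>) < 0")
      case True
      then obtain k where k: "k > 0" "form10 r (U \<alpha>) = - real k" using natneg special_form_Ints[OF r a] by blast
      have mk: "m < k" using descend[of "U \<alpha>" k 1] k wU[OF a] by force
      have "(10 * real k + real m)\<^sup>2 \<le> ((real m)\<^sup>2 + 20) * 21" using CS[of "U \<alpha>" k] k wU[OF a] by simp
      then have "real ((10 * k + m)^2) \<le> real ((m^2 + 20) * 21)" by simp
      then have ineq: "(10 * k + m)^2 \<le> (m^2 + 20) * 21" by (simp only: of_nat_le_iff)
      \<comment> \<open>Expanding, 100 k^2 + 20 k m is at most 20 m^2 + 420; since m < k this gives
        80 k^2 at most 420. The surviving pair k = 2, m = 1 has the height of
        \<open>U \<alpha>\<close> itself.\<close>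
      have "k \<le> 2"
      proof (rule ccontr)
        assume "\<not> k \<le> 2"
        then have "3 * 3 \<le> k * k" by (intro mult_le_mono) auto
        moreover have "m * m \<le> k * k" using mk by (intro mult_le_mono) auto
        ultimately show False using ineq by (simp add: power2_eq_square algebra_simps)
      qed
      then have "k = 2" "m = 1" using mk m0 k(1) by auto
      then show False using same[of "U \<alpha>"] k wU[OF a] by simp
    next
      case False
      then have "form10 r (V \<alpha>) < 0" using neg by blast
      then obtain k where k: "k > 0" "form10 r (V \<alpha>) = - real k" using natneg special_form_Ints[OF r a] by blast
      have mk: "m < 2 * k" using descend[of "V \<alpha>" k 2] k wV[OF a] by force
      have "(10 * real k + real m * 2)\<^sup>2 \<le> ((real m)\<^sup>2 + 20) * 24" using CS[of "V \<alpha>" k] k wV[OF a] by simp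
      then have "real ((10 * k + m * 2)^2) \<le> real ((m^2 + 20) * 24)" by simp
      then have ineq: "(10 * k + m * 2)^2 \<le> (m^2 + 20) * 24" by (simp only: of_nat_le_iff)
      \<comment> \<open>Here m < 2k turns 20 m^2 into at most 40 k m, and 100 k^2 is at most
        480.\<close>
      have "k \<le> 2"
      proof (rule ccontr)
        assume "\<not> k \<le> 2"
        then have "3 * 3 \<le> k * k" by (intro mult_le_mono) auto
        moreover have "m * m \<le> 2 * k * m" using mk by (intro mult_le_mono) auto
        moreover have "100 * (k * k) + 40 * (k * m) \<le> 20 * (m * m) + 480"
          using ineq by (simp add: power2_eq_square algebra_simps)
        ultimately show False by linarith
      qed
      \<comment> \<open>The first case fails by parity: a special root has even height or pairs
        evenly with every \<open>V\<close>. In the second, \<open>r\<close> would equal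
        \<open>V \<alpha>\<close>. In the third, \<open>r - V \<alpha>\<close> is isotropic of
        height \<plusminus>1.\<close>
      then consider "k = 1" "m = 1" | "k = 2" "m = 2" | "k = 2" "m = 1 \<or> m = 3" using mk m0 k(1) by force
      then show False
      proof cases
        case 1
        have "real m / 2 \<in> \<int> \<or> real k / 2 \<in> \<int>"
        proof -
          consider "\<forall>\<alpha>\<in>setA. form10 r (U \<alpha>) / 2 \<in> \<int>" | "\<forall>\<alpha>\<in>setA. form10 r (V \<alpha>) / 2 \<in> \<int>" using r by (auto simp: special_def)
          then show ?thesis
          proof cases
            case 1
            then have "(\<Sum>\<alpha>\<in>setA. form10 r (U \<alpha>) / 2) \<in> \<int>" by (intro Ints_sum) auto
            then show ?thesis using m by (simp add: form_w flip: sum_divide_distrib)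
          next
            case 2
            then have "- (form10 r (V \<alpha>) / 2) \<in> \<int>" using a by (simp only: Ints_minus)
            then show ?thesis using k by simp
          qed
        qed
        with 1 show False using half_not_Ints by simp
      next
        case 2 then show False using same[of "V \<alpha>"] k wV[OF a] by simp
      next
        case 3
        define z where "z = r - V \<alpha>"
        have vv: "form10 (V \<alpha>) (V \<alpha>) = -2" using V_roots[OF a] by (simp add: roots10_def)
        have "form10 z z = 0" using 3 k rr vv by (simp add: z_def form10_commute[of "V \<alpha>" r])
        moreover have "z \<in> L10" using rL V_L10[OF a] by (simp add: z_def L10_closed)
        moreover have "form10 z w = real m - 2" using m wV[OF a] by (simp add: z_def form10_commute[of "V \<alpha>" w])
        then have "(form10 z w)\<^sup>2 = 1" using 3 by (auto simp: power2_eq_square)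
        ultimately show False using isotropic_w by blast
      qed
    qed
  qed
qed

lemma special_no_cut:
  assumes r: "special r" and x: "x \<in> D_int" shows "form10 x r \<noteq> 0"
proof -
  have "form10 r w \<in> \<int>" using r w_L10 form10_Ints by (auto simp: special_def roots10_def)
  then obtain i where i: "form10 r w = of_int i" by (auto elim: Ints_cases)
  show ?thesis
  proof (cases "i \<ge> 0")
    case True
    then show ?thesis using special_no_cut_aux[OF r, of "nat i"] i x by simp
  next
    case False
    then have "form10 (- r) w = real (nat (- i))" using i by simp
    from special_no_cut_aux[OF special_minus[OF r] this x] show ?thesis by simp
  qed
qed

lemma special_sign:
  assumes r: "special r" and x: "x \<in> D_int" and y: "y \<in> D_int" and p: "form10 x r > 0" shows "form10 y r > 0"
proof (rule ccontr)
  assume "\<not> form10 y r > 0"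
  then have "form10 y r < 0" using special_no_cut[OF r y] by auto
  then show False using D_int_zero[OF y x _ p] special_no_cut[OF r] by blast
qed

end

section \<open>Isometries fixing the walls modulo 2\<close>

lemma triples_meet_two: "\<forall>\<alpha>\<in>set triples. \<exists>\<gamma>\<in>set triples. card (\<alpha> \<inter> \<gamma>) = 2"
  by code_simp

lemma open_P10: "open P10"
  unfolding P10_def by (intro open_Collect_conj open_Collect_less continuous_intros)

lemma transpose_setA:
  assumes "i \<in> five" "j \<in> five" shows "bij_betw ((`) (Transposition.transpose i j)) setA setA"
proof (rule bij_betw_byWitness[of _ "(`) (Transposition.transpose i j)"])
  have "Transposition.transpose i j ` S \<in> setA" if "S \<in> setA" for S
  proof -
    have "card (Transposition.transpose i j ` S) = card S" by (rule card_image) (rule inj_on_subset[OF inj_transpose subset_UNIV])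
    moreover have "Transposition.transpose i j ` S \<subseteq> five"
      using that assms by (auto simp: setA_def Transposition.transpose_def)
    ultimately show ?thesis using that by (simp add: setA_def)
  qed
  then show "(`) (Transposition.transpose i j) ` setA \<subseteq> setA" "(`) (Transposition.transpose i j) ` setA \<subseteq> setA" by auto
qed (auto simp: image_image)

context petersen_frame
begin

definition fixV :: "(real^10 \<Rightarrow> real^10) \<Rightarrow> bool" where
  "fixV g \<longleftrightarrow> g \<in> isoms10 \<and> (\<forall>\<alpha>\<in>setA. cong2 (g (V \<alpha>)) (V \<alpha>))"

lemma fixV_id: "fixV id" by (simp add: fixV_def isoms10_id cong2_refl)

lemma fixV_comp: "fixV g \<Longrightarrow> fixV h \<Longrightarrow> fixV (g \<circ> h)"
  unfolding fixV_def using isoms10_comp cong2_image cong2_trans by (metis comp_apply)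

lemma fixV_inv: "fixV g \<Longrightarrow> fixV (inv g)"
  unfolding fixV_def using isoms10_inv cong2_image cong2_sym isoms10_inv_apply(1) by metis

text \<open>The relations e_a+e_b + e_b+e_c + e_a+e_c = 0 modulo 2: the complements of the three
  neighbours of \<gamma> are the pairs inside \<gamma>. They cut the span of the ten
  \<open>V\<close> modulo 2 down to dimension 4.\<close>

lemma neighbour_sum: "\<gamma> \<in> setA \<Longrightarrow> (\<Sum>\<delta>\<in>setA. adj \<delta> \<gamma> *\<^sub>R V \<delta>) = 2 *\<^sub>R (V \<gamma> + U \<gamma>)"
proof (rule eq_by_U)
  fix \<beta> assume g: "\<gamma> \<in> setA" and b: "\<beta> \<in> setA"
  have "form10 (\<Sum>\<delta>\<in>setA. adj \<delta> \<gamma> *\<^sub>R V \<delta>) (U \<beta>) = (\<Sum>\<delta>\<in>setA. if \<delta> = \<beta> then 2 * adj \<delta> \<gamma> else 0)"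
    unfolding form10_sum_left form10_scale_left using b by (intro sum.cong) (auto simp: VU)
  also have "\<dots> = 2 * adj \<beta> \<gamma>" using b by simp
  finally show "form10 (\<Sum>\<delta>\<in>setA. adj \<delta> \<gamma> *\<^sub>R V \<delta>) (U \<beta>) = form10 (2 *\<^sub>R (V \<gamma> + U \<gamma>)) (U \<beta>)"
    using g b by (simp add: VU UU adj_commute)
qed

text \<open>Modulo 2, the first kind of special root lies in the span of the \<open>V\<close> and
  the second in its orthogonal complement. A map fixing the \<open>V\<close> modulo 2 preserves
  both.\<close>

lemma fixV_special:
  assumes r: "special r" and g: "fixV g" shows "special (g r)"
proof -
  have gi: "g \<in> isoms10" and ig: "fixV (inv g)" using g fixV_inv by (auto simp: fixV_def)
  have rt: "g r \<in> roots10" and rL: "r \<in> L10" using r isoms10_roots[OF gi] by (auto simp: special_def roots10_def)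
  consider "\<forall>\<alpha>\<in>setA. form10 r (U \<alpha>) / 2 \<in> \<int>" | "\<forall>\<alpha>\<in>setA. form10 r (V \<alpha>) / 2 \<in> \<int>" using r by (auto simp: special_def)
  then show ?thesis
  proof cases
    case 1
    have r2: "r = (\<Sum>\<alpha>\<in>setA. (form10 r (U \<alpha>) / 2) *\<^sub>R V \<alpha>)"
    proof -
      have "r = (1/2) *\<^sub>R (2 *\<^sub>R r)" by simp
      also have "\<dots> = (\<Sum>\<alpha>\<in>setA. (form10 r (U \<alpha>) / 2) *\<^sub>R V \<alpha>)" unfolding expand_V by (simp add: scaleR_sum_right)
      finally show ?thesis .
    qed
    have l: "linear g" using isoms10_linear[OF gi] .
    have "form10 (g r) (U \<beta>) / 2 \<in> \<int>" if b: "\<beta> \<in> setA" for \<beta>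
    proof -
      have h: "form10 (g (V \<alpha>)) (U \<beta>) / 2 \<in> \<int>" if a: "\<alpha> \<in> setA" for \<alpha>
      proof -
        have "cong2 (g (V \<alpha>)) (V \<alpha>)" using g a by (simp add: fixV_def)
        then obtain k where "k \<in> \<int>" "form10 (g (V \<alpha>)) (U \<beta>) = form10 (V \<alpha>) (U \<beta>) + 2 * k"
          using cong2_form U_L10[OF b] by blast
        then show ?thesis using VU[OF a b] by (auto simp: add_divide_distrib)
      qed
      have "g r = (\<Sum>\<alpha>\<in>setA. (form10 r (U \<alpha>) / 2) *\<^sub>R g (V \<alpha>))"
        by (subst r2) (simp add: linear_sum[OF l] linear_scale[OF l])
      then have "form10 (g r) (U \<beta>) / 2 = (\<Sum>\<alpha>\<in>setA. (form10 r (U \<alpha>) / 2) * (form10 (g (V \<alpha>)) (U \<beta>) / 2))"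
        by (simp add: sum_divide_distrib)
      also have "\<dots> \<in> \<int>" using 1 h by (intro Ints_sum Ints_mult) auto
      finally show ?thesis .
    qed
    then show ?thesis using rt by (simp add: special_def)
  next
    case 2
    have "form10 (g r) (V \<alpha>) / 2 \<in> \<int>" if a: "\<alpha> \<in> setA" for \<alpha>
    proof -
      have "cong2 (inv g (V \<alpha>)) (V \<alpha>)" using ig a by (simp add: fixV_def)
      then obtain k where k: "k \<in> \<int>" "form10 (inv g (V \<alpha>)) r = form10 (V \<alpha>) r + 2 * k" using cong2_form rL by blast
      have "form10 (g r) (V \<alpha>) = form10 r (V \<alpha>) + 2 * k"
        using isoms10_adjoint[OF gi, of r "V \<alpha>"] k form10_commute[of r] by simp
      then show ?thesis using 2 a k(1) by (simp add: add_divide_distrib)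
    qed
    then show ?thesis using rt by (simp add: special_def)
  qed
qed

text \<open>The pullback of a wall is special, so it has the same sign at \<open>x\<close> and
  \<open>y\<close>: a single point mapped to the interior of D controls all of them.\<close>

lemma fixV_D_int:
  assumes g: "fixV g" and x: "x \<in> D_int" "g x \<in> D_int" and y: "y \<in> D_int" shows "g y \<in> D_int"
proof -
  have gi: "g \<in> isoms10" using g by (simp add: fixV_def)
  have "form10 (g y) s > 0" if "special s" "form10 (g x) s > 0" for s
  proof -
    have "special (inv g s)" using fixV_special that(1) fixV_inv[OF g] by blast
    then show ?thesis using special_sign[of "inv g s" x y] x y that(2) isoms10_adjoint[OF gi] by metis
  qed
  then show ?thesis using x y special_U special_V isoms10_P10[OF gi] by (auto simp: D_int_def)
qed

text \<open>Parities against the \<open>V\<close> separate the walls. Every \<open>U\<close> pairs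
  evenly with all of them, while \<open>V \<alpha>\<close> pairs oddly exactly with the
  \<open>V \<gamma>\<close> for which \<gamma> meets \<alpha> in two points, and this set determines
  \<alpha>.\<close>

lemma V_cong2_unique:
  assumes a: "\<alpha> \<in> setA" and b: "\<beta> \<in> setA" and s: "s = U \<beta> \<or> s = V \<beta>" and c: "cong2 s (V \<alpha>)"
  shows "s = V \<alpha>"
proof -
  have par: "\<exists>k\<in>\<int>. form10 s (V \<gamma>) = form10 (V \<alpha>) (V \<gamma>) + 2 * k" if "\<gamma> \<in> setA" for \<gamma>
    using cong2_form[OF c V_L10[OF that]] .
  have par': "\<not> (\<exists>k\<in>\<int>. 2 * m = 1 + 2 * k)" if "m \<in> \<int>" for m :: real
  proof
    assume "\<exists>k\<in>\<int>. 2 * m = 1 + 2 * k"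
    then obtain k where "k \<in> \<int>" "m - k = 1/2" by (auto simp: algebra_simps)
    then show False using half_not_Ints that by (metis Ints_diff)
  qed
  have val: "form10 (V \<beta>) (V \<gamma>) = (if card (\<beta> \<inter> \<gamma>) = 2 then 1 else if card (\<beta> \<inter> \<gamma>) = 1 then 0 else -2)"
    if "\<beta> \<in> setA" "\<gamma> \<in> setA" for \<beta> \<gamma>
    using VV[OF that] setA_inter_card[OF that] that by (auto simp: adj_def split: if_splits)
  from s show ?thesis
  proof
    assume s: "s = U \<beta>"
    obtain \<gamma> where g: "\<gamma> \<in> setA" "card (\<alpha> \<inter> \<gamma>) = 2" using triples_meet_two a setA_triples by blast
    then obtain k where k: "k \<in> \<int>" "form10 (U \<beta>) (V \<gamma>) = 1 + 2 * k" using par val[OF a] s by force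
    then show ?thesis using UV[OF b g(1)] par'[of 1] par'[of 0] by (auto split: if_splits)
  next
    assume s: "s = V \<beta>"
    have "\<beta> = \<alpha>"
    proof (rule ccontr)
      assume "\<beta> \<noteq> \<alpha>"
      then obtain \<gamma> where g: "\<gamma> \<in> setA" "(card (\<beta> \<inter> \<gamma>) = 2) \<noteq> (card (\<alpha> \<inter> \<gamma>) = 2)"
        using triples_separate a b setA_triples by metis
      obtain k where k: "k \<in> \<int>" "form10 (V \<beta>) (V \<gamma>) = form10 (V \<alpha>) (V \<gamma>) + 2 * k" using par[OF g(1)] s by blast
      have "\<exists>m\<in>\<int>. (form10 (V \<beta>) (V \<gamma>) = 1 \<and> form10 (V \<alpha>) (V \<gamma>) = 2 * m) \<or> (form10 (V \<alpha>) (V \<gamma>) = 1 \<and> form10 (V \<beta>) (V \<gamma>) = 2 * m)"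
        using val[OF a g(1)] val[OF b g(1)] g(2) by (auto intro: bexI[of _ 0] bexI[of _ "-1"])
      then obtain m where m: "m \<in> \<int>" "(form10 (V \<beta>) (V \<gamma>) = 1 \<and> form10 (V \<alpha>) (V \<gamma>) = 2 * m) \<or> (form10 (V \<alpha>) (V \<gamma>) = 1 \<and> form10 (V \<beta>) (V \<gamma>) = 2 * m)" by blast
      from m(2) show False
      proof
        assume "form10 (V \<beta>) (V \<gamma>) = 1 \<and> form10 (V \<alpha>) (V \<gamma>) = 2 * m"
        then have "2 * m = 1 + 2 * (- k)" "- k \<in> \<int>" using k by auto
        then show False using par'[OF m(1)] by blast
      next
        assume "form10 (V \<alpha>) (V \<gamma>) = 1 \<and> form10 (V \<beta>) (V \<gamma>) = 2 * m"
        then show False using k par'[OF m(1)] by auto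
      qed
    qed
    then show ?thesis using s by simp
  qed
qed

text \<open>Near the point \<open>w + V\<^sub>\<alpha>\<close> the wall \<open>V\<^sub>\<alpha>\<close> is the only one, so the image of \<open>V\<^sub>\<alpha>\<close> must again be a wall.\<close>
lemma fixV_unique:
  assumes g: "fixV g" and x: "x \<in> D_int" "g x \<in> D_int" shows "g = id"
proof -
  have gi: "g \<in> isoms10" using g by (simp add: fixV_def)
  have fx: "g (V \<alpha>) = V \<alpha>" if a: "\<alpha> \<in> setA" for \<alpha>
  proof -
    \<comment> \<open>This \<open>p\<close> is the orthogonal projection of \<open>w\<close> to the
      wall of \<open>V \<alpha>\<close>; it is strictly positive on the other nineteen
      walls.\<close>
    define v p where "v = V \<alpha>" and "p = w + V \<alpha>"
    have vv: "form10 v v = -2" using V_roots[OF a] by (simp add: v_def roots10_def)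
    have pv: "form10 p v = 0" using vv wV[OF a] by (simp add: p_def v_def)
    have pU: "form10 p (U \<beta>) > 0" if "\<beta> \<in> setA" for \<beta> using that a by (simp add: p_def wU VU)
    have pV: "form10 p (V \<beta>) > 0" if "\<beta> \<in> setA" "\<beta> \<noteq> \<alpha>" for \<beta>
      using that a adj_bounds[of \<alpha> \<beta>] by (simp add: p_def wV VV)
    have pp: "form10 p p = 12" using ww vv wV[OF a] by (simp add: p_def v_def form10_commute[of "V \<alpha>" w])
    have pP: "p \<in> P10" using P10_I[OF w_P10, of p] pp ww wV[OF a] by (simp add: p_def)
    have "g p \<notin> D_int"
    proof
      assume "g p \<in> D_int"
      moreover have "inv g (g x) \<in> D_int" using x(1) isoms10_inv_apply(1)[OF gi] by simp
      ultimately have "inv g (g p) \<in> D_int" using fixV_D_int[OF fixV_inv[OF g] x(2)] by blast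
      then have "p \<in> D_int" using isoms10_inv_apply(1)[OF gi] by simp
      then show False using pv a by (auto simp: D_int_def v_def)
    qed
    then obtain s \<beta> where s: "\<beta> \<in> setA" "s = U \<beta> \<or> s = V \<beta>" "form10 (g p) s \<le> 0"
      using isoms10_P10[OF gi pP] unfolding D_int_def by force
    \<comment> \<open>The pulled-back wall \<open>r\<close> is positive on the interior of D and not
      positive at the boundary point \<open>p\<close>, so it must vanish there.\<close>
    define r where "r = inv g s"
    have sp: "special r" using s special_U special_V fixV_special[OF _ fixV_inv[OF g]] by (auto simp: r_def)
    have rr: "form10 r r = -2" using sp by (simp add: special_def roots10_def)
    have "form10 x r > 0" using isoms10_adjoint[OF gi, of x s] x s by (auto simp: r_def D_int_def)
    then have rD: "form10 z r > 0" if "z \<in> D_int" for z using special_sign[OF sp x(1) that] by simp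
    have "form10 p r \<le> 0" using s(3) isoms10_adjoint[OF gi] by (simp add: r_def)
    moreover have "form10 p r \<ge> 0"
    proof (rule ccontr)
      assume neg: "\<not> form10 p r \<ge> 0"
      have wr: "form10 w r > 0" using rD w_D_int by blast
      \<comment> \<open>Chosen so that \<open>r\<close> vanishes at
        \<open>p + t *\<^sub>R w\<close>, an interior point of D.\<close>
      define t where "t = - form10 p r / form10 w r"
      have t: "t > 0" unfolding t_def using neg wr by (intro divide_pos_pos) auto
      have "p + t *\<^sub>R w \<in> P10" using P10_add[OF pP P10_scale[OF w_P10 t]] .
      moreover have "form10 (p + t *\<^sub>R w) (U \<gamma>) > 0" if "\<gamma> \<in> setA" for \<gamma> using pU that t by (simp add: wU add_pos_pos)
      moreover have "form10 (p + t *\<^sub>R w) (V \<gamma>) > 0" if "\<gamma> \<in> setA" for \<gamma>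
        using pV[OF that] pv that t by (cases "\<gamma> = \<alpha>") (auto simp: wV v_def add_pos_pos)
      ultimately have "p + t *\<^sub>R w \<in> D_int" by (simp add: D_int_def)
      from rD[OF this] show False using wr by (simp add: t_def)
    qed
    ultimately have pr: "form10 p r = 0" by simp
    have "r = v"
    proof (rule ccontr)
      assume "r \<noteq> v"
      \<comment> \<open>If \<open>r\<close> and \<open>v\<close> were distinct roots through
        \<open>p\<close>, a small step from \<open>p\<close> along \<open>y\<close> would enter the
        interior, since \<open>v\<close> increases, while \<open>r\<close> becomes negative.\<close>
      define y where "y = r - v"
      have y0: "y \<noteq> 0" using \<open>r \<noteq> v\<close> by (simp add: y_def)
      have "form10 y p = 0" using pr pv by (simp add: y_def form10_commute[of _ p])
      then have "form10 y y < 0" using form10_neg_perp[of p y] pp y0 by simp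
      then have k: "form10 r v > -2" using rr vv by (simp add: y_def form10_commute[of v r])
      have yv: "form10 y v > 0" and yr: "form10 y r < 0" using k rr vv by (simp_all add: y_def form10_commute[of v r])
      define Q where "Q = P10 \<inter> (\<Inter>\<beta>\<in>setA. {z. form10 z (U \<beta>) > 0}) \<inter> (\<Inter>\<beta>\<in>setA - {\<alpha>}. {z. form10 z (V \<beta>) > 0})"
      have "open Q" unfolding Q_def by (intro open_Int open_INT open_P10 ballI open_Collect_less continuous_intros finite_setA finite_Diff)
      moreover have "p + 0 *\<^sub>R y \<in> Q" using pP pU pV by (auto simp: Q_def)
      moreover have "((\<lambda>t. p + t *\<^sub>R y) \<longlongrightarrow> p + 0 *\<^sub>R y) (at_right 0)" by (intro tendsto_intros)
      ultimately have "\<forall>\<^sub>F t in at_right 0. p + t *\<^sub>R y \<in> Q" by (metis topological_tendstoD)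
      moreover have "\<forall>\<^sub>F t::real in at_right 0. t > 0" by (simp add: eventually_at_right_less)
      ultimately have "\<forall>\<^sub>F t in at_right 0. p + t *\<^sub>R y \<in> Q \<and> t > 0" by (rule eventually_conj)
      then obtain t where t: "p + t *\<^sub>R y \<in> Q" "t > 0"
        using eventually_happens'[OF trivial_limit_at_right_real] by blast
      have "form10 (p + t *\<^sub>R y) (V \<alpha>) > 0" using pv yv t(2) by (simp add: v_def)
      then have "p + t *\<^sub>R y \<in> D_int" using t(1) by (auto simp: Q_def D_int_def)
      from rD[OF this] have "form10 p r + t * form10 y r > 0" by simp
      then show False using pr yr t(2) by (simp add: zero_less_mult_iff)
    qed
    then have "g v = s" using isoms10_inv_apply(2)[OF gi] by (auto simp: r_def)
    moreover have "cong2 (g v) v" using g a by (simp add: fixV_def v_def)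
    ultimately show ?thesis using V_cong2_unique[OF a s(1,2)] by (simp add: v_def)
  qed
  have l: "linear g" using isoms10_linear[OF gi] .
  have "g z = z" for z
  proof -
    have "2 *\<^sub>R g z = g (2 *\<^sub>R z)" by (simp add: linear_scale[OF l])
    also have "\<dots> = 2 *\<^sub>R z" unfolding expand_V[of z] using fx by (simp add: linear_sum[OF l] linear_scale[OF l])
    finally show ?thesis by simp
  qed
  then show ?thesis by (simp add: fun_eq_iff)
qed

lemma fixV_refl_U: assumes a: "\<alpha> \<in> setA" shows "fixV (refl10 (U \<alpha>))"
  unfolding fixV_def
proof (intro conjI ballI)
  show "refl10 (U \<alpha>) \<in> isoms10" using refl10_isoms10 U_roots a by blast
  fix \<beta> assume "\<beta> \<in> setA"
  then show "cong2 (refl10 (U \<alpha>) (V \<beta>)) (V \<beta>)" using a U_L10[OF a] unfolding cong2_def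
    by (intro bexI[of _ "if \<beta> = \<alpha> then U \<alpha> else 0"]) (auto simp: refl10_def VU L10_closed)
qed

text \<open>Reflections in the \<open>V\<close> act on the ten classes \<open>V mod 2\<close> as transpositions in \<open>S\<^sub>5\<close>, and the same transposition
  is induced by a symmetry of \<open>D\<close>.\<close>
lemma fixV_refl_V:
  assumes a: "\<alpha> \<in> setA" obtains \<sigma> where "fixV (\<sigma> \<circ> refl10 (V \<alpha>))" "\<And>x. form10 (\<sigma> x) w = form10 x w"
proof -
  have "\<alpha> \<in> set triples" using a by (simp add: setA_triples)
  from bspec[OF triples_transpose this] obtain i j where ij: "i \<in> {1,2,3,4,5}" "j \<in> {1,2,3,4,5}"
    and ta: "Transposition.transpose i j ` \<alpha> = \<alpha>"
    and t1: "\<forall>\<beta>\<in>set triples. (card (\<alpha> \<inter> \<beta>) = 1 \<longrightarrow> Transposition.transpose i j ` \<beta> = \<beta>) \<and>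
     (card (\<alpha> \<inter> \<beta>) = 2 \<longrightarrow> Transposition.transpose i j ` \<beta> \<noteq> \<beta> \<and> Transposition.transpose i j ` \<beta> \<noteq> \<alpha> \<and> (\<exists>\<gamma>\<in>set triples. set (filter (\<lambda>\<delta>. card (\<delta> \<inter> \<gamma>) = 1) triples) = {\<alpha>, \<beta>, Transposition.transpose i j ` \<beta>}))"
    by (elim bexE conjE)
  let ?t = "(`) (Transposition.transpose i j)"
  have ij5: "i \<in> five" "j \<in> five" using ij by (auto simp: five_def)
  obtain \<sigma> where s: "\<sigma> \<in> isoms10" "\<And>\<alpha>. \<alpha> \<in> setA \<Longrightarrow> \<sigma> (U \<alpha>) = U (?t \<alpha>)" "\<And>\<alpha>. \<alpha> \<in> setA \<Longrightarrow> \<sigma> (V \<alpha>) = V (?t \<alpha>)"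
    using symmetry[OF ij5] by blast
  have l: "linear \<sigma>" using isoms10_linear[OF s(1)] .
  have "\<sigma> w = (\<Sum>\<alpha>\<in>setA. U (?t \<alpha>))" unfolding w_def linear_sum[OF l] using s(2) by simp
  also have "\<dots> = w" unfolding w_def by (rule sum.reindex_bij_betw[OF transpose_setA[OF ij5]])
  finally have "\<sigma> w = w" .
  then have sw: "form10 (\<sigma> x) w = form10 x w" for x using isoms10_form[OF s(1), of x w] by simp
  have "fixV (\<sigma> \<circ> refl10 (V \<alpha>))" unfolding fixV_def
  proof (intro conjI ballI)
    show "\<sigma> \<circ> refl10 (V \<alpha>) \<in> isoms10" using s(1) refl10_isoms10 V_roots[OF a] isoms10_comp by blast
    fix \<beta> assume b: "\<beta> \<in> setA"
    have eq: "(\<sigma> \<circ> refl10 (V \<alpha>)) (V \<beta>) = V (?t \<beta>) + form10 (V \<beta>) (V \<alpha>) *\<^sub>R V \<alpha>"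
      using s(3) a b ta by (simp add: refl10_def linear_add[OF l] linear_scale[OF l])
    consider "\<beta> = \<alpha>" | "\<beta> \<noteq> \<alpha>" "card (\<alpha> \<inter> \<beta>) = 1" | "\<beta> \<noteq> \<alpha>" "card (\<alpha> \<inter> \<beta>) = 2"
      using setA_inter_card[OF a b] by presburger
    then show "cong2 ((\<sigma> \<circ> refl10 (V \<alpha>)) (V \<beta>)) (V \<beta>)"
    proof cases
      case 1
      have "form10 (V \<alpha>) (V \<alpha>) = -2" using V_roots[OF a] by (simp add: roots10_def)
      then show ?thesis unfolding eq cong2_def using 1 ta V_L10[OF a]
        by (intro bexI[of _ "- V \<alpha>"]) (auto simp: L10_closed)
    next
      case 2
      then have "?t \<beta> = \<beta>" using t1 b by (simp add: setA_triples)
      moreover have "form10 (V \<beta>) (V \<alpha>) = 0" using VV[OF b a] 2 by (simp add: adj_def Int_commute)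
      ultimately show ?thesis unfolding eq by (simp add: cong2_refl)
    next
      case 3
      have tb: "?t \<beta> \<in> setA" using transpose_setA[OF ij5] b by (auto simp: bij_betw_def)
      have "\<beta> \<in> set triples" using b by (simp add: setA_triples)
      from mp[OF conjunct2[OF bspec[OF t1 this]] 3(2)] obtain \<gamma> where d: "?t \<beta> \<noteq> \<beta>" "?t \<beta> \<noteq> \<alpha>"
        and g': "\<gamma> \<in> set triples"
        and nb: "set (filter (\<lambda>\<delta>. card (\<delta> \<inter> \<gamma>) = 1) triples) = {\<alpha>, \<beta>, ?t \<beta>}"
        by (elim bexE conjE)
      have g: "\<gamma> \<in> setA" using g' by (simp add: setA_triples)
      have nb': "{\<delta>\<in>setA. card (\<delta> \<inter> \<gamma>) = 1} = {\<alpha>, \<beta>, ?t \<beta>}" using nb by (simp add: setA_triples)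
      \<comment> \<open>The reflection followed by the symmetry sends \<open>V \<beta>\<close> to
        \<open>V (?t \<beta>) + V \<alpha>\<close>; this agrees with \<open>V \<beta>\<close> modulo
        2 because the three triples are the neighbours of \<gamma>.\<close>
      have "(\<Sum>\<delta>\<in>setA. adj \<delta> \<gamma> *\<^sub>R V \<delta>) = (\<Sum>\<delta>\<in>{\<delta>\<in>setA. card (\<delta> \<inter> \<gamma>) = 1}. V \<delta>)"
        unfolding adj_def by (subst sum.inter_filter) (auto intro: sum.cong)
      also have "\<dots> = V \<alpha> + (V \<beta> + V (?t \<beta>))" unfolding nb' using d 3 by simp
      finally have sum: "V \<alpha> + (V \<beta> + V (?t \<beta>)) = 2 *\<^sub>R (V \<gamma> + U \<gamma>)" using neighbour_sum[OF g] by simp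
      have "form10 (V \<beta>) (V \<alpha>) = 1" using VV[OF b a] 3 by (simp add: adj_def Int_commute)
      then have "(\<sigma> \<circ> refl10 (V \<alpha>)) (V \<beta>) - V \<beta> = (V \<alpha> + (V \<beta> + V (?t \<beta>))) - 2 *\<^sub>R V \<beta>"
        unfolding eq by (simp add: scaleR_2)
      also have "\<dots> = 2 *\<^sub>R (V \<gamma> + U \<gamma> - V \<beta>)" unfolding sum by (simp only: scaleR_diff_right)
      finally show ?thesis unfolding cong2_def using V_L10 U_L10 g b
        by (intro bexI[of _ "V \<gamma> + U \<gamma> - V \<beta>"]) (auto simp: L10_closed)
    qed
  qed
  then show thesis using that sw by blast
qed

text \<open>Minimise the height over \<open>w\<close> within \<Gamma>. The symmetry accompanying a
  reflection in a \<open>V\<close> preserves this height, so only the reflection matters, and it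
  lowers the height unless the wall is already positive.\<close>

lemma fixV_descent:
  assumes x: "x \<in> P10_reg" obtains g where "fixV g" "g x \<in> D_int"
proof -
  have xP: "x \<in> P10" using x by (simp add: P10_reg_def)
  have sub: "{g. fixV g} \<subseteq> isoms10" "{g. fixV g} \<noteq> {}" using fixV_id by (auto simp: fixV_def)
  obtain g where "g \<in> {g. fixV g}" and min': "\<And>h. h \<in> {g. fixV g} \<Longrightarrow> form10 (g x) w \<le> form10 (h x) w"
    using isoms10_min_exists[OF sub xP w_P10 w_L10] by blast
  then have g: "fixV g" and min: "\<And>h. fixV h \<Longrightarrow> form10 (g x) w \<le> form10 (h x) w" by simp_all
  have gi: "g \<in> isoms10" using g by (simp add: fixV_def)
  have nz: "form10 (g x) s \<noteq> 0" if "s \<in> roots10" for s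
    using x isoms10_adjoint[OF gi, of x s] isoms10_roots[OF isoms10_inv[OF gi] that] by (auto simp: P10_reg_def)
  have "form10 (g x) (U \<alpha>) > 0" if a: "\<alpha> \<in> setA" for \<alpha>
  proof -
    have "fixV (refl10 (U \<alpha>) \<circ> g)" using fixV_comp fixV_refl_U[OF a] g by blast
    from min[OF this] have "form10 (g x) (U \<alpha>) \<ge> 0" using wU[OF a] by (simp add: refl10_def form10_commute[of "U \<alpha>" w])
    then show ?thesis using nz[OF U_roots[OF a]] by simp
  qed
  moreover have "form10 (g x) (V \<alpha>) > 0" if a: "\<alpha> \<in> setA" for \<alpha>
  proof -
    obtain \<sigma> where s: "fixV (\<sigma> \<circ> refl10 (V \<alpha>))" "\<And>x. form10 (\<sigma> x) w = form10 x w" using fixV_refl_V[OF a] by blast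
    have "fixV ((\<sigma> \<circ> refl10 (V \<alpha>)) \<circ> g)" using fixV_comp s(1) g by blast
    from min[OF this] have "form10 (g x) (V \<alpha>) \<ge> 0" using wV[OF a] s(2) by (simp add: refl10_def form10_commute[of "V \<alpha>" w])
    then show ?thesis using nz[OF V_roots[OF a]] by simp
  qed
  ultimately have "g x \<in> D_int" using isoms10_P10[OF gi xP] by (simp add: D_int_def)
  with g that show thesis by blast
qed

lemma cong2_third:
  assumes g: "g \<in> isoms10" and z: "z \<in> L10" "a + b + c = 2 *\<^sub>R z" and ab: "cong2 (g a) a" "cong2 (g b) b"
  shows "cong2 (g c) c"
proof -
  have c: "c = 2 *\<^sub>R z - a - b" using z(2) by (simp add: algebra_simps)
  have l: "linear g" using isoms10_linear[OF g] .
  have "cong2 (2 *\<^sub>R g z) (2 *\<^sub>R z)" unfolding cong2_def using z(1) isoms10_L10[OF g]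
    by (intro bexI[of _ "g z - z"]) (simp_all add: scaleR_diff_right L10_closed)
  then have "cong2 (2 *\<^sub>R g z - g a - g b) (2 *\<^sub>R z - a - b)" by (intro cong2_diff ab)
  then show ?thesis unfolding c by (simp add: linear_diff[OF l] linear_scale[OF l])
qed

text \<open>The complementary pairs 12, 13, 34, 35 form a spanning tree on five points, so these
  four classes are a basis. Each further class closes a triangle through
  \<open>neighbour_sum\<close>.\<close>

lemma fixV_from_four:
  assumes g: "g \<in> isoms10" and c: "cong2 (g (V {3,4,5})) (V {3,4,5})" "cong2 (g (V {2,4,5})) (V {2,4,5})"
    "cong2 (g (V {1,2,5})) (V {1,2,5})" "cong2 (g (V {1,2,4})) (V {1,2,4})"
  shows "fixV g"
proof -
  have third: "cong2 (g (V \<alpha>)) (V \<alpha>)"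
    if "\<gamma> \<in> setA" "cong2 (g (V \<beta>)) (V \<beta>)" "cong2 (g (V \<beta>')) (V \<beta>')"
      "(\<Sum>\<delta>\<in>setA. adj \<delta> \<gamma> *\<^sub>R V \<delta>) = V \<beta> + V \<beta>' + V \<alpha>" for \<alpha> \<beta> \<beta>' \<gamma>
  proof (rule cong2_third[OF g, of "V \<gamma> + U \<gamma>" "V \<beta>" "V \<beta>'"])
    show "V \<gamma> + U \<gamma> \<in> L10" using V_L10[OF that(1)] U_L10[OF that(1)] by (rule L10_closed(2))
    show "V \<beta> + V \<beta>' + V \<alpha> = 2 *\<^sub>R (V \<gamma> + U \<gamma>)" using neighbour_sum[OF that(1)] that(4) by simp
  qed (fact that(2) that(3))+
  have d1: "cong2 (g (V {1,4,5})) (V {1,4,5})"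
    by (rule third[of "{1,2,3}", OF _ c(2) c(1)])
      (simp add: setA_triples triples_def, simp add: sum_setA adj_def ac_simps)
  have d2: "cong2 (g (V {1,2,3})) (V {1,2,3})"
    by (rule third[of "{3,4,5}", OF _ c(4) c(3)])
      (simp add: setA_triples triples_def, simp add: sum_setA adj_def ac_simps)
  have d3: "cong2 (g (V {2,3,5})) (V {2,3,5})"
    by (rule third[of "{1,3,4}", OF _ c(3) c(2)])
      (simp add: setA_triples triples_def, simp add: sum_setA adj_def ac_simps)
  have d4: "cong2 (g (V {1,3,5})) (V {1,3,5})"
    by (rule third[of "{2,3,4}", OF _ c(3) d1])
      (simp add: setA_triples triples_def, simp add: sum_setA adj_def ac_simps)
  have d5: "cong2 (g (V {2,3,4})) (V {2,3,4})"
    by (rule third[of "{1,3,5}", OF _ c(4) c(2)])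
      (simp add: setA_triples triples_def, simp add: sum_setA adj_def ac_simps)
  have d6: "cong2 (g (V {1,3,4})) (V {1,3,4})"
    by (rule third[of "{2,3,5}", OF _ c(4) d1])
      (simp add: setA_triples triples_def, simp add: sum_setA adj_def ac_simps)
  show ?thesis using g c d1 d2 d3 d4 d5 d6 unfolding fixV_def setA_triples triples_def by simp
qed

end

section \<open>The lattice modulo 2\<close>

text \<open>Elements of \<open>L\<^sub>1\<^sub>0 / 2 L\<^sub>1\<^sub>0\<close> are boolean lists of length 10; \<open>qf\<close> is half the square modulo 2.\<close>
fun qf :: "bool list \<Rightarrow> bool" where
  "qf [a,b,c,d,e,f,g,h,i,j] = ((((((((((((((((a \<and> b) \<noteq> c) \<noteq> d) \<noteq> e) \<noteq> f) \<noteq> g) \<noteq> h) \<noteq> i) \<noteq> j) \<noteq> (c \<and> e)) \<noteq> (e \<and> f)) \<noteq> (f \<and> g)) \<noteq> (g \<and> h)) \<noteq> (h \<and> i)) \<noteq> (i \<and> j)) \<noteq> (d \<and> f))"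
| "qf _ = False"

definition add2 :: "bool list \<Rightarrow> bool list \<Rightarrow> bool list" where
  "add2 l m = map2 (\<noteq>) l m"

definition bf :: "bool list \<Rightarrow> bool list \<Rightarrow> bool" where
  "bf l m = (qf (add2 l m) \<noteq> (qf l \<noteq> qf m))"

text \<open>The two hyperbolic coordinates are separated from the E_8 part: enumeration runs over
  blocks of 256 vectors, and pairings with the hyperbolic basis are constant on a block.\<close>

definition ext2 :: "bool \<Rightarrow> bool \<Rightarrow> bool list list" where
  "ext2 a b = map (\<lambda>m. a # b # m) (List.n_lists 8 [False, True])"

definition vecs2 :: "bool list list" where
  "vecs2 = ext2 False False @ ext2 False True @ ext2 True False @ ext2 True True"

abbreviation F2 :: "bool list set" where "F2 \<equiv> {l. length l = 10}"

definition red2 :: "real^10 \<Rightarrow> bool list" where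
  "red2 x = [odd \<lfloor>x$0\<rfloor>, odd \<lfloor>x$1\<rfloor>, odd \<lfloor>x$2\<rfloor>, odd \<lfloor>x$3\<rfloor>, odd \<lfloor>x$4\<rfloor>, odd \<lfloor>x$5\<rfloor>, odd \<lfloor>x$6\<rfloor>, odd \<lfloor>x$7\<rfloor>, odd \<lfloor>x$8\<rfloor>, odd \<lfloor>x$9\<rfloor>]"

definition lift2 :: "bool list \<Rightarrow> real^10" where
  "lift2 l = vec10 (of_bool (l!0)) (of_bool (l!1)) (of_bool (l!2)) (of_bool (l!3)) (of_bool (l!4))
     (of_bool (l!5)) (of_bool (l!6)) (of_bool (l!7)) (of_bool (l!8)) (of_bool (l!9))"

lemma length_10_cases:
  assumes "length l = 10"
  obtains a b c d e f g h i j where "l = [a,b,c,d,e,f,g,h,i,j]"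
  using assms by (auto simp: length_Suc_conv eval_nat_numeral)

lemma set_ext2: "set (ext2 a b) = {l. \<exists>m. l = a # b # m \<and> length m = 8}"
  by (auto simp: ext2_def set_n_lists)

lemma distinct_ext2: "distinct (ext2 a b)"
  by (simp add: ext2_def distinct_map distinct_n_lists inj_on_def)

lemma set_vecs2: "set vecs2 = F2"
proof (intro set_eqI iffI)
  fix l assume "l \<in> F2"
  then obtain a b c d e f g h i j where "l = [a,b,c,d,e,f,g,h,i,j]" using length_10_cases by blast
  then have "l = a # b # [c,d,e,f,g,h,i,j]" "length [c,d,e,f,g,h,i,j] = 8" by simp_all
  then show "l \<in> set vecs2" unfolding vecs2_def set_append set_ext2 by (cases a; cases b; blast)
qed (auto simp: vecs2_def set_ext2)

lemma distinct_vecs2: "distinct vecs2"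
  by (auto simp: vecs2_def distinct_ext2 set_ext2)

lemma card_F2: "card {l \<in> F2. P l} = length (filter P vecs2)"
proof -
  have "card (set (filter P vecs2)) = length (filter P vecs2)" by (intro distinct_card distinct_filter distinct_vecs2)
  moreover have "set (filter P vecs2) = {l \<in> F2. P l}" by (auto simp: set_vecs2)
  ultimately show ?thesis by simp
qed

lemma finite_F2 [simp]: "finite F2" using set_vecs2 by (metis List.finite_set)

lemma lift2_L10: "lift2 l \<in> L10" by (simp add: lift2_def L10_iff)

lemma length_red2 [simp]: "length (red2 x) = 10" by (simp add: red2_def)

lemma red2_lift2: "length l = 10 \<Longrightarrow> red2 (lift2 l) = l"
  by (elim length_10_cases) (simp add: red2_def lift2_def)

lemma L10_int_coords:
  assumes "x \<in> L10"
  obtains a b c d e f g h i j :: int where "x = vec10 (of_int a) (of_int b) (of_int c) (of_int d) (of_int e)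
    (of_int f) (of_int g) (of_int h) (of_int i) (of_int j)"
proof -
  have "x$k = of_int \<lfloor>x$k\<rfloor>" for k using assms by (simp add: L10_def)
  then have "x = vec10 (of_int \<lfloor>x$0\<rfloor>) (of_int \<lfloor>x$1\<rfloor>) (of_int \<lfloor>x$2\<rfloor>) (of_int \<lfloor>x$3\<rfloor>) (of_int \<lfloor>x$4\<rfloor>)
    (of_int \<lfloor>x$5\<rfloor>) (of_int \<lfloor>x$6\<rfloor>) (of_int \<lfloor>x$7\<rfloor>) (of_int \<lfloor>x$8\<rfloor>) (of_int \<lfloor>x$9\<rfloor>)"
    unfolding vec_eq_10 vec10_nth by blast
  then show thesis using that by blast
qed

lemma red2_vec10: "red2 (vec10 (of_int a) (of_int b) (of_int c) (of_int d) (of_int e) (of_int f) (of_int g) (of_int h) (of_int i) (of_int j))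
   = [odd a, odd b, odd c, odd d, odd e, odd f, odd g, odd h, odd i, odd j]"
  by (simp add: red2_def)

lemma floor_add_Ints:
  fixes x y :: real assumes "x \<in> \<int>" "y \<in> \<int>" shows "\<lfloor>x + y\<rfloor> = \<lfloor>x\<rfloor> + \<lfloor>y\<rfloor>"
proof -
  obtain i where "x = of_int i" using assms(1) by (rule Ints_cases)
  moreover obtain j where "y = of_int j" using assms(2) by (rule Ints_cases)
  ultimately show ?thesis by simp
qed

lemma red2_add: "x \<in> L10 \<Longrightarrow> y \<in> L10 \<Longrightarrow> red2 (x + y) = add2 (red2 x) (red2 y)"
proof -
  assume "x \<in> L10" "y \<in> L10"
  then have "x$k \<in> \<int>" "y$k \<in> \<int>" for k by (simp_all add: L10_def)
  then have "\<lfloor>x$k + y$k\<rfloor> = \<lfloor>x$k\<rfloor> + \<lfloor>y$k\<rfloor>" for k by (rule floor_add_Ints)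
  then show ?thesis by (simp add: red2_def add2_def)
qed

lemma red2_eq_iff_cong2: "x \<in> L10 \<Longrightarrow> y \<in> L10 \<Longrightarrow> red2 x = red2 y \<longleftrightarrow> cong2 x y"
proof
  assume x: "x \<in> L10" and y: "y \<in> L10" and e: "red2 x = red2 y"
  have h: "(x$k - y$k) / 2 \<in> \<int>" if "odd \<lfloor>x$k\<rfloor> = odd \<lfloor>y$k\<rfloor>" for k
  proof -
    have xk: "x$k = of_int \<lfloor>x$k\<rfloor>" and yk: "y$k = of_int \<lfloor>y$k\<rfloor>" using x y by (simp_all add: L10_def)
    have "even (\<lfloor>x$k\<rfloor> - \<lfloor>y$k\<rfloor>)" using that by simp
    then obtain m where "\<lfloor>x$k\<rfloor> - \<lfloor>y$k\<rfloor> = 2 * m" by blast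
    then have "real_of_int \<lfloor>x$k\<rfloor> - of_int \<lfloor>y$k\<rfloor> = of_int (2 * m)" by (simp only: flip: of_int_diff)
    then have "x$k - y$k = of_int (2 * m)" using xk yk by simp
    then show ?thesis by simp
  qed
  have "\<forall>k. odd \<lfloor>x$k\<rfloor> = odd \<lfloor>y$k\<rfloor>" using e unfolding all_10 red2_def by (simp only: list.inject)
  then have "(1/2) *\<^sub>R (x - y) \<in> L10" using h by (simp add: L10_def)
  then show "cong2 x y" unfolding cong2_def by (intro bexI[of _ "(1/2) *\<^sub>R (x - y)"]) simp_all
next
  assume x: "x \<in> L10" and y: "y \<in> L10" and "cong2 x y"
  then obtain z where z: "z \<in> L10" "x = y + 2 *\<^sub>R z" by (auto simp: cong2_def algebra_simps)
  have "red2 (2 *\<^sub>R z) = red2 0"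
  proof -
    have "z$k \<in> \<int>" for k using z(1) by (simp add: L10_def)
    then have "\<lfloor>2 * z$k\<rfloor> = 2 * \<lfloor>z$k\<rfloor>" for k using floor_add_Ints[of "z$k" "z$k"] by simp
    then show ?thesis by (simp add: red2_def)
  qed
  moreover have "2 *\<^sub>R z \<in> L10" using z(1) by (simp add: L10_closed)
  ultimately have "red2 (y + 2 *\<^sub>R z) = red2 (y + 0)" using red2_add[OF y, of "2 *\<^sub>R z"] red2_add[OF y L10_closed(1)] by simp
  then show "red2 x = red2 y" using z(2) by simp
qed

lemma odd_add_xor: "odd (a + b) \<longleftrightarrow> odd a \<noteq> odd b" "odd (a - b) \<longleftrightarrow> odd a \<noteq> odd b" for a b :: int
  by auto

lemma qf_red2: assumes "x \<in> L10" shows "qf (red2 x) \<longleftrightarrow> odd \<lfloor>form10 x x / 2\<rfloor>"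
proof -
  obtain a b c d e f g h i j where x: "x = vec10 (real_of_int a) (of_int b) (of_int c) (of_int d) (of_int e)
    (of_int f) (of_int g) (of_int h) (of_int i) (of_int j)" using L10_int_coords[OF assms] .
  let ?p = "a * b - c * c - d * d - e * e - f * f - g * g - h * h - i * i - j * j + c * e + e * f + f * g + g * h + h * i + i * j + d * f"
  have "form10 x x = 2 * of_int ?p" unfolding x form10_expand vec10_nth by (simp add: algebra_simps)
  then have "form10 x x / 2 = of_int ?p" by (simp only:) simp
  then have "\<lfloor>form10 x x / 2\<rfloor> = ?p" by (simp only: floor_of_int)
  then show ?thesis unfolding x red2_vec10 by (simp only: qf.simps odd_add_xor even_mult_iff de_Morgan_disj conj_absorb)
qed

lemma bf_red2: assumes x: "x \<in> L10" and y: "y \<in> L10" shows "bf (red2 x) (red2 y) \<longleftrightarrow> odd \<lfloor>form10 x y\<rfloor>"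
proof -
  obtain k l m where k: "form10 x x / 2 = of_int k" "form10 y y / 2 = of_int l" "form10 x y = of_int m"
    using form10_even[OF x] form10_even[OF y] form10_Ints[OF x y] by (meson Ints_cases)
  have "form10 (x + y) (x + y) / 2 = form10 x x / 2 + form10 y y / 2 + form10 x y"
    using form10_commute[of y x] by (simp add: add_divide_distrib)
  also have "\<dots> = of_int (k + l + m)" using k by simp
  finally have "\<lfloor>form10 (x + y) (x + y) / 2\<rfloor> = k + l + m" by (simp only: floor_of_int)
  then have "qf (add2 (red2 x) (red2 y)) \<longleftrightarrow> odd (k + l + m)"
    using qf_red2[OF L10_closed(2)[OF x y]] red2_add[OF x y] by simp
  moreover have "qf (red2 x) \<longleftrightarrow> odd k" "qf (red2 y) \<longleftrightarrow> odd l" using qf_red2 x y k by auto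
  ultimately show ?thesis unfolding bf_def using k(3) by auto
qed

lemma length_add2 [simp]: "length l = 10 \<Longrightarrow> length m = 10 \<Longrightarrow> length (add2 l m) = 10"
  by (simp add: add2_def)

lemma add2_red2: "length l = 10 \<Longrightarrow> length m = 10 \<Longrightarrow> add2 l m = red2 (lift2 l + lift2 m)"
  by (simp add: red2_add lift2_L10 red2_lift2)

lemma bf_lift2: "length l = 10 \<Longrightarrow> length m = 10 \<Longrightarrow> bf l m \<longleftrightarrow> odd \<lfloor>form10 (lift2 l) (lift2 m)\<rfloor>"
  using bf_red2[OF lift2_L10 lift2_L10, of l m] by (simp add: red2_lift2)

lemma bf_commute: "length l = 10 \<Longrightarrow> length m = 10 \<Longrightarrow> bf l m = bf m l"
  by (simp add: bf_lift2 form10_commute)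

lemma bf_add2:
  assumes "length l = 10" "length m = 10" "length n = 10"
  shows "bf n (add2 l m) \<longleftrightarrow> bf n l \<noteq> bf n m"
proof -
  obtain i j where "form10 (lift2 n) (lift2 l) = of_int i" "form10 (lift2 n) (lift2 m) = of_int j"
    using form10_Ints[OF lift2_L10 lift2_L10] by (meson Ints_cases)
  moreover have "bf n (add2 l m) \<longleftrightarrow> odd \<lfloor>form10 (lift2 n) (lift2 l + lift2 m)\<rfloor>"
    using bf_red2[OF lift2_L10 L10_closed(2)[OF lift2_L10 lift2_L10], of n l m] assms by (simp add: add2_red2 red2_lift2)
  ultimately have "bf n (add2 l m) \<longleftrightarrow> odd \<lfloor>real_of_int (i + j)\<rfloor>" "bf n l \<longleftrightarrow> odd i" "bf n m \<longleftrightarrow> odd j"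
    using assms by (simp_all add: bf_lift2)
  then show ?thesis by (simp only: floor_of_int odd_add_xor)
qed

lemma bf_self: "length l = 10 \<Longrightarrow> \<not> bf l l"
proof -
  assume l: "length l = 10"
  obtain k where "form10 (lift2 l) (lift2 l) / 2 = of_int k" using form10_even[OF lift2_L10] by (meson Ints_cases)
  then have "form10 (lift2 l) (lift2 l) = of_int (2 * k)" by simp
  then have "\<lfloor>form10 (lift2 l) (lift2 l)\<rfloor> = 2 * k" by (simp only: floor_of_int)
  then show ?thesis using l by (simp add: bf_lift2)
qed

lemma add2_cancel: "length l = 10 \<Longrightarrow> length m = 10 \<Longrightarrow> add2 l (add2 l m) = m"
  by (rule nth_equalityI) (auto simp: add2_def)

section \<open>The action of isometries modulo 2\<close>

definition act2 :: "(real^10 \<Rightarrow> real^10) \<Rightarrow> bool list \<Rightarrow> bool list" where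
  "act2 g l = red2 (g (lift2 l))"

lemma length_act2 [simp]: "length (act2 g l) = 10" by (simp add: act2_def)

lemma act2_red2: "g \<in> isoms10 \<Longrightarrow> x \<in> L10 \<Longrightarrow> act2 g (red2 x) = red2 (g x)"
proof -
  assume g: "g \<in> isoms10" and x: "x \<in> L10"
  have "red2 (lift2 (red2 x)) = red2 x" by (simp add: red2_lift2)
  then have "cong2 (lift2 (red2 x)) x" using red2_eq_iff_cong2 lift2_L10 x by blast
  then have "cong2 (g (lift2 (red2 x))) (g x)" using cong2_image g by blast
  then show ?thesis unfolding act2_def using red2_eq_iff_cong2 isoms10_L10[OF g] lift2_L10 x by blast
qed

lemma act2_comp: "g \<in> isoms10 \<Longrightarrow> h \<in> isoms10 \<Longrightarrow> act2 (g \<circ> h) l = act2 g (act2 h l)"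
  using act2_red2[of g "h (lift2 l)"] isoms10_L10[OF _ lift2_L10] by (simp add: act2_def)

lemma act2_id: "length l = 10 \<Longrightarrow> act2 id l = l" by (simp add: act2_def red2_lift2)

lemma act2_inv: "g \<in> isoms10 \<Longrightarrow> length l = 10 \<Longrightarrow> act2 g (act2 (inv g) l) = l" "g \<in> isoms10 \<Longrightarrow> length l = 10 \<Longrightarrow> act2 (inv g) (act2 g l) = l"
proof -
  assume g: "g \<in> isoms10" and l: "length l = 10"
  have "g \<circ> inv g = id" "inv g \<circ> g = id" using isoms10_inv_apply[OF g] by (auto simp: fun_eq_iff)
  then show "act2 g (act2 (inv g) l) = l" "act2 (inv g) (act2 g l) = l"
    using act2_comp[OF g isoms10_inv[OF g], of l] act2_comp[OF isoms10_inv[OF g] g, of l] act2_id[OF l] by simp_all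
qed

lemma act2_qf: "g \<in> isoms10 \<Longrightarrow> length l = 10 \<Longrightarrow> qf (act2 g l) = qf l"
  using qf_red2[OF isoms10_L10[OF _ lift2_L10], of g l] qf_red2[OF lift2_L10, of l]
  by (simp add: act2_def isoms10_form red2_lift2)

lemma act2_bf: "g \<in> isoms10 \<Longrightarrow> length l = 10 \<Longrightarrow> length m = 10 \<Longrightarrow> bf (act2 g l) (act2 g m) = bf l m"
  using bf_red2[OF isoms10_L10[OF _ lift2_L10] isoms10_L10[OF _ lift2_L10], of g g l m]
  by (simp add: act2_def isoms10_form bf_lift2)

text \<open>A reflection reduces to the orthogonal transvection in the class of its root.\<close>

lemma act2_refl10:
  assumes r: "r \<in> roots10" and l: "length l = 10"
  shows "act2 (refl10 r) l = (if bf l (red2 r) then add2 l (red2 r) else l)"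
proof -
  have rL: "r \<in> L10" using r by (simp add: roots10_def)
  obtain k where k: "form10 (lift2 l) r = of_int k" using form10_Ints[OF lift2_L10 rL] by (meson Ints_cases)
  have b: "bf l (red2 r) \<longleftrightarrow> odd k" using bf_red2[OF lift2_L10 rL, of l] k l by (simp add: red2_lift2)
  show ?thesis
  proof (cases "odd k")
    case True
    then obtain m where m: "k = 2 * m + 1" by (meson oddE)
    have "red2 (refl10 r (lift2 l)) = red2 (lift2 l + r)"
      by (subst red2_eq_iff_cong2) (auto simp: refl10_def k m cong2_def L10_closed lift2_L10 rL scaleR_left_distrib intro!: bexI[of _ "of_int m *\<^sub>R r"])
    then show ?thesis using b True l red2_add[OF lift2_L10 rL] by (simp add: act2_def red2_lift2)
  next
    case False
    then obtain m where m: "k = 2 * m" by (meson evenE)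
    have "red2 (refl10 r (lift2 l)) = red2 (lift2 l)"
      by (subst red2_eq_iff_cong2) (auto simp: refl10_def k m cong2_def L10_closed lift2_L10 rL intro!: bexI[of _ "of_int m *\<^sub>R r"])
    then show ?thesis using b False l by (simp add: act2_def red2_lift2)
  qed
qed

lemma card_act2:
  assumes g: "g \<in> isoms10" and P: "\<And>l. length l = 10 \<Longrightarrow> P l \<longleftrightarrow> P' (act2 g l)"
  shows "card {l \<in> F2. P l} = card {l \<in> F2. P' l}"
proof (rule bij_betw_same_card)
  show "bij_betw (act2 g) {l \<in> F2. P l} {l \<in> F2. P' l}"
    by (rule bij_betw_byWitness[of _ "act2 (inv g)"]) (use P in \<open>auto simp: act2_inv[OF g]\<close>)
qed

text \<open>The standard frame: \<open>f0b\<close> and \<open>f1b\<close> are a hyperbolic pair. In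
  the E_8 part, \<open>xb\<close> is a sum of three orthogonal simple roots and \<open>yb\<close> a
  simple root meeting one of them; they span an anisotropic plane.\<close>

definition f0b :: "bool list" where "f0b = [True,False,False,False,False,False,False,False,False,False]"
definition f1b :: "bool list" where "f1b = [False,True,False,False,False,False,False,False,False,False]"
definition xb :: "bool list" where "xb = [False,False,False,True,False,False,True,False,True,False]"
definition yb :: "bool list" where "yb = [False,False,False,False,False,False,False,False,False,True]"
definition zerob :: "bool list" where "zerob = replicate 10 False"

lemma length_stdb [simp]: "length f0b = 10" "length f1b = 10" "length xb = 10" "length yb = 10" "length zerob = 10"
  by (simp_all add: f0b_def f1b_def xb_def yb_def zerob_def)

text \<open>The positive roots of \<open>E\<^sub>8\<close> in the basis of simple roots; modulo 2 they are the 120 vectors on which the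
  quadratic form does not vanish.\<close>
definition e8_roots :: "int list list" where
  "e8_roots =
    [[1,0,0,0,0,0,0,0], [0,1,0,0,0,0,0,0], [0,0,1,0,0,0,0,0], [0,0,0,1,0,0,0,0], [0,0,0,0,1,0,0,0],
     [0,0,0,0,0,1,0,0], [0,0,0,0,0,0,1,0], [0,0,0,0,0,0,0,1], [1,0,1,0,0,0,0,0], [0,1,0,1,0,0,0,0],
     [0,0,1,1,0,0,0,0], [0,0,0,1,1,0,0,0], [0,0,0,0,1,1,0,0], [0,0,0,0,0,1,1,0], [0,0,0,0,0,0,1,1],
     [1,0,1,1,0,0,0,0], [0,1,1,1,0,0,0,0], [0,1,0,1,1,0,0,0], [0,0,1,1,1,0,0,0], [0,0,0,1,1,1,0,0],
     [0,0,0,0,1,1,1,0], [0,0,0,0,0,1,1,1], [1,1,1,1,0,0,0,0], [1,0,1,1,1,0,0,0], [0,1,1,1,1,0,0,0],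
     [0,1,0,1,1,1,0,0], [0,0,1,1,1,1,0,0], [0,0,0,1,1,1,1,0], [0,0,0,0,1,1,1,1], [1,1,1,1,1,0,0,0],
     [1,0,1,1,1,1,0,0], [0,1,1,2,1,0,0,0], [0,1,1,1,1,1,0,0], [0,1,0,1,1,1,1,0], [0,0,1,1,1,1,1,0],
     [0,0,0,1,1,1,1,1], [1,1,1,2,1,0,0,0], [1,1,1,1,1,1,0,0], [1,0,1,1,1,1,1,0], [0,1,1,2,1,1,0,0],
     [0,1,1,1,1,1,1,0], [0,1,0,1,1,1,1,1], [0,0,1,1,1,1,1,1], [1,1,2,2,1,0,0,0], [1,1,1,2,1,1,0,0],
     [1,1,1,1,1,1,1,0], [1,0,1,1,1,1,1,1], [0,1,1,2,2,1,0,0], [0,1,1,2,1,1,1,0], [0,1,1,1,1,1,1,1],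
     [1,1,2,2,1,1,0,0], [1,1,1,2,2,1,0,0], [1,1,1,2,1,1,1,0], [1,1,1,1,1,1,1,1], [0,1,1,2,2,1,1,0],
     [0,1,1,2,1,1,1,1], [1,1,2,2,2,1,0,0], [1,1,2,2,1,1,1,0], [1,1,1,2,2,1,1,0], [1,1,1,2,1,1,1,1],
     [0,1,1,2,2,2,1,0], [0,1,1,2,2,1,1,1], [1,1,2,3,2,1,0,0], [1,1,2,2,2,1,1,0], [1,1,2,2,1,1,1,1],
     [1,1,1,2,2,2,1,0], [1,1,1,2,2,1,1,1], [0,1,1,2,2,2,1,1], [1,2,2,3,2,1,0,0], [1,1,2,3,2,1,1,0],
     [1,1,2,2,2,2,1,0], [1,1,2,2,2,1,1,1], [1,1,1,2,2,2,1,1], [0,1,1,2,2,2,2,1], [1,2,2,3,2,1,1,0],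
     [1,1,2,3,2,2,1,0], [1,1,2,3,2,1,1,1], [1,1,2,2,2,2,1,1], [1,1,1,2,2,2,2,1], [1,2,2,3,2,2,1,0],
     [1,2,2,3,2,1,1,1], [1,1,2,3,3,2,1,0], [1,1,2,3,2,2,1,1], [1,1,2,2,2,2,2,1], [1,2,2,3,3,2,1,0],
     [1,2,2,3,2,2,1,1], [1,1,2,3,3,2,1,1], [1,1,2,3,2,2,2,1], [1,2,2,4,3,2,1,0], [1,2,2,3,3,2,1,1],
     [1,2,2,3,2,2,2,1], [1,1,2,3,3,2,2,1], [1,2,3,4,3,2,1,0], [1,2,2,4,3,2,1,1], [1,2,2,3,3,2,2,1],
     [1,1,2,3,3,3,2,1], [2,2,3,4,3,2,1,0], [1,2,3,4,3,2,1,1], [1,2,2,4,3,2,2,1], [1,2,2,3,3,3,2,1],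
     [2,2,3,4,3,2,1,1], [1,2,3,4,3,2,2,1], [1,2,2,4,3,3,2,1], [2,2,3,4,3,2,2,1], [1,2,3,4,3,3,2,1],
     [1,2,2,4,4,3,2,1], [2,2,3,4,3,3,2,1], [1,2,3,4,4,3,2,1], [2,2,3,4,4,3,2,1], [1,2,3,5,4,3,2,1],
     [2,2,3,5,4,3,2,1], [1,3,3,5,4,3,2,1], [2,3,3,5,4,3,2,1], [2,2,4,5,4,3,2,1], [2,3,4,5,4,3,2,1],
     [2,3,4,6,4,3,2,1], [2,3,4,6,5,3,2,1], [2,3,4,6,5,4,2,1], [2,3,4,6,5,4,3,1], [2,3,4,6,5,4,3,2]]"

fun e8q :: "int list \<Rightarrow> int" where
  "e8q [c,d,e,f,g,h,i,j] = c * c + d * d + e * e + f * f + g * g + h * h + i * i + j * j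
     - c * e - e * f - f * g - g * h - h * i - i * j - d * f"
| "e8q _ = 0"

lemma e8_roots_norm: "\<forall>r\<in>set e8_roots. length r = 8 \<and> e8q r = 1"
  by code_simp

definition e8_class :: "int list \<Rightarrow> bool list" where "e8_class r = False # False # map odd r"

definition nonsing_e8 :: "bool list list" where
  "nonsing_e8 = filter qf (ext2 False False)"

lemma e8_class_nonsing: "\<forall>r\<in>set e8_roots. qf (e8_class r)"
  by code_simp

lemma e8_class_distinct: "distinct (map e8_class e8_roots)"
  by code_simp

lemma length_e8_roots: "length e8_roots = 120"
  by code_simp

lemma length_nonsing_e8: "length nonsing_e8 = 120"
  by code_simp

text \<open>Intermediate stations, each non-orthogonal to \<open>xb\<close>. Every nonsingular E_8
  class equals \<open>xb\<close>, or pairs oddly with \<open>xb\<close> or with one of these, so two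
  transvections suffice to reach \<open>xb\<close>.\<close>

definition linking_e8 :: "bool list list" where
  "linking_e8 = [[False,False,False,False,False,False,False,False,False,True],
     [False,False,True,True,False,False,False,False,False,True],
     [False,False,False,True,True,False,False,False,False,True],
     [False,False,True,True,True,False,False,False,False,True],
     [False,False,True,False,False,True,False,False,False,True],
     [False,False,True,False,False,False,True,False,False,True]]"

lemma linking_e8: "\<forall>z\<in>set linking_e8. length z = 10 \<and> qf z \<and> \<not> bf f0b z \<and> \<not> bf f1b z \<and> bf z xb"
  by code_simp

lemma nonsing_e8_linked: "\<forall>x\<in>set nonsing_e8. x = xb \<or> bf x xb \<or> (\<exists>z\<in>set linking_e8. bf x z)"
  by code_simp

text \<open>The form is the product of the hyperbolic coordinates plus the E_8 form, which has 136
  zeros and 120 nonzero values. The first block omits the zero vector, and the last one counts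
  nonzero values.\<close>

lemma count_sing: "length (filter (\<lambda>l. \<not> qf l \<and> l \<noteq> zerob) vecs2) = 527"
proof -
  have "length (filter (\<lambda>l. \<not> qf l \<and> l \<noteq> zerob) (ext2 False False)) = 135" by code_simp
  moreover have "length (filter (\<lambda>l. \<not> qf l \<and> l \<noteq> zerob) (ext2 False True)) = 136" by code_simp
  moreover have "length (filter (\<lambda>l. \<not> qf l \<and> l \<noteq> zerob) (ext2 True False)) = 136" by code_simp
  moreover have "length (filter (\<lambda>l. \<not> qf l \<and> l \<noteq> zerob) (ext2 True True)) = 120" by code_simp
  ultimately show ?thesis unfolding vecs2_def filter_append length_append by linarith
qed

lemma count_hyp: "length (filter (\<lambda>l. \<not> qf l \<and> bf f0b l) vecs2) = 256"
proof -
  have "length (filter (\<lambda>l. \<not> qf l \<and> bf f0b l) (ext2 False False)) = 0" by code_simp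
  moreover have "length (filter (\<lambda>l. \<not> qf l \<and> bf f0b l) (ext2 False True)) = 136" by code_simp
  moreover have "length (filter (\<lambda>l. \<not> qf l \<and> bf f0b l) (ext2 True False)) = 0" by code_simp
  moreover have "length (filter (\<lambda>l. \<not> qf l \<and> bf f0b l) (ext2 True True)) = 120" by code_simp
  ultimately show ?thesis unfolding vecs2_def filter_append length_append by linarith
qed

text \<open>Of the 240 roots of E_8, 112 pair to \<plusminus>1 with a given root; modulo sign these
  are 56 classes.\<close>

lemma count_pair: "length (filter (bf xb) nonsing_e8) = 56"
  by code_simp

lemma bf_stdb: "bf xb yb" "qf xb" "qf yb" "\<not> bf f0b xb" "\<not> bf f1b xb" "\<not> bf f0b yb" "\<not> bf f1b yb" "bf f0b f1b" "\<not> qf f0b" "\<not> qf f1b"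
  by code_simp+

section \<open>Transitivity modulo 2\<close>

lemma bf_f0b: "bf f0b l \<longleftrightarrow> l ! 1" and bf_f1b: "bf f1b l \<longleftrightarrow> l ! 0" if len: "length l = 10"
proof -
  obtain a b c d e f g h i j where l: "l = [a,b,c,d,e,f,g,h,i,j]" using len by (rule length_10_cases)
  have "lift2 f0b = vec10 1 0 0 0 0 0 0 0 0 0" "lift2 f1b = vec10 0 1 0 0 0 0 0 0 0 0"
    by (simp_all add: lift2_def f0b_def f1b_def)
  then show "bf f0b l \<longleftrightarrow> l ! 1" "bf f1b l \<longleftrightarrow> l ! 0"
    using len by (simp_all add: bf_lift2 form10_expand lift2_def l)
qed

lemma set_nonsing_e8: "set nonsing_e8 = {l. length l = 10 \<and> qf l \<and> \<not> bf f0b l \<and> \<not> bf f1b l}"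
proof (intro set_eqI iffI)
  fix l assume "l \<in> set nonsing_e8"
  then obtain m where m: "l = False # False # m" "length m = 8" "qf l"
    by (auto simp: nonsing_e8_def set_ext2)
  then show "l \<in> {l. length l = 10 \<and> qf l \<and> \<not> bf f0b l \<and> \<not> bf f1b l}" by (simp add: bf_f0b bf_f1b)
next
  fix l assume l: "l \<in> {l. length l = 10 \<and> qf l \<and> \<not> bf f0b l \<and> \<not> bf f1b l}"
  then obtain a b c d e f g h i j where "l = [a,b,c,d,e,f,g,h,i,j]" using length_10_cases by blast
  then have "l = False # False # [c,d,e,f,g,h,i,j]" using l by (simp add: bf_f0b bf_f1b)
  then show "l \<in> set nonsing_e8" using l by (auto simp: nonsing_e8_def set_ext2)
qed

lemma distinct_nonsing_e8: "distinct nonsing_e8"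
  unfolding nonsing_e8_def by (intro distinct_filter distinct_ext2)

text \<open>The listed roots give 120 distinct nonsingular classes among exactly 120. Hence every
  nonsingular E_8 class lifts to a root, and its transvection to a lattice reflection.\<close>

lemma e8_roots_cover: "set (map e8_class e8_roots) = set nonsing_e8"
proof (rule card_subset_eq)
  show "set (map e8_class e8_roots) \<subseteq> set nonsing_e8"
  proof
    fix l assume "l \<in> set (map e8_class e8_roots)"
    then obtain r where r: "r \<in> set e8_roots" "l = e8_class r" by auto
    have "qf l" "length r = 8" using bspec[OF e8_class_nonsing r(1)] bspec[OF e8_roots_norm r(1)] r(2) by auto
    then show "l \<in> set nonsing_e8" using r(2) by (simp add: nonsing_e8_def set_ext2 e8_class_def)
  qed
  show "card (set (map e8_class e8_roots)) = card (set nonsing_e8)"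
    unfolding distinct_card[OF e8_class_distinct] distinct_card[OF distinct_nonsing_e8]
    by (simp add: length_e8_roots length_nonsing_e8)
qed simp

lemma nonsing_root:
  assumes "length l = 10" "qf l" "\<not> bf f0b l" "\<not> bf f1b l"
  obtains r where "r \<in> roots10" "red2 r = l"
proof -
  have "l \<in> set (map e8_class e8_roots)" using assms unfolding e8_roots_cover set_nonsing_e8 by simp
  then obtain r where r: "r \<in> set e8_roots" "l = False # False # map odd r" by (auto simp: e8_class_def)
  have len: "length r = 8" and q: "e8q r = 1" using bspec[OF e8_roots_norm r(1)] by auto
  obtain c d e f g h i j where rl: "r = [c,d,e,f,g,h,i,j]" using len by (auto simp: length_Suc_conv eval_nat_numeral)
  define v where "v = vec10 (of_int 0) (of_int 0) (of_int c) (of_int d) (of_int e) (of_int f) (of_int g) (of_int h) (of_int i) (of_int j)"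
  have "form10 v v = - 2 * of_int (e8q r)" unfolding rl by (simp add: v_def form10_expand algebra_simps)
  then have "form10 v v = -2" using q by simp
  moreover have "v \<in> L10" by (simp add: v_def L10_iff)
  ultimately have "v \<in> roots10" by (simp add: roots10_def)
  moreover have "red2 v = l" unfolding v_def red2_vec10 r(2) rl by simp
  ultimately show thesis using that by blast
qed

text \<open>If \<open>x\<close> and \<open>x'\<close> are not orthogonal, the transvection in \<open>x + x'\<close> exchanges them.\<close>
lemma transvection_move:
  assumes x: "length x = 10" "qf x" "\<not> bf f0b x" "\<not> bf f1b x" and x': "length x' = 10" "qf x'" "\<not> bf f0b x'" "\<not> bf f1b x'"
    and b: "bf x x'"
  shows "\<exists>g\<in>isoms10. act2 g x = x' \<and> (\<forall>m. length m = 10 \<and> bf m x = bf m x' \<longrightarrow> act2 g m = m)"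
proof -
  define d where "d = add2 x x'"
  have d: "length d = 10" "qf d" "\<not> bf f0b d" "\<not> bf f1b d"
    using x x' b by (auto simp: d_def bf_add2) (auto simp: bf_def)
  obtain r where r: "r \<in> roots10" "red2 r = d" using nonsing_root[OF d] .
  have "act2 (refl10 r) x = x'"
  proof -
    have "bf x d" using x x' b bf_self[of x] by (simp add: d_def bf_add2)
    then show ?thesis using act2_refl10[OF r(1) x(1)] r(2) x x' by (simp add: d_def add2_cancel)
  qed
  moreover have "act2 (refl10 r) m = m" if "length m = 10" "bf m x = bf m x'" for m
    using act2_refl10[OF r(1) that(1)] r(2) that x x' by (simp add: d_def bf_add2)
  ultimately show ?thesis using refl10_isoms10[OF r(1)] by blast
qed

lemma trans_x:
  assumes x: "length x = 10" "qf x" "\<not> bf f0b x" "\<not> bf f1b x"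
  obtains g where "g \<in> isoms10" "act2 g f0b = f0b" "act2 g f1b = f1b" "act2 g x = xb"
proof -
  have std: "length xb = 10" "qf xb" "\<not> bf f0b xb" "\<not> bf f1b xb" using bf_stdb by auto
  have step: "\<exists>g\<in>isoms10. act2 g f0b = f0b \<and> act2 g f1b = f1b \<and> act2 g x = x'"
    if h: "length x = 10" "qf x" "\<not> bf f0b x" "\<not> bf f1b x" "length x' = 10" "qf x'" "\<not> bf f0b x'" "\<not> bf f1b x'" "bf x x'" for x x'
  proof -
    obtain g where "g \<in> isoms10" "act2 g x = x'" "\<forall>m. length m = 10 \<and> bf m x = bf m x' \<longrightarrow> act2 g m = m"
      using transvection_move[OF h] by blast
    then show ?thesis using h by (intro bexI[of _ g]) simp_all
  qed
  have xn: "x \<in> set nonsing_e8" using x by (simp add: set_nonsing_e8)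
  from bspec[OF nonsing_e8_linked xn]
  consider "x = xb" | "bf x xb" | z where "z \<in> set linking_e8" "bf x z" by blast
  then have "\<exists>g\<in>isoms10. act2 g f0b = f0b \<and> act2 g f1b = f1b \<and> act2 g x = xb"
  proof cases
    case 1 then show ?thesis using isoms10_id act2_id by (intro bexI[of _ id]) auto
  next
    case 2 then show ?thesis using step[OF x std] by blast
  next
    case 3
    have z: "length z = 10" "qf z" "\<not> bf f0b z" "\<not> bf f1b z" and zx: "bf z xb" using bspec[OF linking_e8 3(1)] by auto
    obtain g where g: "g \<in> isoms10" "act2 g f0b = f0b" "act2 g f1b = f1b" "act2 g x = z" using step[OF x z 3(2)] by blast
    obtain h where h: "h \<in> isoms10" "act2 h f0b = f0b" "act2 h f1b = f1b" "act2 h z = xb" using step[OF z std zx] by blast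
    show ?thesis using g h isoms10_comp[OF h(1) g(1)] act2_comp[OF h(1) g(1)] by (intro bexI[of _ "h \<circ> g"]) simp_all
  qed
  then show thesis using that by blast
qed

text \<open>The transvection in \<open>add2 y yb\<close> fixes \<open>xb\<close>, since both vectors
  pair oddly with it. If \<open>y\<close> is orthogonal to \<open>yb\<close>, the transvection in
  \<open>xb\<close> first replaces \<open>y\<close> by \<open>add2 y xb\<close>, which is
  not.\<close>

lemma trans_y:
  assumes y: "length y = 10" "qf y" "\<not> bf f0b y" "\<not> bf f1b y" "bf xb y"
  obtains g where "g \<in> isoms10" "act2 g f0b = f0b" "act2 g f1b = f1b" "act2 g xb = xb" "act2 g y = yb"
proof -
  have std: "length yb = 10" "qf yb" "\<not> bf f0b yb" "\<not> bf f1b yb" and std': "length xb = 10" "qf xb" "\<not> bf f0b xb" "\<not> bf f1b xb"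
    using bf_stdb by auto
  have step: "\<exists>g\<in>isoms10. act2 g f0b = f0b \<and> act2 g f1b = f1b \<and> act2 g xb = xb \<and> act2 g y = yb"
    if y: "length y = 10" "qf y" "\<not> bf f0b y" "\<not> bf f1b y" "bf y yb" "bf xb y" for y
  proof -
    obtain g where "g \<in> isoms10" "act2 g y = yb" "\<forall>m. length m = 10 \<and> bf m y = bf m yb \<longrightarrow> act2 g m = m"
      using transvection_move[OF y(1-4) std y(5)] by blast
    then show ?thesis using y std bf_stdb by (intro bexI[of _ g]) simp_all
  qed
  have "\<exists>g\<in>isoms10. act2 g f0b = f0b \<and> act2 g f1b = f1b \<and> act2 g xb = xb \<and> act2 g y = yb"
  proof (cases "bf y yb")
    case True then show ?thesis using step y by blast
  next
    case False
    obtain r where r: "r \<in> roots10" "red2 r = xb" using nonsing_root[OF std'] .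
    let ?g = "refl10 r"
    have g: "?g \<in> isoms10" using refl10_isoms10[OF r(1)] .
    have yx: "bf y xb" using bf_commute[of y xb] y by simp
    have g': "act2 ?g f0b = f0b" "act2 ?g f1b = f1b" "act2 ?g xb = xb" "act2 ?g y = add2 y xb"
      using act2_refl10[OF r(1)] r(2) std' y yx bf_self[of xb] by simp_all
    let ?y = "add2 y xb"
    have y': "length ?y = 10" "qf ?y" "\<not> bf f0b ?y" "\<not> bf f1b ?y" "bf ?y yb" "bf xb ?y"
    proof -
      show "length ?y = 10" using y by simp
      have "bf yb ?y" using False bf_commute[of y yb] bf_commute[of xb yb] y bf_stdb by (simp add: bf_add2)
      then show "bf ?y yb" using bf_commute[of ?y yb] y by simp
      show "qf ?y" using yx y std' by (auto simp: bf_def)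
      show "\<not> bf f0b ?y" "\<not> bf f1b ?y" "bf xb ?y" using y std' bf_self[of xb] by (simp_all add: bf_add2)
    qed
    obtain h where h: "h \<in> isoms10" "act2 h f0b = f0b" "act2 h f1b = f1b" "act2 h xb = xb" "act2 h ?y = yb"
      using step[OF y'] by blast
    show ?thesis using g g' h isoms10_comp[OF h(1) g] act2_comp[OF h(1) g] by (intro bexI[of _ "h \<circ> ?g"]) simp_all
  qed
  then show thesis using that by blast
qed

text \<open>The Eichler transvection for the first isotropic basis vector and an E_8 vector
  \<open>c\<close>. It fixes that isotropic vector, and its inverse belongs to
  \<open>- c\<close>.\<close>

definition eichler10 :: "real^10 \<Rightarrow> real^10 \<Rightarrow> real^10" where
  "eichler10 c x = x + x$1 *\<^sub>R c - (form10 x c + form10 c c / 2 * x$1) *\<^sub>R vec10 1 0 0 0 0 0 0 0 0 0"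

lemma eichler10_isoms10:
  assumes c: "c \<in> L10" "c$0 = 0" "c$1 = 0" shows "eichler10 c \<in> isoms10"
proof (rule isoms10_I_inverse)
  let ?f = "vec10 1 0 0 0 0 0 0 0 0 0"
  have f: "form10 x ?f = x$1" "form10 ?f x = x$1" for x by (simp_all add: form10_expand)
  have n1: "eichler10 c x $ 1 = x$1" for x using c by (simp add: eichler10_def)
  show "linear (eichler10 c)" by (rule linearI) (simp_all add: eichler10_def vec_eq_10 algebra_simps add_divide_distrib)
  show "form10 (eichler10 c x) (eichler10 c y) = form10 x y" for x y
    using c form10_commute[of c y] by (simp add: eichler10_def f algebra_simps)
  have L: "eichler10 c x \<in> L10" if "x \<in> L10" "c \<in> L10" for x c
    unfolding eichler10_def using that form10_Ints[OF that] form10_even[OF that(2)]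
    by (intro L10_closed Ints_add Ints_mult) (auto simp: L10_iff)
  then show "eichler10 c x \<in> L10" if "x \<in> L10" for x using that c by blast
  show "h10 \<in> P10" by (rule h10_P10)
  have cc: "form10 c c \<le> 0" using form10_le[of c] c by simp
  have hc: "form10 h10 c = 0" using c by (simp add: form10_h10)
  have "form10 h10 (eichler10 c h10) = 2 - form10 c c / 2"
    using c hc by (simp add: eichler10_def f form10_h10)
  moreover have "form10 (eichler10 c h10) (eichler10 c h10) = 2"
    using c form10_commute[of c h10] hc by (simp add: eichler10_def f form10_h10 algebra_simps)
  ultimately show "eichler10 c h10 \<in> P10" using P10_I[OF h10_P10] cc by simp
  show "\<exists>y\<in>L10. eichler10 c y = x" if "x \<in> L10" for x
  proof (intro bexI)
    show "eichler10 (- c) x \<in> L10" using L that c L10_closed(4) by blast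
    have e: "form10 (eichler10 (- c) x) c = form10 x c - form10 c c * x$1" "eichler10 (- c) x $ 1 = x$1"
      using c by (simp_all add: eichler10_def f algebra_simps)
    show "eichler10 c (eichler10 (- c) x) = x" unfolding eichler10_def[of c "eichler10 (- c) x"] e
      by (simp add: eichler10_def vec_eq_10 algebra_simps)
  qed
qed

lemma trans_f:
  assumes f: "length f = 10" "\<not> qf f" "bf f0b f"
  obtains g where "g \<in> isoms10" "act2 g f0b = f0b" "act2 g f = f1b"
proof -
  have f1: "f ! 1" using f bf_f0b by simp
  define z where "z = lift2 f"
  \<comment> \<open>The coefficient of the second isotropic vector in \<open>z\<close> is 1, so this
    Eichler map removes the whole E_8 part of \<open>z\<close>. Singularity then makes the remaining
    first coordinate even.\<close>
  define c where "c = (\<chi> i. if i = 0 \<or> i = 1 then 0 else - z$i)"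
  have zL: "z \<in> L10" by (simp add: z_def lift2_L10)
  have cL: "c \<in> L10" using zL by (auto simp: L10_def c_def)
  have c01: "c$0 = 0" "c$1 = 0" by (simp_all add: c_def)
  have g: "eichler10 c \<in> isoms10" using eichler10_isoms10[OF cL c01] .
  have "eichler10 c (lift2 f0b) = lift2 f0b"
    using c01 by (simp add: eichler10_def lift2_def f0b_def form10_expand)
  then have a0: "act2 (eichler10 c) f0b = f0b" by (simp add: act2_def red2_lift2)
  have z1: "z$1 = 1" using f1 by (simp add: z_def lift2_def)
  define y where "y = eichler10 c z"
  have yL: "y \<in> L10" using isoms10_L10[OF g zL] by (simp add: y_def)
  have yc: "y$1 = 1" "y$2 = 0" "y$3 = 0" "y$4 = 0" "y$5 = 0" "y$6 = 0" "y$7 = 0" "y$8 = 0" "y$9 = 0"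
    using z1 by (simp_all add: y_def eichler10_def c_def)
  obtain k where k: "y$0 = of_int k" using yL by (auto simp: L10_def elim: Ints_cases)
  have "form10 y y / 2 = of_int k" using yc k by (simp add: form10_expand)
  then have "qf (red2 y) \<longleftrightarrow> odd k" using qf_red2[OF yL] by simp
  moreover have "qf (red2 y) = qf f" using act2_qf[OF g f(1)] by (simp add: act2_def y_def z_def)
  ultimately have "even k" using f(2) by simp
  then have "red2 y = f1b" using yc k by (simp add: red2_def f1b_def)
  then have "act2 (eichler10 c) f = f1b" by (simp add: act2_def y_def z_def)
  then show thesis using that g a0 by blast
qed

text \<open>If a hyperbolic coordinate is odd, \<open>trans_f\<close> and the swap \<open>s\<close>
  finish. If both are even, the E_8 part is nonzero, and an Eichler map with a simple root pairing
  oddly with it makes the first coordinate odd.\<close>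

lemma trans_e:
  assumes e: "length e = 10" "\<not> qf e" "e \<noteq> zerob"
  obtains g where "g \<in> isoms10" "act2 g e = f0b"
proof -
  define s where "s = refl10 (simple10 9)"
  have sr: "simple10 9 \<in> roots10" using simple10_roots[of 9] by simp
  have si: "s \<in> isoms10" unfolding s_def using refl10_isoms10[OF sr] .
  have sx: "s x $ 0 = x$1" "s x $ 1 = x$0" for x by (simp_all add: s_def refl10_def simple10_def form10_expand)
  have sf: "act2 s f1b = f0b"
  proof -
    have "s (lift2 f1b) = lift2 f0b" by (simp add: s_def refl10_def simple10_def form10_expand lift2_def f0b_def f1b_def vec_eq_10)
    then show ?thesis by (simp add: act2_def red2_lift2)
  qed
  have A: "\<exists>g\<in>isoms10. act2 g e = f0b" if e: "length e = 10" "\<not> qf e" "e ! 1" for e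
  proof -
    have "bf f0b e" using e bf_f0b by simp
    then obtain g where g: "g \<in> isoms10" "act2 g e = f1b" using trans_f e by blast
    then show ?thesis using si sf isoms10_comp[OF si g(1)] act2_comp[OF si g(1)] by (intro bexI[of _ "s \<circ> g"]) simp_all
  qed
  have B: "\<exists>g\<in>isoms10. act2 g e = f0b" if e: "length e = 10" "\<not> qf e" "e ! 0" for e
  proof -
    have "act2 s e ! 1" using e(3) sx(2)[of "lift2 e"] by (simp add: act2_def red2_def lift2_def)
    moreover have "\<not> qf (act2 s e)" using act2_qf[OF si e(1)] e(2) by simp
    ultimately obtain g where g: "g \<in> isoms10" "act2 g (act2 s e) = f0b" using A[of "act2 s e"] by auto
    then show ?thesis using isoms10_comp[OF g(1) si] act2_comp[OF g(1) si] by (intro bexI[of _ "g \<circ> s"]) simp_all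
  qed
  consider "e ! 1" | "e ! 0" | "\<not> e ! 0" "\<not> e ! 1" by blast
  then have "\<exists>g\<in>isoms10. act2 g e = f0b"
  proof cases
    case 1 then show ?thesis using A e by blast
  next
    case 2 then show ?thesis using B e by blast
  next
    case 3
    define z where "z = lift2 e"
    have zL: "z \<in> L10" by (simp add: z_def lift2_L10)
    have z01: "z$0 = 0" "z$1 = 0" using 3 by (simp_all add: z_def lift2_def)
    \<comment> \<open>E_8 is unimodular, hence nondegenerate modulo 2; the elimination below works
      inwards from the ends of its diagram.\<close>
    have "\<exists>i<8. odd \<lfloor>form10 z (simple10 i)\<rfloor>"
    proof (rule ccontr)
      assume "\<not> ?thesis"
      then have ev: "even \<lfloor>form10 z (simple10 i)\<rfloor>" if "i < 8" for i using that by blast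
      obtain a b c d e' f g h i j where el: "e = [a,b,c,d,e',f,g,h,i,j]" using e(1) by (rule length_10_cases)
      have zz: "z = vec10 (of_int (of_bool a)) (of_int (of_bool b)) (of_int (of_bool c)) (of_int (of_bool d)) (of_int (of_bool e'))
        (of_int (of_bool f)) (of_int (of_bool g)) (of_int (of_bool h)) (of_int (of_bool i)) (of_int (of_bool j))"
        by (simp add: z_def lift2_def el)
      have fl: "form10 z (simple10 0) = of_int (of_bool e' - 2 * of_bool c)" "form10 z (simple10 1) = of_int (of_bool f - 2 * of_bool d)"
        "form10 z (simple10 2) = of_int (of_bool c + of_bool f - 2 * of_bool e')"
        "form10 z (simple10 3) = of_int (of_bool e' + of_bool g + of_bool d - 2 * of_bool f)"
        "form10 z (simple10 4) = of_int (of_bool f + of_bool h - 2 * of_bool g)"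
        "form10 z (simple10 5) = of_int (of_bool g + of_bool i - 2 * of_bool h)"
        "form10 z (simple10 6) = of_int (of_bool h + of_bool j - 2 * of_bool i)"
        "form10 z (simple10 7) = of_int (of_bool i - 2 * of_bool j)"
        unfolding zz by (simp_all add: simple10_def form10_expand)
      have "\<not> e'" using ev[of 0] unfolding fl floor_of_int by (cases e') simp_all
      moreover have "\<not> f" using ev[of 1] unfolding fl floor_of_int by (cases f) simp_all
      moreover have "\<not> i" using ev[of 7] unfolding fl floor_of_int by (cases i) simp_all
      moreover have "\<not> c" using ev[of 2] calculation unfolding fl floor_of_int by (cases c) simp_all
      moreover have "\<not> h" using ev[of 4] ev[of 5] calculation unfolding fl floor_of_int by (cases h; cases g) simp_all
      moreover have "\<not> g" using ev[of 5] calculation unfolding fl floor_of_int by (cases g) simp_all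
      moreover have "\<not> j" using ev[of 6] calculation unfolding fl floor_of_int by (cases j) simp_all
      moreover have "\<not> d" using ev[of 3] calculation unfolding fl floor_of_int by (cases d) simp_all
      ultimately have "\<not> c" "\<not> h" "\<not> g" "\<not> j" "\<not> d" by blast+
      then have "e = zerob" using \<open>\<not> e'\<close> \<open>\<not> f\<close> \<open>\<not> i\<close> 3 by (simp add: el zerob_def eval_nat_numeral)
      then show False using e(3) by blast
    qed
    then obtain m where m: "m < 8" "odd \<lfloor>form10 z (simple10 m)\<rfloor>" by blast
    let ?c = "simple10 m"
    have cL: "?c \<in> L10" using simple10_roots[of m] m(1) by (simp add: roots10_def)
    have c01: "?c $ 0 = 0" "?c $ 1 = 0" using m(1) by (auto simp: simple10_def)
    have g: "eichler10 ?c \<in> isoms10" using eichler10_isoms10[OF cL c01] .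
    have "eichler10 ?c z $ 0 = - form10 z ?c" using z01 by (simp add: eichler10_def)
    moreover have "form10 z ?c \<in> \<int>" using form10_Ints[OF zL cL] .
    ultimately have "odd \<lfloor>eichler10 ?c z $ 0\<rfloor>" using m(2) by (auto elim!: Ints_cases simp flip: of_int_minus)
    then have "act2 (eichler10 ?c) e ! 0" by (simp add: act2_def red2_def z_def)
    moreover have "\<not> qf (act2 (eichler10 ?c) e)" using act2_qf[OF g e(1)] e(2) by simp
    ultimately obtain h where h: "h \<in> isoms10" "act2 h (act2 (eichler10 ?c) e) = f0b" using B[of "act2 (eichler10 ?c) e"] by auto
    then show ?thesis using isoms10_comp[OF h(1) g] act2_comp[OF h(1) g] by (intro bexI[of _ "h \<circ> eichler10 ?c"]) simp_all
  qed
  then show thesis using that by blast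
qed

section \<open>Counting chambers\<close>

definition sing2 :: "bool list set" where "sing2 = {e \<in> F2. \<not> qf e \<and> e \<noteq> zerob}"
definition hyp2 :: "bool list \<Rightarrow> bool list set" where "hyp2 e = {f \<in> F2. \<not> qf f \<and> bf e f}"
definition aniso2 :: "bool list \<Rightarrow> bool list \<Rightarrow> bool list set" where
  "aniso2 e f = {x \<in> F2. qf x \<and> \<not> bf e x \<and> \<not> bf f x}"
definition aniso2' :: "bool list \<Rightarrow> bool list \<Rightarrow> bool list \<Rightarrow> bool list set" where
  "aniso2' e f x = {y \<in> F2. qf y \<and> \<not> bf e y \<and> \<not> bf f y \<and> bf x y}"

text \<open>Bases \<open>(e,f,x,y)\<close> of the 4-dimensional quadratic subspaces of minus type, split as a hyperbolic plane plus an
  anisotropic plane.\<close>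
definition frames2 :: "(bool list \<times> bool list \<times> bool list \<times> bool list) set" where
  "frames2 = (SIGMA e:sing2. SIGMA f:hyp2 e. SIGMA x:aniso2 e f. aniso2' e f x)"

lemma trans_ef:
  assumes "e \<in> sing2" "f \<in> hyp2 e"
  obtains g where "g \<in> isoms10" "act2 g e = f0b" "act2 g f = f1b"
proof -
  have e: "length e = 10" "\<not> qf e" "e \<noteq> zerob" and f: "length f = 10" "\<not> qf f" "bf e f"
    using assms by (auto simp: sing2_def hyp2_def)
  obtain g where g: "g \<in> isoms10" "act2 g e = f0b" using trans_e[OF e] .
  have q: "\<not> qf (act2 g f)" "bf f0b (act2 g f)" using act2_qf[OF g(1) f(1)] act2_bf[OF g(1) e(1) f(1)] f g(2) by auto
  obtain h where h: "h \<in> isoms10" "act2 h f0b = f0b" "act2 h (act2 g f) = f1b" using trans_f[OF length_act2 q] .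
  show thesis using that[OF isoms10_comp[OF h(1) g(1)]] g h by (simp add: act2_comp)
qed

lemma trans_efx:
  assumes "e \<in> sing2" "f \<in> hyp2 e" "x \<in> aniso2 e f"
  obtains g where "g \<in> isoms10" "act2 g e = f0b" "act2 g f = f1b" "act2 g x = xb"
proof -
  have len: "length e = 10" "length f = 10" and x: "length x = 10" "qf x" "\<not> bf e x" "\<not> bf f x"
    using assms by (auto simp: sing2_def hyp2_def aniso2_def)
  obtain g where g: "g \<in> isoms10" "act2 g e = f0b" "act2 g f = f1b" using trans_ef[OF assms(1,2)] .
  have q: "qf (act2 g x)" "\<not> bf f0b (act2 g x)" "\<not> bf f1b (act2 g x)"
    using act2_qf[OF g(1) x(1)] act2_bf[OF g(1) len(1) x(1)] act2_bf[OF g(1) len(2) x(1)] x g by auto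
  obtain h where h: "h \<in> isoms10" "act2 h f0b = f0b" "act2 h f1b = f1b" "act2 h (act2 g x) = xb"
    using trans_x[OF length_act2 q] .
  show thesis using that[OF isoms10_comp[OF h(1) g(1)]] g h by (simp add: act2_comp)
qed

lemma trans_efxy:
  assumes "e \<in> sing2" "f \<in> hyp2 e" "x \<in> aniso2 e f" "y \<in> aniso2' e f x"
  obtains g where "g \<in> isoms10" "act2 g e = f0b" "act2 g f = f1b" "act2 g x = xb" "act2 g y = yb"
proof -
  have len: "length e = 10" "length f = 10" "length x = 10" and y: "length y = 10" "qf y" "\<not> bf e y" "\<not> bf f y" "bf x y"
    using assms by (auto simp: sing2_def hyp2_def aniso2_def aniso2'_def)
  obtain g where g: "g \<in> isoms10" "act2 g e = f0b" "act2 g f = f1b" "act2 g x = xb" using trans_efx[OF assms(1-3)] .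
  have q: "qf (act2 g y)" "\<not> bf f0b (act2 g y)" "\<not> bf f1b (act2 g y)" "bf xb (act2 g y)"
    using act2_qf[OF g(1) y(1)] act2_bf[OF g(1) len(1) y(1)] act2_bf[OF g(1) len(2) y(1)] act2_bf[OF g(1) len(3) y(1)] y g by auto
  obtain h where h: "h \<in> isoms10" "act2 h f0b = f0b" "act2 h f1b = f1b" "act2 h xb = xb" "act2 h (act2 g y) = yb"
    using trans_y[OF length_act2 q] .
  show thesis using that[OF isoms10_comp[OF h(1) g(1)]] g h by (simp add: act2_comp)
qed

section \<open>The number of frames\<close>

lemma card_sing2: "card sing2 = 527"
  unfolding sing2_def card_F2 by (rule count_sing)

text \<open>Transitivity makes the count independent of \<open>e\<close>, so it is read off at
  \<open>f0b\<close>. The next two counts are reduced to the standard frame in the same way.\<close>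

lemma card_hyp2: assumes "e \<in> sing2" shows "card (hyp2 e) = 256"
proof -
  have e: "length e = 10" "\<not> qf e" "e \<noteq> zerob" using assms by (auto simp: sing2_def)
  obtain g where g: "g \<in> isoms10" "act2 g e = f0b" using trans_e[OF e] .
  have "bf f0b (act2 g l) = bf e l" if "length l = 10" for l using act2_bf[OF g(1) e(1) that] unfolding g(2) .
  then have "card (hyp2 e) = card {f \<in> F2. \<not> qf f \<and> bf f0b f}" unfolding hyp2_def
    by (intro card_act2[OF g(1)]) (simp add: act2_qf[OF g(1)])
  then show ?thesis unfolding card_F2 count_hyp .
qed

lemma card_aniso2: assumes "e \<in> sing2" "f \<in> hyp2 e" shows "card (aniso2 e f) = 120"
proof -
  have len: "length e = 10" "length f = 10" using assms by (auto simp: sing2_def hyp2_def)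
  obtain g where g: "g \<in> isoms10" "act2 g e = f0b" "act2 g f = f1b" using trans_ef[OF assms(1,2)] .
  have "bf f0b (act2 g l) = bf e l" "bf f1b (act2 g l) = bf f l" if "length l = 10" for l
    using act2_bf[OF g(1) len(1) that] act2_bf[OF g(1) len(2) that] unfolding g(2,3) .
  then have "card (aniso2 e f) = card {x \<in> F2. qf x \<and> \<not> bf f0b x \<and> \<not> bf f1b x}" unfolding aniso2_def
    by (intro card_act2[OF g(1)]) (simp add: act2_qf[OF g(1)])
  also have "{x \<in> F2. qf x \<and> \<not> bf f0b x \<and> \<not> bf f1b x} = set nonsing_e8" unfolding set_nonsing_e8 by simp
  finally show ?thesis unfolding distinct_card[OF distinct_nonsing_e8] length_nonsing_e8 .
qed

lemma card_aniso2': assumes "e \<in> sing2" "f \<in> hyp2 e" "x \<in> aniso2 e f" shows "card (aniso2' e f x) = 56"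
proof -
  have len: "length e = 10" "length f = 10" "length x = 10" using assms by (auto simp: sing2_def hyp2_def aniso2_def)
  obtain g where g: "g \<in> isoms10" "act2 g e = f0b" "act2 g f = f1b" "act2 g x = xb" using trans_efx[OF assms(1-3)] .
  have "bf f0b (act2 g l) = bf e l" "bf f1b (act2 g l) = bf f l" "bf xb (act2 g l) = bf x l" if "length l = 10" for l
    using act2_bf[OF g(1) len(1) that] act2_bf[OF g(1) len(2) that] act2_bf[OF g(1) len(3) that] unfolding g(2-4) .
  then have "card (aniso2' e f x) = card {y \<in> F2. qf y \<and> \<not> bf f0b y \<and> \<not> bf f1b y \<and> bf xb y}" unfolding aniso2'_def
    by (intro card_act2[OF g(1)]) (simp add: act2_qf[OF g(1)])
  also have "{y \<in> F2. qf y \<and> \<not> bf f0b y \<and> \<not> bf f1b y \<and> bf xb y} = set (filter (bf xb) nonsing_e8)"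
    unfolding set_filter set_nonsing_e8 by auto
  finally show ?thesis unfolding distinct_card[OF distinct_filter[OF distinct_nonsing_e8]] count_pair .
qed

lemma card_Sigma_const:
  assumes "finite A" "\<And>a. a \<in> A \<Longrightarrow> finite (B a)" "\<And>a. a \<in> A \<Longrightarrow> card (B a) = n"
  shows "card (Sigma A B) = card A * n"
  using assms by (subst card_SigmaI) auto

lemma card_frames2: "card frames2 = 2^14 * 3 * 5 * 7 * 17 * 31"
proof -
  have fin: "finite sing2" "finite (hyp2 e)" "finite (aniso2 e f)" "finite (aniso2' e f x)" for e f x
    by (auto simp: sing2_def hyp2_def aniso2_def aniso2'_def)
  have 3: "card (SIGMA x:aniso2 e f. aniso2' e f x) = 120 * 56" if "e \<in> sing2" "f \<in> hyp2 e" for e f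
    using that by (subst card_Sigma_const[where n = 56]) (simp_all add: fin card_aniso2 card_aniso2')
  have 2: "card (SIGMA f:hyp2 e. SIGMA x:aniso2 e f. aniso2' e f x) = 256 * (120 * 56)" if "e \<in> sing2" for e
    using that by (subst card_Sigma_const[where n = "120 * 56"]) (simp_all add: fin card_hyp2 3 del: card_SigmaI)
  have "card frames2 = 527 * (256 * (120 * 56))" unfolding frames2_def
    by (subst card_Sigma_const[where n = "256 * (120 * 56)"]) (simp_all add: fin card_sing2 2 del: card_SigmaI)
  then show ?thesis by simp
qed

lemma countable_L10: "countable L10"
proof -
  let ?f = "\<lambda>(a,b,c,d,e,f,g,h,i,j). vec10 (real_of_int a) (of_int b) (of_int c) (of_int d) (of_int e)
    (of_int f) (of_int g) (of_int h) (of_int i) (of_int j)"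
  have "L10 \<subseteq> range ?f"
  proof
    fix x assume "x \<in> L10"
    then obtain a b c d e f g h i j where "x = vec10 (real_of_int a) (of_int b) (of_int c) (of_int d) (of_int e)
      (of_int f) (of_int g) (of_int h) (of_int i) (of_int j)" by (rule L10_int_coords)
    then have "x = ?f (a,b,c,d,e,f,g,h,i,j)" by simp
    then show "x \<in> range ?f" by blast
  qed
  then show ?thesis by (rule countable_subset) simp
qed

text \<open>As \<open>p\<close> lies on no mirror, each of the countably many roots excludes at most
  one parameter.\<close>

lemma regular_on_ray:
  assumes p: "p \<in> P10_reg" and x: "x \<in> P10" and d: "\<delta> > 0"
  obtains t where "0 < t" "t < \<delta>" "x + t *\<^sub>R p \<in> P10_reg"
proof -
  let ?bad = "(\<lambda>r. - form10 x r / form10 p r) ` roots10"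
  have "countable roots10" by (rule countable_subset[OF _ countable_L10]) (auto simp: roots10_def)
  then have "countable ?bad" by simp
  moreover have "uncountable {0<..<\<delta>}" using d by (simp add: uncountable_open_interval)
  ultimately have "\<not> {0<..<\<delta>} \<subseteq> ?bad" using countable_subset by blast
  then obtain t where "t \<in> {0<..<\<delta>}" and tb: "t \<notin> ?bad" by blast
  then have t: "0 < t" "t < \<delta>" by simp_all
  have "form10 (x + t *\<^sub>R p) r \<noteq> 0" if r: "r \<in> roots10" for r
  proof
    assume "form10 (x + t *\<^sub>R p) r = 0"
    moreover have "form10 p r \<noteq> 0" using p r by (auto simp: P10_reg_def)
    ultimately have "t = - form10 x r / form10 p r" by (simp add: field_simps)
    then show False using tb r by blast
  qed
  moreover have "x + t *\<^sub>R p \<in> P10" using x p t(1) by (auto simp: P10_reg_def intro!: P10_add P10_scale)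
  ultimately have "x + t *\<^sub>R p \<in> P10_reg" by (auto simp: P10_reg_def)
  then show thesis using that t by blast
qed

lemma closure_finite_UN: "finite I \<Longrightarrow> closure (\<Union>i\<in>I. S i) = (\<Union>i\<in>I. closure (S i))"
  by (induction I rule: finite_induct) auto

context petersen_frame
begin

definition D :: "(real^10) set" where
  "D = {x \<in> P10. \<forall>\<alpha>\<in>setA. form10 x (U \<alpha>) \<ge> 0 \<and> form10 x (V \<alpha>) \<ge> 0}"

text \<open>No mirror passes through an open chamber, so testing the single point
  \<open>g weyl10\<close> decides whether the whole chamber lies in the interior of D.\<close>

definition GD :: "(real^10 \<Rightarrow> real^10) set" where
  "GD = {g \<in> isoms10. g weyl10 \<in> D_int}"

text \<open>Indexed by the complement of the triple.\<close>
definition v12 :: "real^10" where "v12 = V {3,4,5}"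
definition v13 :: "real^10" where "v13 = V {2,4,5}"
definition v34 :: "real^10" where "v34 = V {1,2,5}"
definition v35 :: "real^10" where "v35 = V {1,2,4}"

text \<open>In F_2^5 the first two vectors are the weight-4 vectors omitting 5 and omitting 4, a
  hyperbolic pair; \<open>v12\<close> and \<open>v13\<close> span the anisotropic plane orthogonal
  to it. Pulling back by \<open>inv g\<close> makes the marking invariant under left multiplication
  of \<open>g\<close> by \<Gamma>.\<close>

definition marking :: "(real^10 \<Rightarrow> real^10) \<Rightarrow> bool list \<times> bool list \<times> bool list \<times> bool list" where
  "marking g = (red2 (inv g (v12 + v34)), red2 (inv g (v12 + v35)),
     red2 (inv g (v12)), red2 (inv g (v13)))"

lemma A4: "{3,4,5} \<in> setA" "{1,2,5} \<in> setA" "{1,2,4} \<in> setA" "{2,4,5} \<in> setA"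
  by (simp_all add: setA_triples triples_def)

lemma V4_L10: "v12 \<in> L10" "v13 \<in> L10" "v12 + v34 \<in> L10" "v12 + v35 \<in> L10"
  unfolding v12_def v13_def v34_def v35_def by (intro L10_closed(2) V_L10 A4)+

lemma V4_form:
  "form10 (v12) (v12) = -2" "form10 (v13) (v13) = -2" "form10 (v34) (v34) = -2"
  "form10 (v35) (v35) = -2"
  "form10 (v12) (v13) = 1" "form10 (v12) (v34) = 0" "form10 (v12) (v35) = 0"
  "form10 (v13) (v34) = 1" "form10 (v13) (v35) = 1" "form10 (v34) (v35) = 1"
proof -
  have ne: "{3,4,5::nat} \<noteq> {2,4,5}" "{3,4,5::nat} \<noteq> {1,2,5}" "{3,4,5::nat} \<noteq> {1,2,4}" "{2,4,5::nat} \<noteq> {1,2,5}"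
    "{2,4,5::nat} \<noteq> {1,2,4}" "{1,2,5::nat} \<noteq> {1,2,4}" by code_simp+
  have adj: "adj {3,4,5} {2,4,5} = 0" "adj {3,4,5} {1,2,5} = 1" "adj {3,4,5} {1,2,4} = 1" "adj {2,4,5} {1,2,5} = 0"
    "adj {2,4,5} {1,2,4} = 0" "adj {1,2,5} {1,2,4} = 0" by (simp_all add: adj_def)
  show "form10 v12 v12 = -2" "form10 v13 v13 = -2" "form10 v34 v34 = -2" "form10 v35 v35 = -2"
    unfolding v12_def v13_def v34_def v35_def VV[OF A4(1,1)] VV[OF A4(2,2)] VV[OF A4(3,3)] VV[OF A4(4,4)]
      adj_self[OF A4(1)] adj_self[OF A4(2)] adj_self[OF A4(3)] adj_self[OF A4(4)] by simp_all
  show "form10 v12 v13 = 1" "form10 v12 v34 = 0" "form10 v12 v35 = 0" "form10 v13 v34 = 1" "form10 v13 v35 = 1" "form10 v34 v35 = 1"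
    unfolding v12_def v13_def v34_def v35_def VV[OF A4(1,4)] VV[OF A4(1,2)] VV[OF A4(1,3)] VV[OF A4(4,2)] VV[OF A4(4,3)] VV[OF A4(2,3)]
      adj using ne by simp_all
qed

lemma marking_frames2: assumes g: "g \<in> isoms10" shows "marking g \<in> frames2"
proof -
  have ig: "inv g \<in> isoms10" using isoms10_inv[OF g] .
  have q: "qf (red2 (inv g x)) \<longleftrightarrow> odd \<lfloor>form10 x x / 2\<rfloor>" if "x \<in> L10" for x
    using qf_red2[OF isoms10_L10[OF ig that]] isoms10_form[OF ig] by simp
  have b: "bf (red2 (inv g x)) (red2 (inv g y)) \<longleftrightarrow> odd \<lfloor>form10 x y\<rfloor>" if "x \<in> L10" "y \<in> L10" for x y
    using bf_red2[OF isoms10_L10[OF ig that(1)] isoms10_L10[OF ig that(2)]] isoms10_form[OF ig] by simp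
  have z: "\<not> bf zerob l" if "length l = 10" for l
  proof -
    have "lift2 zerob = 0" by (simp add: lift2_def zerob_def vec_eq_10)
    then show ?thesis using that by (simp add: bf_lift2)
  qed
  have fl: "\<lfloor>- 1 :: real\<rfloor> = - 1" by (simp add: floor_eq_iff)
  note comm = form10_commute[of v34 v12] form10_commute[of v35 v12] form10_commute[of v34 v13]
    form10_commute[of v35 v13] form10_commute[of v13 v12]
  let ?e = "red2 (inv g (v12 + v34))" and ?f = "red2 (inv g (v12 + v35))"
  have ef: "bf ?e ?f" by (simp add: b V4_L10 V4_form comm fl)
  then have "?e \<noteq> zerob" using z[of ?f] by auto
  with ef show ?thesis unfolding marking_def frames2_def
    by (simp add: sing2_def hyp2_def aniso2_def aniso2'_def q b V4_L10 V4_form comm fl)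
qed

text \<open>Equal markings put \<open>h \<circ> inv g\<close> into \<Gamma>. It carries one interior
  point of D to another, so \<open>fixV_unique\<close> makes it the identity.\<close>

lemma marking_inj: "inj_on marking GD"
proof (rule inj_onI)
  fix g h assume "g \<in> GD" "h \<in> GD" and e: "marking g = marking h"
  then have g: "g \<in> isoms10" "g weyl10 \<in> D_int" and h: "h \<in> isoms10" "h weyl10 \<in> D_int" by (auto simp: GD_def)
  define k where "k = h \<circ> inv g"
  have k: "k \<in> isoms10" using isoms10_comp[OF h(1) isoms10_inv[OF g(1)]] by (simp add: k_def)
  have l: "linear k" using isoms10_linear[OF k] .
  have c: "cong2 (k x) x" if x: "x \<in> L10" and r: "red2 (inv g x) = red2 (inv h x)" for x
  proof -
    have "cong2 (inv g x) (inv h x)"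
      using red2_eq_iff_cong2[OF isoms10_L10[OF isoms10_inv[OF g(1)] x] isoms10_L10[OF isoms10_inv[OF h(1)] x]] r by blast
    then have "cong2 (h (inv g x)) (h (inv h x))" by (rule cong2_image[OF h(1)])
    then show ?thesis using isoms10_inv_apply(2)[OF h(1)] by (simp add: k_def)
  qed
  have c3: "cong2 (k (v12)) (v12)" and c4: "cong2 (k (v13)) (v13)"
    and c1: "cong2 (k (v12 + v34)) (v12 + v34)"
    and c2: "cong2 (k (v12 + v35)) (v12 + v35)"
    using e by (simp_all add: marking_def c V4_L10)
  have c5: "cong2 (k (v34)) (v34)" using cong2_diff[OF c1 c3] by (simp add: linear_add[OF l])
  have c6: "cong2 (k (v35)) (v35)" using cong2_diff[OF c2 c3] by (simp add: linear_add[OF l])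
  have "fixV k" using fixV_from_four[OF k] c3 c4 c5 c6 unfolding v12_def v13_def v34_def v35_def by blast
  moreover have "k (g weyl10) = h weyl10" using isoms10_inv_apply(1)[OF g(1)] by (simp add: k_def)
  ultimately have "k = id" using fixV_unique g(2) h(2) by metis
  then have "h (inv g (g x)) = g x" for x by (metis comp_apply id_apply k_def)
  then show "g = h" using isoms10_inv_apply(1)[OF g(1)] by (auto simp: fun_eq_iff)
qed

text \<open>Transitivity gives an isometry \<open>k\<close> carrying the frame of the
  \<open>V\<close> to \<open>t\<close>. Its inverse may place \<open>weyl10\<close> outside D;
  correcting by an element of \<Gamma> brings it in and leaves the marking unchanged.\<close>

lemma marking_surj:
  assumes t: "t \<in> frames2" shows "t \<in> marking ` GD"
proof -
  obtain e f x y where t': "t = (e,f,x,y)" "e \<in> sing2" "f \<in> hyp2 e" "x \<in> aniso2 e f" "y \<in> aniso2' e f x"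
    using t by (auto simp: frames2_def)
  then have len: "length e = 10" "length f = 10" "length x = 10" "length y = 10"
    by (auto simp: sing2_def hyp2_def aniso2_def aniso2'_def)
  obtain b where b: "b \<in> isoms10" "act2 b e = f0b" "act2 b f = f1b" "act2 b x = xb" "act2 b y = yb"
    using trans_efxy t' by blast
  let ?X1 = "v12 + v34" and ?X2 = "v12 + v35" and ?X3 = "v12" and ?X4 = "v13"
  have "marking id \<in> frames2" using marking_frames2[OF isoms10_id] .
  then have m: "red2 ?X1 \<in> sing2" "red2 ?X2 \<in> hyp2 (red2 ?X1)" "red2 ?X3 \<in> aniso2 (red2 ?X1) (red2 ?X2)"
    "red2 ?X4 \<in> aniso2' (red2 ?X1) (red2 ?X2) (red2 ?X3)" by (simp_all add: marking_def frames2_def)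
  obtain a where a: "a \<in> isoms10" "act2 a (red2 ?X1) = f0b" "act2 a (red2 ?X2) = f1b" "act2 a (red2 ?X3) = xb" "act2 a (red2 ?X4) = yb"
    using trans_efxy[OF m] by blast
  define k where "k = inv b \<circ> a"
  have k: "k \<in> isoms10" using isoms10_comp[OF isoms10_inv[OF b(1)] a(1)] by (simp add: k_def)
  have act: "act2 k (red2 X) = act2 (inv b) (act2 a (red2 X))" for X
    unfolding k_def by (rule act2_comp[OF isoms10_inv[OF b(1)] a(1)])
  have kX: "red2 (k ?X1) = e" "red2 (k ?X2) = f" "red2 (k ?X3) = x" "red2 (k ?X4) = y"
  proof -
    have r: "red2 (k X) = act2 (inv b) (act2 a (red2 X))" if "X \<in> L10" for X using act2_red2[OF k that] act by simp
    have i: "act2 (inv b) (act2 b l) = l" if "length l = 10" for l using act2_inv(2)[OF b(1) that] .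
    show "red2 (k ?X1) = e" "red2 (k ?X2) = f" "red2 (k ?X3) = x" "red2 (k ?X4) = y"
      unfolding r[OF V4_L10(3)] r[OF V4_L10(4)] r[OF V4_L10(1)] r[OF V4_L10(2)] a(2-5) b(2-5)[symmetric]
      by (rule i, rule len)+
  qed
  define g0 where "g0 = inv k"
  have g0: "g0 \<in> isoms10" using isoms10_inv[OF k] by (simp add: g0_def)
  have "g0 weyl10 \<in> P10_reg" using open_chamber_nonempty[OF g0] open_chamber_regular[OF g0] by blast
  then obtain h where h: "fixV h" "h (g0 weyl10) \<in> D_int" using fixV_descent by blast
  have hi: "h \<in> isoms10" using h(1) by (simp add: fixV_def)
  define g where "g = h \<circ> g0"
  have g: "g \<in> isoms10" using isoms10_comp[OF hi g0] by (simp add: g_def)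
  have "g \<in> GD" using g h(2) by (simp add: GD_def g_def)
  moreover have "marking g = t"
  proof -
    have ig: "inv g X = k (inv h X)" for X
    proof -
      have "g (k (inv h X)) = X" using isoms10_inv_apply[OF k] isoms10_inv_apply[OF hi] by (simp add: g_def g0_def)
      then show ?thesis using isoms10_inv_apply(1)[OF g, of "k (inv h X)"] by simp
    qed
    have ih: "fixV (inv h)" using fixV_inv[OF h(1)] .
    have l: "linear (inv h)" using isoms10_linear[OF isoms10_inv[OF hi]] .
    have cV: "cong2 (inv h v12) v12" "cong2 (inv h v13) v13" "cong2 (inv h v34) v34" "cong2 (inv h v35) v35"
      using ih A4 unfolding v12_def v13_def v34_def v35_def fixV_def by blast+
    have r: "red2 (inv g X) = red2 (k X)" if "X \<in> L10" "cong2 (inv h X) X" for X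
    proof -
      have L: "k (inv h X) \<in> L10" "k X \<in> L10" using isoms10_L10[OF k] isoms10_L10[OF isoms10_inv[OF hi]] that(1) by auto
      show ?thesis unfolding ig using red2_eq_iff_cong2[OF L] cong2_image[OF k that(2)] by blast
    qed
    have "cong2 (inv h ?X1) ?X1" "cong2 (inv h ?X2) ?X2"
      unfolding linear_add[OF l] by (intro cong2_add cV)+
    then show ?thesis unfolding marking_def t'(1) using r V4_L10 cV kX by simp
  qed
  ultimately show ?thesis by blast
qed

lemma card_GD: "card GD = 2^14 * 3 * 5 * 7 * 17 * 31"
proof -
  have "marking ` GD = frames2" using marking_surj marking_frames2 by (auto simp: GD_def)
  then have "bij_betw marking GD frames2" using marking_inj by (simp add: bij_betw_def)
  then show ?thesis unfolding card_frames2[symmetric] by (rule bij_betw_same_card)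
qed

text \<open>Infinite sets have \<open>card\<close> 0, so the positive count already yields
  finiteness.\<close>

lemma finite_GD: "finite GD" using card_GD by (intro card_ge_0_finite) simp

lemma open_chamber_D_int:
  assumes g: "g \<in> isoms10" and x: "x \<in> open_chamber g" "x \<in> D_int" and y: "y \<in> open_chamber g"
  shows "y \<in> D_int"
  using x y open_chamber_root_sign(2)[OF g _ x(1) y] U_roots V_roots by (auto simp: D_int_def open_chamber_def)

lemma closed_D: "closed {x. \<forall>\<alpha>\<in>setA. form10 x (U \<alpha>) \<ge> 0 \<and> form10 x (V \<alpha>) \<ge> 0}"
  unfolding Collect_ball_eq by (intro closed_INT ballI closed_Collect_conj closed_Collect_le continuous_intros)

text \<open>A point of D, possibly on a wall, is a limit of regular interior points along a ray, and
  those lie in chambers indexed by \<open>GD\<close>. Finiteness lets the closure pass through the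
  union.\<close>

lemma D_union: "\<Union>(closed_chamber ` GD) = D"
proof
  show "\<Union>(closed_chamber ` GD) \<subseteq> D"
  proof
    fix x assume "x \<in> \<Union>(closed_chamber ` GD)"
    then obtain g where g: "g \<in> isoms10" "g weyl10 \<in> D_int" "x \<in> closed_chamber g" by (auto simp: GD_def)
    have "open_chamber g \<subseteq> D_int" using open_chamber_D_int[OF g(1) open_chamber_nonempty[OF g(1)] g(2)] by blast
    then have "open_chamber g \<subseteq> {x. \<forall>\<alpha>\<in>setA. form10 x (U \<alpha>) \<ge> 0 \<and> form10 x (V \<alpha>) \<ge> 0}"
      by (auto simp: D_int_def less_imp_le)
    then have "closure (open_chamber g) \<subseteq> {x. \<forall>\<alpha>\<in>setA. form10 x (U \<alpha>) \<ge> 0 \<and> form10 x (V \<alpha>) \<ge> 0}"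
      by (rule closure_minimal[OF _ closed_D])
    then show "x \<in> D" using g(3) closure_open_chamber[OF g(1)] by (auto simp: D_def)
  qed
  show "D \<subseteq> \<Union>(closed_chamber ` GD)"
  proof
    fix x assume x: "x \<in> D"
    then have xP: "x \<in> P10" by (simp add: D_def)
    have "GD \<noteq> {}" using card_GD by auto
    then obtain g1 where g1: "g1 \<in> isoms10" "g1 weyl10 \<in> D_int" by (auto simp: GD_def)
    define p where "p = g1 weyl10"
    have p: "p \<in> P10_reg" "p \<in> D_int"
      using open_chamber_nonempty[OF g1(1)] open_chamber_regular[OF g1(1)] g1(2) by (auto simp: p_def)
    have "x \<in> closure (\<Union>g\<in>GD. open_chamber g)"
    proof (rule limit_in_closure[of x p])
      fix \<delta> :: real assume "\<delta> > 0"
      then obtain t where t: "0 < t" "t < \<delta>" "x + t *\<^sub>R p \<in> P10_reg" using regular_on_ray[OF p(1) xP] by blast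
      have yD: "x + t *\<^sub>R p \<in> D_int"
        using x p(2) t(1) t(3) by (auto simp: D_def D_int_def P10_reg_def intro!: add_nonneg_pos)
      obtain g where g: "g \<in> isoms10" "x + t *\<^sub>R p \<in> open_chamber g" using regular_in_open_chamber[OF t(3)] .
      then have "g weyl10 \<in> D_int" using open_chamber_D_int[OF g(1) g(2) yD open_chamber_nonempty[OF g(1)]] by simp
      then have "g \<in> GD" using g(1) by (simp add: GD_def)
      then show "\<exists>t. 0 < t \<and> t < \<delta> \<and> x + t *\<^sub>R p \<in> (\<Union>g\<in>GD. open_chamber g)" using t g(2) by blast
    qed
    also have "closure (\<Union>g\<in>GD. open_chamber g) = (\<Union>g\<in>GD. closure (open_chamber g))"
      using finite_GD by (rule closure_finite_UN)
    finally obtain g where "g \<in> GD" "x \<in> closure (open_chamber g)" by blast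
    then have "x \<in> closed_chamber g" using closure_open_chamber[of g] xP by (auto simp: GD_def)
    then show "x \<in> \<Union>(closed_chamber ` GD)" using \<open>g \<in> GD\<close> by blast
  qed
qed

lemma D_vinberg_chambers:
  "\<exists>\<C>. finite \<C> \<and> (\<forall>C\<in>\<C>. vinberg_chamber C) \<and> card \<C> = 2^14 * 3 * 5 * 7 * 17 * 31 \<and> \<Union>\<C> = D"
proof (intro exI conjI)
  show "finite (closed_chamber ` GD)" using finite_GD by simp
  show "\<forall>C\<in>closed_chamber ` GD. vinberg_chamber C" using vinberg_chamber_closed_chamber by (auto simp: GD_def)
  have "inj_on closed_chamber GD" using closed_chamber_inj by (auto simp: inj_on_def GD_def)
  then show "card (closed_chamber ` GD) = 2^14 * 3 * 5 * 7 * 17 * 31" unfolding card_GD[symmetric] by (rule card_image)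
  show "\<Union>(closed_chamber ` GD) = D" by (rule D_union)
qed

end

section \<open>The lattice of the Enriques surface\<close>

lemma triples_compl: "\<forall>\<alpha>\<in>set triples. \<forall>\<beta>\<in>set triples. ({1,2,3,4,5} - \<beta> \<subseteq> \<alpha>) = (card (\<alpha> \<inter> \<beta>) = 1)"
  by code_simp

lemma triples_common: "\<forall>\<alpha>\<in>set triples. \<forall>\<gamma>\<in>set triples.
   length (filter (\<lambda>\<beta>. card (\<alpha> \<inter> \<beta>) = 1 \<and> card (\<beta> \<inter> \<gamma>) = 1) triples) = (if \<alpha> = \<gamma> then 3 else if card (\<alpha> \<inter> \<gamma>) = 1 then 0 else 1)"
  by code_simp

text \<open>The six triples meeting \<alpha> in two points form a hexagon of the Petersen graph. For
  \<open>l\<close> outside \<alpha>, membership of \<open>l\<close> alternates around it, and the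
  signs form an eigenvector for -2.\<close>

definition hexsign :: "nat \<Rightarrow> nat set \<Rightarrow> nat set \<Rightarrow> int" where
  "hexsign l \<alpha> \<beta> = (if card (\<alpha> \<inter> \<beta>) = 2 then if l \<in> \<beta> then 1 else -1 else 0)"

lemma triples_hexagon: "\<forall>l\<in>set [1,2,3,4,5]. \<forall>\<alpha>\<in>set triples. l \<notin> \<alpha> \<longrightarrow> (\<forall>\<gamma>\<in>set triples.
   sum_list (map (\<lambda>\<beta>. if card (\<beta> \<inter> \<gamma>) = 1 then hexsign l \<alpha> \<beta> else 0) triples) = - 2 * hexsign l \<alpha> \<gamma>)"
  by code_simp

text \<open>Strong regularity of the Petersen graph: adjacent vertices have no common neighbour,
  distinct non-adjacent ones exactly one.\<close>

lemma adj_square: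
  assumes "\<alpha> \<in> setA" "\<gamma> \<in> setA"
  shows "(\<Sum>\<beta>\<in>setA. adj \<alpha> \<beta> * adj \<beta> \<gamma>) = 1 - adj \<alpha> \<gamma> + (if \<alpha> = \<gamma> then 2 else 0)"
proof -
  have "(\<Sum>\<beta>\<in>setA. adj \<alpha> \<beta> * adj \<beta> \<gamma>) = (\<Sum>\<beta>\<in>setA. if card (\<alpha> \<inter> \<beta>) = 1 \<and> card (\<beta> \<inter> \<gamma>) = 1 then 1 else 0)"
    by (intro sum.cong) (auto simp: adj_def)
  also have "\<dots> = real (length (filter (\<lambda>\<beta>. card (\<alpha> \<inter> \<beta>) = 1 \<and> card (\<beta> \<inter> \<gamma>) = 1) triples))"
    unfolding setA_triples sum.distinct_set_conv_list[OF triples_distinct]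
    by (simp add: sum_list_map_filter'[symmetric] sum_list_triv)
  also have "\<dots> = 1 - adj \<alpha> \<gamma> + (if \<alpha> = \<gamma> then 2 else 0)"
    using bspec[OF bspec[OF triples_common] ] assms setA_inter_card[OF assms] unfolding setA_triples by (auto simp: adj_def)
  finally show ?thesis .
qed

lemma compl5_setB: "\<alpha> \<in> setA \<Longrightarrow> compl5 \<alpha> \<in> setB"
  by (auto simp: setA_def setB_def compl5_def five_def card_Diff_subset finite_subset[of _ "{1..5}"])

lemma compl5_compl5: "S \<subseteq> five \<Longrightarrow> compl5 (compl5 S) = S"
  by (auto simp: compl5_def)

lemma setB_compl5: "setB = compl5 ` setA"
proof
  show "setB \<subseteq> compl5 ` setA"
  proof
    fix S assume S: "S \<in> setB"
    then have "compl5 S \<in> setA"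
      by (auto simp: setA_def setB_def compl5_def five_def card_Diff_subset finite_subset[of _ "{1..5}"])
    moreover have "S = compl5 (compl5 S)" using S compl5_compl5 by (auto simp: setB_def)
    ultimately show "S \<in> compl5 ` setA" by blast
  qed
qed (use compl5_setB in auto)

lemma inj_compl5: "inj_on compl5 setA"
  by (rule inj_on_inverseI[of _ compl5]) (auto simp: compl5_compl5 setA_def)

lemma setA_setB_disjoint: "setA \<inter> setB = {}" by (auto simp: setA_def setB_def)

lemma sum_gens: "(\<Sum>S\<in>gens. f S) = (\<Sum>\<alpha>\<in>setA. f \<alpha>) + (\<Sum>\<alpha>\<in>setA. f (compl5 \<alpha>))" for f :: "nat set \<Rightarrow> real"
proof -
  have "(\<Sum>S\<in>gens. f S) = (\<Sum>\<alpha>\<in>setA. f \<alpha>) + (\<Sum>S\<in>setB. f S)"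
    unfolding gens_def by (rule sum.union_disjoint) (auto simp: setB_compl5 setA_setB_disjoint[unfolded setB_compl5])
  then show ?thesis unfolding setB_compl5 by (simp add: sum.reindex[OF inj_compl5])
qed

text \<open>With lines indexed by complementary triples, the incidence of nodes and lines is the
  Petersen matrix A, and the Gram matrix has blocks -2I and A.\<close>

lemma gX_values:
  assumes a: "\<alpha> \<in> setA" and b: "\<beta> \<in> setA"
  shows "gX \<alpha> \<beta> = (if \<alpha> = \<beta> then -2 else 0)" "gX (compl5 \<alpha>) (compl5 \<beta>) = (if \<alpha> = \<beta> then -2 else 0)"
    "gX \<alpha> (compl5 \<beta>) = adj \<alpha> \<beta>" "gX (compl5 \<alpha>) \<beta> = adj \<alpha> \<beta>"
proof -
  have nB: "\<alpha> \<notin> setB" "\<beta> \<notin> setB" using a b setA_setB_disjoint by auto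
  have nA: "compl5 \<alpha> \<notin> setA" "compl5 \<beta> \<notin> setA" using compl5_setB[OF a] compl5_setB[OF b] setA_setB_disjoint by auto
  have eq: "compl5 \<alpha> = compl5 \<beta> \<longleftrightarrow> \<alpha> = \<beta>" using inj_compl5 a b by (auto simp: inj_on_def)
  have five: "five = {1,2,3,4,5}" by (rule five_eq)
  have sub: "compl5 \<beta> \<subseteq> \<alpha> \<longleftrightarrow> card (\<alpha> \<inter> \<beta>) = 1" "compl5 \<alpha> \<subseteq> \<beta> \<longleftrightarrow> card (\<alpha> \<inter> \<beta>) = 1"
    using bspec[OF bspec[OF triples_compl]] a b unfolding compl5_def five setA_triples by (auto simp: Int_commute)
  have ne: "\<alpha> \<noteq> compl5 \<beta>" "compl5 \<alpha> \<noteq> \<beta>" using nA a b by auto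
  show "gX \<alpha> \<beta> = (if \<alpha> = \<beta> then -2 else 0)" "gX (compl5 \<alpha>) (compl5 \<beta>) = (if \<alpha> = \<beta> then -2 else 0)"
    "gX \<alpha> (compl5 \<beta>) = adj \<alpha> \<beta>" "gX (compl5 \<alpha>) \<beta> = adj \<alpha> \<beta>"
    using nB nA eq sub ne a b compl5_setB[OF a] compl5_setB[OF b] by (simp_all add: gX_def adj_def)
qed

lemma pistar_values:
  assumes "\<alpha> \<in> setA" shows "pistar a \<alpha> = a \<alpha>" "pistar a (compl5 \<alpha>) = a \<alpha>"
proof -
  have "compl5 \<alpha> \<notin> setA" "compl5 \<alpha> \<in> setB" "compl5 (compl5 \<alpha>) = \<alpha>"
    using compl5_setB[OF assms] setA_setB_disjoint compl5_compl5 assms by (auto simp: setA_def)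
  then show "pistar a \<alpha> = a \<alpha>" "pistar a (compl5 \<alpha>) = a \<alpha>" using assms by (simp_all add: pistar_def)
qed

lemma sum_gX:
  assumes b: "\<beta> \<in> setA"
  shows "(\<Sum>S\<in>gens. f S * gX S \<beta>) = (\<Sum>\<alpha>\<in>setA. f (compl5 \<alpha>) * adj \<alpha> \<beta>) - 2 * f \<beta>"
    "(\<Sum>S\<in>gens. f S * gX S (compl5 \<beta>)) = (\<Sum>\<alpha>\<in>setA. f \<alpha> * adj \<alpha> \<beta>) - 2 * f (compl5 \<beta>)"
proof -
  have 1: "(\<Sum>\<alpha>\<in>setA. f \<alpha> * gX \<alpha> \<beta>) = (\<Sum>\<alpha>\<in>setA. if \<alpha> = \<beta> then - 2 * f \<alpha> else 0)"
    by (rule sum.cong[OF refl]) (simp add: gX_values b)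
  have 2: "(\<Sum>\<alpha>\<in>setA. f (compl5 \<alpha>) * gX (compl5 \<alpha>) (compl5 \<beta>)) = (\<Sum>\<alpha>\<in>setA. if \<alpha> = \<beta> then - 2 * f (compl5 \<alpha>) else 0)"
    by (rule sum.cong[OF refl]) (simp add: gX_values b)
  have 3: "(\<Sum>\<alpha>\<in>setA. f (compl5 \<alpha>) * gX (compl5 \<alpha>) \<beta>) = (\<Sum>\<alpha>\<in>setA. f (compl5 \<alpha>) * adj \<alpha> \<beta>)"
    by (rule sum.cong[OF refl]) (simp add: gX_values b)
  have 4: "(\<Sum>\<alpha>\<in>setA. f \<alpha> * gX \<alpha> (compl5 \<beta>)) = (\<Sum>\<alpha>\<in>setA. f \<alpha> * adj \<alpha> \<beta>)"
    by (rule sum.cong[OF refl]) (simp add: gX_values b)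
  show "(\<Sum>S\<in>gens. f S * gX S \<beta>) = (\<Sum>\<alpha>\<in>setA. f (compl5 \<alpha>) * adj \<alpha> \<beta>) - 2 * f \<beta>"
    "(\<Sum>S\<in>gens. f S * gX S (compl5 \<beta>)) = (\<Sum>\<alpha>\<in>setA. f \<alpha> * adj \<alpha> \<beta>) - 2 * f (compl5 \<beta>)"
    unfolding sum_gens 1 2 3 4 using b by simp_all
qed

lemma formY_eq: "formY a b = (\<Sum>\<beta>\<in>setA. ((\<Sum>\<alpha>\<in>setA. a \<alpha> * adj \<alpha> \<beta>) - 2 * a \<beta>) * b \<beta>)"
proof -
  have "formX (pistar a) (pistar b) = (\<Sum>T\<in>gens. (\<Sum>S\<in>gens. pistar a S * gX S T) * pistar b T)"
    unfolding formX_def by (subst sum.swap) (simp add: sum_distrib_right)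
  also have "\<dots> = (\<Sum>\<beta>\<in>setA. ((\<Sum>\<alpha>\<in>setA. a \<alpha> * adj \<alpha> \<beta>) - 2 * a \<beta>) * b \<beta>) + (\<Sum>\<beta>\<in>setA. ((\<Sum>\<alpha>\<in>setA. a \<alpha> * adj \<alpha> \<beta>) - 2 * a \<beta>) * b \<beta>)"
    unfolding sum_gens[of "\<lambda>T. (\<Sum>S\<in>gens. pistar a S * gX S T) * pistar b T"]
    by (intro arg_cong2[of _ _ _ _ "(+)"] sum.cong refl) (simp_all add: sum_gX pistar_values)
  finally show ?thesis by (simp add: formY_def)
qed

text \<open>The equations say that (a - dE, a - dL) lies in the kernel of the Gram matrix. As 2 is
  not an eigenvalue of A, the kernel consists of the pairs (c, -c) with Ac = -2c; this is how
  half-integral \<open>a\<close> can represent classes in S_Y.\<close>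

lemma inSX_pistar:
  "inSX (pistar a) \<longleftrightarrow> (\<exists>dE dL. (\<forall>\<beta>\<in>setA. dE \<beta> \<in> \<int> \<and> dL \<beta> \<in> \<int>) \<and>
     (\<forall>\<beta>\<in>setA. (\<Sum>\<alpha>\<in>setA. (a \<alpha> - dL \<alpha>) * adj \<alpha> \<beta>) = 2 * (a \<beta> - dE \<beta>) \<and>
       (\<Sum>\<alpha>\<in>setA. (a \<alpha> - dE \<alpha>) * adj \<alpha> \<beta>) = 2 * (a \<beta> - dL \<beta>)))" (is "_ \<longleftrightarrow> (\<exists>dE dL. ?P dE dL)")
proof
  have key: "(\<forall>T\<in>gens. (\<Sum>S\<in>gens. (pistar a S - d S) * gX S T) = 0) \<longleftrightarrow>
    (\<forall>\<beta>\<in>setA. (\<Sum>\<alpha>\<in>setA. (a \<alpha> - d (compl5 \<alpha>)) * adj \<alpha> \<beta>) = 2 * (a \<beta> - d \<beta>) \<and>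
       (\<Sum>\<alpha>\<in>setA. (a \<alpha> - d \<alpha>) * adj \<alpha> \<beta>) = 2 * (a \<beta> - d (compl5 \<beta>)))" for d
  proof -
    have g: "(\<forall>T\<in>gens. Q T) \<longleftrightarrow> (\<forall>\<beta>\<in>setA. Q \<beta> \<and> Q (compl5 \<beta>))" for Q by (auto simp: gens_def setB_compl5)
    have k: "(\<Sum>S\<in>gens. (pistar a S - d S) * gX S \<beta>) = (\<Sum>\<alpha>\<in>setA. (a \<alpha> - d (compl5 \<alpha>)) * adj \<alpha> \<beta>) - 2 * (a \<beta> - d \<beta>)"
      "(\<Sum>S\<in>gens. (pistar a S - d S) * gX S (compl5 \<beta>)) = (\<Sum>\<alpha>\<in>setA. (a \<alpha> - d \<alpha>) * adj \<alpha> \<beta>) - 2 * (a \<beta> - d (compl5 \<beta>))"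
      if "\<beta> \<in> setA" for \<beta>
      using that by (simp_all add: sum_gX[of \<beta> "\<lambda>S. pistar a S - d S"] pistar_values cong: sum.cong)
    show ?thesis unfolding g by (intro ball_cong refl) (simp only: k right_minus_eq)
  qed
  {
    assume "inSX (pistar a)"
    then obtain d where d: "\<forall>S\<in>gens. d S \<in> \<int>" "\<forall>T\<in>gens. (\<Sum>S\<in>gens. (pistar a S - d S) * gX S T) = 0"
      unfolding inSX_def by blast
    have "\<forall>\<beta>\<in>setA. d \<beta> \<in> \<int> \<and> d (compl5 \<beta>) \<in> \<int>"
      using d(1) by (intro ballI conjI; elim bspec) (simp_all add: gens_def compl5_setB)
    then have "?P d (\<lambda>\<alpha>. d (compl5 \<alpha>))" using iffD1[OF key d(2)] by (rule conjI)
    then show "\<exists>dE dL. ?P dE dL" by (intro exI)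
  next
    assume "\<exists>dE dL. ?P dE dL"
    then obtain dE dL where P: "?P dE dL" by (elim exE)
    define d where "d S = (if S \<in> setA then dE S else dL (compl5 S))" for S
    have d: "d \<alpha> = dE \<alpha>" "d (compl5 \<alpha>) = dL \<alpha>" if "\<alpha> \<in> setA" for \<alpha>
    proof -
      have "compl5 \<alpha> \<notin> setA" "compl5 (compl5 \<alpha>) = \<alpha>"
        using compl5_setB[OF that] setA_setB_disjoint compl5_compl5 that by (auto simp: setA_def)
      then show "d \<alpha> = dE \<alpha>" "d (compl5 \<alpha>) = dL \<alpha>" using that by (simp_all add: d_def)
    qed
    have "\<forall>S\<in>gens. d S \<in> \<int>" unfolding gens_def setB_compl5 using conjunct1[OF P] d by auto
    moreover have "\<forall>T\<in>gens. (\<Sum>S\<in>gens. (pistar a S - d S) * gX S T) = 0"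
    proof (rule iffD2[OF key], rule ballI)
      fix \<beta> assume b: "\<beta> \<in> setA"
      have "(\<Sum>\<alpha>\<in>setA. (a \<alpha> - d (compl5 \<alpha>)) * adj \<alpha> \<beta>) = (\<Sum>\<alpha>\<in>setA. (a \<alpha> - dL \<alpha>) * adj \<alpha> \<beta>)"
        "(\<Sum>\<alpha>\<in>setA. (a \<alpha> - d \<alpha>) * adj \<alpha> \<beta>) = (\<Sum>\<alpha>\<in>setA. (a \<alpha> - dE \<alpha>) * adj \<alpha> \<beta>)"
        by (simp_all add: d cong: sum.cong)
      then show "(\<Sum>\<alpha>\<in>setA. (a \<alpha> - d (compl5 \<alpha>)) * adj \<alpha> \<beta>) = 2 * (a \<beta> - d \<beta>) \<and>
         (\<Sum>\<alpha>\<in>setA. (a \<alpha> - d \<alpha>) * adj \<alpha> \<beta>) = 2 * (a \<beta> - d (compl5 \<beta>))"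
        using bspec[OF conjunct2[OF P] b] d[OF b] by simp
    qed
    ultimately show "inSX (pistar a)" unfolding inSX_def by blast
  }
qed

text \<open>The explicit form of \<open>vbar\<close>: the Gram matrix A - 2I of the
  \<open>ubar\<close> has inverse (J - A - 3I)/4, and the functional to be represented is twice a
  coordinate.\<close>

definition vb :: "nat set \<Rightarrow> nat set \<Rightarrow> real" where
  "vb \<alpha> = (\<lambda>\<beta>. if \<beta> \<in> setA then (1 - adj \<alpha> \<beta> - (if \<alpha> = \<beta> then 3 else 0)) / 2 else 0)"

lemma vb_VY: "vb \<alpha> \<in> VY" by (simp add: VY_def vb_def)

lemma ubar_VY: "\<alpha> \<in> setA \<Longrightarrow> ubar \<alpha> \<in> VY" by (auto simp: VY_def ubar_def)

lemma ubar_SY: "\<alpha> \<in> setA \<Longrightarrow> ubar \<alpha> \<in> SY"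
  using ubar_VY[of \<alpha>] unfolding SY_def mem_Collect_eq inSX_pistar
  by (intro conjI exI[of _ "ubar \<alpha>"]) (auto simp: ubar_def)

text \<open>Up to \<open>- ubar \<alpha>\<close>, the vector \<open>vb \<alpha>\<close> is half of a hexagon in the Petersen graph; on \<open>X\<close> the hexagon
  splits into two numerically equivalent fibres of an elliptic fibration.\<close>
lemma vb_SY: assumes a: "\<alpha> \<in> setA" shows "vb \<alpha> \<in> SY"
proof -
  have "\<alpha> \<noteq> five" using a by (auto simp: setA_def five_def)
  then obtain l where l: "l \<in> five" "l \<notin> \<alpha>" using a by (auto simp: setA_def)
  define s where "s \<beta> = real_of_int (hexsign l \<alpha> \<beta>)" for \<beta>
  have hex: "(\<Sum>\<beta>\<in>setA. s \<beta> * adj \<beta> \<gamma>) = - 2 * s \<gamma>" if g: "\<gamma> \<in> setA" for \<gamma>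
  proof -
    have "(\<Sum>\<beta>\<in>setA. s \<beta> * adj \<beta> \<gamma>) = (\<Sum>\<beta>\<in>setA. of_int (if card (\<beta> \<inter> \<gamma>) = 1 then hexsign l \<alpha> \<beta> else 0))"
      by (intro sum.cong) (auto simp: s_def adj_def)
    also have "\<dots> = of_int (sum_list (map (\<lambda>\<beta>. if card (\<beta> \<inter> \<gamma>) = 1 then hexsign l \<alpha> \<beta> else 0) triples))"
      unfolding of_int_sum[symmetric] setA_triples sum.distinct_set_conv_list[OF triples_distinct] ..
    also have "sum_list (map (\<lambda>\<beta>. if card (\<beta> \<inter> \<gamma>) = 1 then hexsign l \<alpha> \<beta> else 0) triples) = - 2 * hexsign l \<alpha> \<gamma>"
    proof -
      have "l \<in> set [1,2,3,4,5]" using l(1) by (simp add: five_eq)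
      then show ?thesis using bspec[OF mp[OF bspec[OF bspec[OF triples_hexagon]] l(2)]] a g unfolding setA_triples by blast
    qed
    finally show ?thesis by (simp add: s_def)
  qed
  \<comment> \<open>Besides -1 at \<alpha>, \<open>dE\<close> and \<open>dL\<close> are the two
    alternating halves of the hexagon. Their deviations from \<open>vb\<close> are opposite halves
    of the eigenvector \<open>s\<close>, hence a kernel element.\<close>
  define dE where "dE \<beta> = (if \<beta> = \<alpha> then -1 else if card (\<alpha> \<inter> \<beta>) = 2 \<and> l \<in> \<beta> then 1 else 0 :: real)" for \<beta>
  define dL where "dL \<beta> = (if \<beta> = \<alpha> then -1 else if card (\<alpha> \<inter> \<beta>) = 2 \<and> l \<notin> \<beta> then 1 else 0 :: real)" for \<beta>
  have diff: "vb \<alpha> \<beta> - dE \<beta> = - s \<beta> / 2" "vb \<alpha> \<beta> - dL \<beta> = s \<beta> / 2" if "\<beta> \<in> setA" for \<beta>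
    using setA_inter_card[OF a that] that a
    by (auto simp: vb_def dE_def dL_def s_def hexsign_def adj_def split: if_splits)
  have "(\<Sum>\<beta>\<in>setA. (vb \<alpha> \<beta> - dL \<beta>) * adj \<beta> \<gamma>) = 2 * (vb \<alpha> \<gamma> - dE \<gamma>)"
    "(\<Sum>\<beta>\<in>setA. (vb \<alpha> \<beta> - dE \<beta>) * adj \<beta> \<gamma>) = 2 * (vb \<alpha> \<gamma> - dL \<gamma>)" if g: "\<gamma> \<in> setA" for \<gamma>
    using hex[OF g] by (simp_all add: diff g sum_negf flip: sum_divide_distrib cong: sum.cong)
  then have "inSX (pistar (vb \<alpha>))" unfolding inSX_pistar
    by (intro exI[of _ dE] exI[of _ dL]) (simp add: dE_def dL_def)
  then show ?thesis using vb_VY by (simp add: SY_def)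
qed

lemma formY_vb: assumes a: "\<alpha> \<in> setA" shows "formY (vb \<alpha>) y = 2 * y \<alpha>"
proof -
  have "(\<Sum>\<beta>\<in>setA. vb \<alpha> \<beta> * adj \<beta> \<gamma>) - 2 * vb \<alpha> \<gamma> = (if \<gamma> = \<alpha> then 2 else 0)" if g: "\<gamma> \<in> setA" for \<gamma>
  proof -
    have "(\<Sum>\<beta>\<in>setA. vb \<alpha> \<beta> * adj \<beta> \<gamma>) = (\<Sum>\<beta>\<in>setA. (adj \<beta> \<gamma> - adj \<alpha> \<beta> * adj \<beta> \<gamma> - (if \<beta> = \<alpha> then 3 * adj \<beta> \<gamma> else 0)) / 2)"
      by (intro sum.cong) (auto simp: vb_def algebra_simps diff_divide_distrib)
    also have "\<dots> = (3 - (1 - adj \<alpha> \<gamma> + (if \<alpha> = \<gamma> then 2 else 0)) - 3 * adj \<alpha> \<gamma>) / 2"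
      using a g by (simp add: sum_subtractf adj_row adj_square flip: sum_divide_distrib)
    finally have S: "(\<Sum>\<beta>\<in>setA. vb \<alpha> \<beta> * adj \<beta> \<gamma>) = (3 - (1 - adj \<alpha> \<gamma> + (if \<alpha> = \<gamma> then 2 else 0)) - 3 * adj \<alpha> \<gamma>) / 2" .
    have vg: "vb \<alpha> \<gamma> = (1 - adj \<alpha> \<gamma> - (if \<alpha> = \<gamma> then 3 else 0)) / 2" using g by (simp add: vb_def)
    show ?thesis unfolding S vg using adj_self[OF a] by (cases "\<gamma> = \<alpha>") (simp_all add: field_simps)
  qed
  then have "formY (vb \<alpha>) y = (\<Sum>\<gamma>\<in>setA. (if \<gamma> = \<alpha> then 2 else 0) * y \<gamma>)" unfolding formY_eq by (intro sum.cong) auto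
  also have "\<dots> = (\<Sum>\<gamma>\<in>setA. if \<gamma> = \<alpha> then 2 * y \<gamma> else 0)" by (intro sum.cong) auto
  finally show ?thesis using a by simp
qed

lemma vX_pair_pistar: assumes a: "\<alpha> \<in> setA" shows "vX_pair \<alpha> (pistar y) = 2 * y \<alpha>"
proof -
  have ne: "\<beta> \<noteq> compl5 \<alpha>" "compl5 \<beta> \<noteq> \<alpha>" if "\<beta> \<in> setA" for \<beta>
    using compl5_setB[OF a] compl5_setB[OF that] setA_setB_disjoint a that by auto
  have eq: "compl5 \<beta> = compl5 \<alpha> \<longleftrightarrow> \<beta> = \<alpha>" if "\<beta> \<in> setA" for \<beta> using inj_compl5 a that by (auto simp: inj_on_def)
  have "vX_pair \<alpha> (pistar y) = (\<Sum>\<beta>\<in>setA. if \<beta> = \<alpha> then y \<beta> else 0) + (\<Sum>\<beta>\<in>setA. if \<beta> = \<alpha> then y \<beta> else 0)"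
    unfolding vX_pair_def sum_gens
    by (intro arg_cong2[of _ _ _ _ "(+)"] sum.cong refl) (auto simp: vXgen_def pistar_values ne eq)
  then show ?thesis using a by simp
qed

lemma formY_ubar:
  assumes "\<alpha> \<in> setA" shows "formY a (ubar \<alpha>) = (\<Sum>\<beta>\<in>setA. a \<beta> * adj \<beta> \<alpha>) - 2 * a \<alpha>"
proof -
  have "formY a (ubar \<alpha>) = (\<Sum>\<beta>\<in>setA. if \<beta> = \<alpha> then (\<Sum>\<gamma>\<in>setA. a \<gamma> * adj \<gamma> \<beta>) - 2 * a \<beta> else 0)"
    unfolding formY_eq by (intro sum.cong) (auto simp: ubar_def)
  then show ?thesis using assms by simp
qed

section \<open>The action of S_5 on the lattice S_Y\<close>

definition permA :: "nat \<Rightarrow> nat \<Rightarrow> (nat set \<Rightarrow> real) \<Rightarrow> nat set \<Rightarrow> real" where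
  "permA i j a = (\<lambda>S. if S \<in> setA then a (Transposition.transpose i j ` S) else 0)"

context
  fixes i j :: nat assumes ij: "i \<in> five" "j \<in> five"
begin

private abbreviation \<tau> :: "nat set \<Rightarrow> nat set" where "\<tau> \<equiv> (`) (Transposition.transpose i j)"

lemma tau_setA: "\<alpha> \<in> setA \<Longrightarrow> \<tau> \<alpha> \<in> setA"
  using transpose_setA[OF ij] by (auto simp: bij_betw_def)

lemma tau_tau: "\<tau> (\<tau> \<alpha>) = \<alpha>" by (simp add: image_image)

lemma sum_tau: "(\<Sum>\<alpha>\<in>setA. f (\<tau> \<alpha>)) = (\<Sum>\<alpha>\<in>setA. f \<alpha>)" for f :: "nat set \<Rightarrow> real"
  by (rule sum.reindex_bij_betw[OF transpose_setA[OF ij]])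

lemma adj_tau: "adj (\<tau> \<alpha>) (\<tau> \<beta>) = adj \<alpha> \<beta>"
proof -
  have "card (\<tau> \<alpha> \<inter> \<tau> \<beta>) = card (\<alpha> \<inter> \<beta>)"
    by (subst image_Int[symmetric]) (auto intro: card_image inj_on_subset[OF inj_transpose subset_UNIV])
  then show ?thesis by (simp add: adj_def)
qed

lemma permA_sum: "\<beta> \<in> setA \<Longrightarrow> (\<Sum>\<alpha>\<in>setA. a (\<tau> \<alpha>) * adj \<alpha> \<beta>) = (\<Sum>\<alpha>\<in>setA. a \<alpha> * adj \<alpha> (\<tau> \<beta>))"
  using sum_tau[of "\<lambda>\<alpha>. a \<alpha> * adj \<alpha> (\<tau> \<beta>)"] by (simp add: adj_tau)

lemma permA_formY: "formY (permA i j a) (permA i j b) = formY a b"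
proof -
  have "formY (permA i j a) (permA i j b) = (\<Sum>\<beta>\<in>setA. ((\<Sum>\<alpha>\<in>setA. a \<alpha> * adj \<alpha> (\<tau> \<beta>)) - 2 * a (\<tau> \<beta>)) * b (\<tau> \<beta>))"
    unfolding formY_eq by (intro sum.cong refl) (simp add: permA_def permA_sum cong: sum.cong)
  also have "\<dots> = formY a b" unfolding formY_eq by (rule sum_tau)
  finally show ?thesis .
qed

lemma permA_SY: assumes "a \<in> SY" shows "permA i j a \<in> SY"
proof -
  obtain dE dL where d: "\<forall>\<beta>\<in>setA. dE \<beta> \<in> \<int> \<and> dL \<beta> \<in> \<int>"
     and e: "\<forall>\<beta>\<in>setA. (\<Sum>\<alpha>\<in>setA. (a \<alpha> - dL \<alpha>) * adj \<alpha> \<beta>) = 2 * (a \<beta> - dE \<beta>) \<and>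
       (\<Sum>\<alpha>\<in>setA. (a \<alpha> - dE \<alpha>) * adj \<alpha> \<beta>) = 2 * (a \<beta> - dL \<beta>)"
    using assms unfolding SY_def mem_Collect_eq inSX_pistar by (elim conjE exE)
  have s: "(\<Sum>\<alpha>\<in>setA. (permA i j a \<alpha> - d (\<tau> \<alpha>)) * adj \<alpha> \<beta>) = (\<Sum>\<alpha>\<in>setA. (a \<alpha> - d \<alpha>) * adj \<alpha> (\<tau> \<beta>))" if "\<beta> \<in> setA" for d \<beta>
    using permA_sum[OF that, of "\<lambda>\<alpha>. a \<alpha> - d \<alpha>"] by (simp add: permA_def cong: sum.cong)
  have "inSX (pistar (permA i j a))" unfolding inSX_pistar
    by (rule exI[of _ "\<lambda>\<beta>. dE (\<tau> \<beta>)"], rule exI[of _ "\<lambda>\<beta>. dL (\<tau> \<beta>)"])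
      (use d e tau_setA in \<open>simp add: s, simp add: permA_def\<close>)
  then show ?thesis by (simp add: SY_def VY_def permA_def)
qed

lemma permA_permA: "a \<in> VY \<Longrightarrow> permA i j (permA i j a) = a"
  by (rule ext) (auto simp: permA_def VY_def tau_setA tau_tau)

lemma permA_ubar: "\<alpha> \<in> setA \<Longrightarrow> permA i j (ubar \<alpha>) = ubar (\<tau> \<alpha>)"
proof (rule ext)
  fix S assume a: "\<alpha> \<in> setA"
  have "\<tau> S = \<alpha> \<longleftrightarrow> S = \<tau> \<alpha>" using tau_tau by metis
  then show "permA i j (ubar \<alpha>) S = ubar (\<tau> \<alpha>) S" using tau_setA[OF a] by (auto simp: permA_def ubar_def)
qed

lemma permA_vb: "permA i j (vb \<alpha>) = vb (\<tau> \<alpha>)"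
proof (rule ext)
  fix S
  have "\<alpha> = \<tau> S \<longleftrightarrow> \<tau> \<alpha> = S" using tau_tau by metis
  moreover have "adj \<alpha> (\<tau> S) = adj (\<tau> \<alpha>) S" using adj_tau[of "\<tau> \<alpha>" S] tau_tau by simp
  ultimately show "permA i j (vb \<alpha>) S = vb (\<tau> \<alpha>) S" using tau_setA by (auto simp: permA_def vb_def)
qed

end

section \<open>Transport along the marking\<close>

locale marked_enriques =
  fixes \<phi> :: "(nat set \<Rightarrow> real) \<Rightarrow> real^10"
  assumes add: "\<forall>a\<in>VY. \<forall>b\<in>VY. \<phi> (\<lambda>S. a S + b S) = \<phi> a + \<phi> b"
    and scal: "\<forall>a\<in>VY. \<forall>c::real. \<phi> (\<lambda>S. c * a S) = c *\<^sub>R \<phi> a"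
    and bij: "bij_betw \<phi> VY UNIV"
    and lat: "\<phi> ` SY = L10"
    and isom: "\<forall>a\<in>VY. \<forall>b\<in>VY. form10 (\<phi> a) (\<phi> b) = formY a b"
    and cone: "\<phi> ` PY = P10"
begin

lemma form_phi: "a \<in> VY \<Longrightarrow> b \<in> VY \<Longrightarrow> form10 (\<phi> a) (\<phi> b) = formY a b" using isom by blast

lemma phi_inj: "a \<in> VY \<Longrightarrow> b \<in> VY \<Longrightarrow> \<phi> a = \<phi> b \<Longrightarrow> a = b"
  using bij by (auto simp: bij_betw_def inj_on_def)

lemma phi_obtain: obtains a where "a \<in> VY" "x = \<phi> a"
  using bij by (metis UNIV_I bij_betw_imp_surj_on imageE)

lemma phi_sum:
  assumes F: "finite F" "F \<subseteq> setA" shows "\<phi> (\<lambda>S. \<Sum>\<alpha>\<in>F. c \<alpha> * ubar \<alpha> S) = (\<Sum>\<alpha>\<in>F. c \<alpha> *\<^sub>R \<phi> (ubar \<alpha>))"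
  using F
proof (induction F rule: finite_induct)
  case empty
  have "(\<lambda>S. 0) \<in> VY" by (simp add: VY_def)
  then show ?case using scal[rule_format, of "\<lambda>S. 0" 0] by simp
next
  case (insert \<beta> F)
  have b: "ubar \<beta> \<in> VY" using insert ubar_VY by auto
  have cb: "(\<lambda>S. c \<beta> * ubar \<beta> S) \<in> VY" using b by (simp add: VY_def)
  have "(\<lambda>S. \<Sum>\<alpha>\<in>F. c \<alpha> * ubar \<alpha> S) \<in> VY"
    using insert ubar_VY by (auto simp: VY_def intro!: sum.neutral)
  then show ?case using insert add[rule_format, OF cb] scal[rule_format, OF b, of "c \<beta>"] by simp
qed

lemma phi_expand: assumes "a \<in> VY" shows "\<phi> a = (\<Sum>\<alpha>\<in>setA. a \<alpha> *\<^sub>R \<phi> (ubar \<alpha>))"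
proof -
  have "a = (\<lambda>S. \<Sum>\<alpha>\<in>setA. a \<alpha> * ubar \<alpha> S)"
  proof
    fix S
    have "(\<Sum>\<alpha>\<in>setA. a \<alpha> * ubar \<alpha> S) = (\<Sum>\<alpha>\<in>setA. if \<alpha> = S then a S else 0)"
      by (intro sum.cong) (auto simp: ubar_def)
    then show "a S = (\<Sum>\<alpha>\<in>setA. a \<alpha> * ubar \<alpha> S)" using assms by (simp add: VY_def)
  qed
  then have "\<phi> a = \<phi> (\<lambda>S. \<Sum>\<alpha>\<in>setA. a \<alpha> * ubar \<alpha> S)" by (rule arg_cong)
  then show ?thesis using phi_sum[of setA a] by simp
qed

text \<open>The uniqueness behind \<open>THE\<close> is nondegeneracy of \<open>formY\<close>,
  inherited from \<open>form10\<close> through the isometry \<phi>.\<close>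

lemma vbar_eq: assumes a: "\<alpha> \<in> setA" shows "vbar \<alpha> = vb \<alpha>"
  unfolding vbar_def
proof (rule the_equality)
  show "vb \<alpha> \<in> VY \<and> (\<forall>y\<in>VY. formY (vb \<alpha>) y = vX_pair \<alpha> (pistar y))"
    using vb_VY formY_vb[OF a] vX_pair_pistar[OF a] by simp
next
  fix v assume v: "v \<in> VY \<and> (\<forall>y\<in>VY. formY v y = vX_pair \<alpha> (pistar y))"
  have "form10 (\<phi> v - \<phi> (vb \<alpha>)) x = 0" for x
  proof -
    obtain y where y: "y \<in> VY" "x = \<phi> y" by (rule phi_obtain)
    have "formY v y = formY (vb \<alpha>) y" using v y(1) formY_vb[OF a] vX_pair_pistar[OF a] by simp
    then show ?thesis using v y vb_VY by (simp add: form_phi)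
  qed
  then have "\<phi> v = \<phi> (vb \<alpha>)" using form10_nondegenerate[of "\<phi> v - \<phi> (vb \<alpha>)"] by simp
  then show "v = vb \<alpha>" using phi_inj v vb_VY by blast
qed

lemma formY_commute: "a \<in> VY \<Longrightarrow> b \<in> VY \<Longrightarrow> formY a b = formY b a"
  using form_phi[of a b] form_phi[of b a] form10_commute by metis

lemma formY_vb_right: "a \<in> VY \<Longrightarrow> \<alpha> \<in> setA \<Longrightarrow> formY a (vb \<alpha>) = 2 * a \<alpha>"
  using formY_commute[OF _ vb_VY] formY_vb by simp

lemma sum_ubar_VY: "(\<lambda>S. \<Sum>\<alpha>\<in>setA. ubar \<alpha> S) \<in> VY"
  using ubar_VY by (auto simp: VY_def intro!: sum.neutral)

lemma phi_sum_ubar: "\<phi> (\<lambda>S. \<Sum>\<alpha>\<in>setA. ubar \<alpha> S) = (\<Sum>\<alpha>\<in>setA. \<phi> (ubar \<alpha>))"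
  using phi_sum[of setA "\<lambda>_. 1"] by simp

lemma sum_ubar_PY: "(\<lambda>S. \<Sum>\<alpha>\<in>setA. ubar \<alpha> S) \<in> PY"
proof -
  let ?u = "\<lambda>S. \<Sum>\<alpha>\<in>setA. ubar \<alpha> S"
  have u: "?u \<beta> = 1" if "\<beta> \<in> setA" for \<beta> using that by (simp add: ubar_def)
  have "formY ?u ?u = (\<Sum>\<beta>\<in>setA. 1)" unfolding formY_eq by (intro sum.cong refl) (simp add: u adj_row cong: sum.cong)
  also have "\<dots> = 10" by (simp add: card_setA)
  finally have "formY ?u ?u > 0" by simp
  then show ?thesis using sum_ubar_VY by (simp add: PY_def)
qed

definition sym_map :: "nat \<Rightarrow> nat \<Rightarrow> real^10 \<Rightarrow> real^10" where
  "sym_map i j x = \<phi> (permA i j (inv_into VY \<phi> x))"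

lemma sym_map_phi: "a \<in> VY \<Longrightarrow> sym_map i j (\<phi> a) = \<phi> (permA i j a)"
  using bij by (simp add: sym_map_def bij_betw_def)

lemma permA_VY: "permA i j a \<in> VY" by (simp add: permA_def VY_def)

lemma sym_map_isoms10: assumes ij: "i \<in> five" "j \<in> five" shows "sym_map i j \<in> isoms10"
proof (rule isoms10_I_inverse)
  let ?\<sigma> = "sym_map i j"
  show "linear ?\<sigma>"
  proof (rule linearI)
    fix x y :: "real^10" and c :: real
    obtain a where a: "a \<in> VY" "x = \<phi> a" by (rule phi_obtain)
    obtain b where b: "b \<in> VY" "y = \<phi> b" by (rule phi_obtain)
    have ab: "(\<lambda>S. a S + b S) \<in> VY" "(\<lambda>S. c * a S) \<in> VY" using a b by (auto simp: VY_def)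
    have p: "permA i j (\<lambda>S. a S + b S) = (\<lambda>S. permA i j a S + permA i j b S)"
      "permA i j (\<lambda>S. c * a S) = (\<lambda>S. c * permA i j a S)" by (auto simp: permA_def)
    have "?\<sigma> (x + y) = ?\<sigma> (\<phi> (\<lambda>S. a S + b S))" using add a b by simp
    also have "\<dots> = \<phi> (permA i j a) + \<phi> (permA i j b)" unfolding sym_map_phi[OF ab(1)] p
      using add permA_VY by simp
    finally show "?\<sigma> (x + y) = ?\<sigma> x + ?\<sigma> y" using a b by (simp add: sym_map_phi)
    have "?\<sigma> (c *\<^sub>R x) = ?\<sigma> (\<phi> (\<lambda>S. c * a S))" using scal a by simp
    also have "\<dots> = c *\<^sub>R \<phi> (permA i j a)" unfolding sym_map_phi[OF ab(2)] p using scal permA_VY by simp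
    finally show "?\<sigma> (c *\<^sub>R x) = c *\<^sub>R ?\<sigma> x" using a by (simp add: sym_map_phi)
  qed
  show "form10 (?\<sigma> x) (?\<sigma> y) = form10 x y" for x y
  proof -
    obtain a where a: "a \<in> VY" "x = \<phi> a" by (rule phi_obtain)
    obtain b where b: "b \<in> VY" "y = \<phi> b" by (rule phi_obtain)
    show ?thesis using a b permA_VY by (simp add: sym_map_phi form_phi permA_formY[OF ij])
  qed
  have SYV: "a \<in> VY" if "a \<in> SY" for a using that by (simp add: SY_def)
  show L: "?\<sigma> x \<in> L10" if "x \<in> L10" for x
  proof -
    have "x \<in> \<phi> ` SY" using that lat by simp
    then obtain a where a: "a \<in> SY" "x = \<phi> a" by (elim imageE)
    have "\<phi> (permA i j a) \<in> \<phi> ` SY" using permA_SY[OF ij a(1)] by (rule imageI)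
    then show ?thesis unfolding lat a(2) sym_map_phi[OF SYV[OF a(1)]] .
  qed
  show "\<exists>y\<in>L10. ?\<sigma> y = x" if "x \<in> L10" for x
  proof
    obtain a where a: "a \<in> VY" "x = \<phi> a" by (rule phi_obtain)
    show "?\<sigma> (?\<sigma> x) = x" using a permA_VY by (simp add: sym_map_phi permA_permA[OF ij])
    show "?\<sigma> x \<in> L10" using L that by blast
  qed
  let ?u = "\<lambda>S. \<Sum>\<alpha>\<in>setA. ubar \<alpha> S"
  show "\<phi> ?u \<in> P10" unfolding cone[symmetric] using sum_ubar_PY by (rule imageI)
  have "permA i j ?u = ?u"
  proof
    fix S
    have "?u T = (if T \<in> setA then 1 else 0)" for T using ubar_VY by (auto simp: ubar_def)
    then show "permA i j ?u S = ?u S" using tau_setA[OF ij, of S] by (simp add: permA_def)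
  qed
  then show "?\<sigma> (\<phi> ?u) \<in> P10" using sym_map_phi[OF sum_ubar_VY] \<open>\<phi> ?u \<in> P10\<close> by simp
qed

sublocale petersen_frame "\<lambda>\<alpha>. \<phi> (ubar \<alpha>)" "\<lambda>\<alpha>. \<phi> (vb \<alpha>)"
proof
  fix \<alpha> \<beta> :: "nat set" and x :: "real^10" and i j :: nat
  show "\<alpha> \<in> setA \<Longrightarrow> \<phi> (ubar \<alpha>) \<in> L10" unfolding lat[symmetric] by (intro imageI ubar_SY)
  show "\<alpha> \<in> setA \<Longrightarrow> \<phi> (vb \<alpha>) \<in> L10" unfolding lat[symmetric] by (intro imageI vb_SY)
  show "form10 (\<phi> (ubar \<alpha>)) (\<phi> (ubar \<beta>)) = adj \<alpha> \<beta> - (if \<alpha> = \<beta> then 2 else 0)" if "\<alpha> \<in> setA" "\<beta> \<in> setA"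
  proof -
    have "(\<Sum>\<gamma>\<in>setA. ubar \<alpha> \<gamma> * adj \<gamma> \<beta>) = (\<Sum>\<gamma>\<in>setA. if \<gamma> = \<alpha> then adj \<gamma> \<beta> else 0)"
      by (intro sum.cong) (auto simp: ubar_def)
    then show ?thesis using that by (simp add: form_phi ubar_VY formY_ubar) (simp add: ubar_def)
  qed
  show "form10 (\<phi> (vb \<alpha>)) (\<phi> (vb \<beta>)) = 1 - adj \<alpha> \<beta> - (if \<alpha> = \<beta> then 3 else 0)" if "\<alpha> \<in> setA" "\<beta> \<in> setA"
    using that by (simp add: form_phi vb_VY formY_vb_right) (simp add: vb_def)
  show "form10 (\<phi> (ubar \<alpha>)) (\<phi> (vb \<beta>)) = (if \<alpha> = \<beta> then 2 else 0)" if "\<alpha> \<in> setA" "\<beta> \<in> setA"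
    using that by (simp add: form_phi vb_VY ubar_VY formY_vb_right) (simp add: ubar_def)
  \<comment> \<open>The coordinate of \<open>x\<close> along \<open>ubar \<alpha>\<close> is half
    its pairing with \<open>vb \<alpha>\<close>.\<close>
  show "2 *\<^sub>R x = (\<Sum>\<alpha>\<in>setA. form10 x (\<phi> (vb \<alpha>)) *\<^sub>R \<phi> (ubar \<alpha>))"
  proof -
    obtain a where a: "a \<in> VY" "x = \<phi> a" by (rule phi_obtain)
    have "(\<Sum>\<alpha>\<in>setA. form10 x (\<phi> (vb \<alpha>)) *\<^sub>R \<phi> (ubar \<alpha>)) = (\<Sum>\<alpha>\<in>setA. 2 *\<^sub>R (a \<alpha> *\<^sub>R \<phi> (ubar \<alpha>)))"
      using a by (intro sum.cong) (simp_all add: form_phi vb_VY formY_vb_right)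
    also have "\<dots> = 2 *\<^sub>R \<phi> a" unfolding phi_expand[OF a(1)] by (rule scaleR_sum_right[symmetric])
    finally show ?thesis unfolding a(2) ..
  qed
  show "(\<Sum>\<alpha>\<in>setA. \<phi> (ubar \<alpha>)) \<in> P10" unfolding cone[symmetric] phi_sum_ubar[symmetric] using sum_ubar_PY by (rule imageI)
  show "\<exists>\<sigma>\<in>isoms10. \<forall>\<alpha>\<in>setA. \<sigma> (\<phi> (ubar \<alpha>)) = \<phi> (ubar (Transposition.transpose i j ` \<alpha>)) \<and>
      \<sigma> (\<phi> (vb \<alpha>)) = \<phi> (vb (Transposition.transpose i j ` \<alpha>))" if "i \<in> five" "j \<in> five"
    using sym_map_isoms10[OF that] sym_map_phi ubar_VY vb_VY permA_ubar[OF that] permA_vb[OF that]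
    by (intro bexI[of _ "sym_map i j"]) auto
qed

lemma phi_DY: "\<phi> ` DY = D"
proof -
  have PYV: "y \<in> VY" if "y \<in> PY" for y using that by (simp add: PY_def)
  have eq: "form10 (\<phi> y) (\<phi> (ubar \<alpha>)) = formY y (ubar \<alpha>)" "form10 (\<phi> y) (\<phi> (vb \<alpha>)) = formY y (vbar \<alpha>)"
    if "y \<in> PY" "\<alpha> \<in> setA" for y \<alpha>
    using that PYV by (simp_all add: form_phi ubar_VY vb_VY vbar_eq)
  show ?thesis
  proof (intro set_eqI iffI)
    fix x assume "x \<in> \<phi> ` DY"
    then obtain y where y: "y \<in> PY" "x = \<phi> y" "\<forall>\<alpha>\<in>setA. formY y (ubar \<alpha>) \<ge> 0 \<and> formY y (vbar \<alpha>) \<ge> 0"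
      by (auto simp: DY_def)
    then show "x \<in> D" unfolding D_def using cone eq by auto
  next
    fix x assume x: "x \<in> D"
    then obtain y where y: "y \<in> PY" "x = \<phi> y" using cone by (auto simp: D_def)
    then have "y \<in> DY" using x eq[OF y(1)] by (simp add: D_def DY_def)
    then show "x \<in> \<phi> ` DY" using y by blast
  qed
qed

end

theorem theorem1p8:
  fixes \<phi> :: "(nat set \<Rightarrow> real) \<Rightarrow> real^10"
  assumes add: "\<forall>a\<in>VY. \<forall>b\<in>VY. \<phi> (\<lambda>S. a S + b S) = \<phi> a + \<phi> b"
    and scal: "\<forall>a\<in>VY. \<forall>c::real. \<phi> (\<lambda>S. c * a S) = c *\<^sub>R \<phi> a"
    and bij: "bij_betw \<phi> VY UNIV"
    and lat: "\<phi> ` SY = L10"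
    and isom: "\<forall>a\<in>VY. \<forall>b\<in>VY. form10 (\<phi> a) (\<phi> b) = formY a b"
    and cone: "\<phi> ` PY = P10"
  shows "\<exists>\<C>. finite \<C> \<and> (\<forall>C\<in>\<C>. vinberg_chamber C)
             \<and> card \<C> = 2^14 * 3 * 5 * 7 * 17 * 31 \<and> \<Union>\<C> = \<phi> ` DY"
proof -
  interpret marked_enriques \<phi> by (rule marked_enriques.intro[OF assms])
  show ?thesis unfolding phi_DY by (rule D_vinberg_chambers)
qed

end
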